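(* Let $d\in\mathbb{N}$, let $\Omega \subset \mathbb{R}^{d}$ be open, let $p\in\mathbb{N}\cup\{\infty\}$, and let $\psi \in C^{p} (\Omega, \Omega)$ and $\omega \in C^{p} (\Omega, \mathbb{K})$. Let $C_{\omega,\psi}:C^p(\Omega,\mathbb{K})\to C^p(\Omega,\mathbb{K})$, $f\mapsto \omega\cdot(f\circ\psi)$. Then the following are equivalent: (1) $C_{\omega, \psi}$ is supercyclic on $C^{p} (\Omega, \mathbb{K})$. (2) $C_{\omega, \psi}$ is weakly mixing on $C^{p} (\Omega, \mathbb{K})$. (3) The following conditions are all satisfied: (i) for every $x \in \Omega$, $\omega (x) \neq 0$; (ii) $\psi$ is injective; (iii) for every $x \in \Omega$, $\det[\psi' (x)] \neq 0$; (iv) $\psi$ is run-away on $\Omega$. Moreover, $C_{\omega, \psi}$ is strongly supercyclic if and only if $C_{\omega, \psi}$ is mixing, and if and only if both $\psi$ is strongly run-away on $\Omega$ and conditions (i)-(iii) hold.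
   Context: $\mathbb{K}$ is $\mathbb{R}$ or $\mathbb{C}$; $\mathbb{N}$ is the set of positive integers and $\mathbb{N}_0=\mathbb{N}\cup\{0\}$. For $p\in\mathbb{N}\cup\{\infty\}$, $C^p(\Omega,\mathbb{K})$ is the separable Fréchet space of functions $f:\Omega\to\mathbb{K}$ all of whose partial derivatives of order at most $p$ (of every order, if $p=\infty$) exist and are continuous, with the seminorms $\|f\|_{K,n}=\max_{|\alpha|\le n}\max_{x\in K}\left|\frac{\partial^{|\alpha|}f}{\partial x^\alpha}(x)\right|$, $K\subset\Omega$ compact, $n\in\mathbb{N}_0$, $n\le p$. $C^p(\Omega,\Omega)$ is the set of maps $F=(f_1,\dots,f_d):\Omega\to\Omega$ with every $f_j\in C^p(\Omega,\mathbb{R})$; $[F'(x)]$ is the Jacobian matrix of $F$ at $x$. $\psi_n$ denotes the $n$-fold composition of $\psi$ with itself. $\psi$ is run-away (respectively, strongly run-away) if for each compact $K\subset\Omega$ we have $\psi_n(K)\cap K=\emptyset$ for some $n\in\mathbb{N}$ (respectively, for all sufficiently large $n\in\mathbb{N}$). Let $T$ be an operator (continuous linear self-map) on a separable Fréchet space $X$ over $\mathbb{K}$. $T$ is supercyclic if there is $g\in X$ such that $\{\lambda T^ng: n\in\mathbb{N}_0,\lambda\in\mathbb{K}\}$ is dense in $X$. $T$ is strongly supercyclic if for every strictly increasing sequence $(m_k)_{k\ge1}$ of positive integers there is $g\in X$ such that $\{\lambda h: \lambda\in\mathbb{K},\ h\in\{g,T^{m_1}g,T^{m_2}g,\dots\}\}$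 is dense in $X$. $T$ is transitive (respectively, mixing) if for all non-empty open $U,V\subset X$, $T^n(U)\cap V\neq\emptyset$ for some $n$ (respectively, for all large $n$). $T$ is weakly mixing if $T\oplus T:(x,y)\mapsto(Tx,Ty)$ is transitive on $X\times X$. *)

theory Defs
  imports "HOL-Analysis.Analysis"
begin

text \<open>The scalar field is a type in the classes \<open>real_normed_field\<close> and \<open>euclidean_space\<close>.
  A commutative real division algebra of finite dimension is the real or the complex field
  (Frobenius), and a multiplicative norm on it is the usual absolute value, so up to isometric
  isomorphism the instances are exactly the types \<open>real\<close> and \<open>complex\<close>.\<close>

section \<open>Spaces of continuously differentiable functions\<close>

definition partial_deriv :: "'d::finite \<Rightarrow> (real^'d \<Rightarrow> 'k::real_normed_vector) \<Rightarrow> real^'d \<Rightarrow> 'k"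
  where "partial_deriv i f x = vector_derivative (\<lambda>t. f (x + t *\<^sub>R axis i 1)) (at 0)"

text \<open>A partial derivative of order \<open>n\<close> is indexed by the list, of length \<open>n\<close>, of the
  coordinates with respect to which one differentiates. At points of an open set, the values
  depend only on the values of the function on that set.\<close>

definition partials :: "'d::finite list \<Rightarrow> (real^'d \<Rightarrow> 'k::real_normed_vector) \<Rightarrow> real^'d \<Rightarrow> 'k"
  where "partials is f = foldr partial_deriv is f"

definition Cp_on :: "enat \<Rightarrow> (real^'d) set \<Rightarrow> (real^'d::finite \<Rightarrow> 'k::real_normed_vector) \<Rightarrow> bool"
  where "Cp_on p \<Omega> f \<longleftrightarrow>
    (\<forall>i is. enat (length (i # is)) \<le> p \<longrightarrow>
       (\<forall>x\<in>\<Omega>. (\<lambda>t. partials is f (x + t *\<^sub>R axis i 1)) differentiable (at 0))) \<and>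
    (\<forall>is. enat (length is) \<le> p \<longrightarrow> continuous_on \<Omega> (partials is f))"

text \<open>Functions with domain \<open>\<Omega>\<close> are represented as elements of \<open>extensional \<Omega>\<close>.\<close>

definition Cp_carrier :: "enat \<Rightarrow> (real^'d) set \<Rightarrow> (real^'d::finite \<Rightarrow> 'k::real_normed_vector) set"
  where "Cp_carrier p \<Omega> = {f \<in> extensional \<Omega>. Cp_on p \<Omega> f}"

definition Cp_self_map :: "enat \<Rightarrow> (real^'d) set \<Rightarrow> (real^'d::finite \<Rightarrow> real^'d) \<Rightarrow> bool"
  where "Cp_self_map p \<Omega> \<psi> \<longleftrightarrow> \<psi> ` \<Omega> \<subseteq> \<Omega> \<and> (\<forall>j. Cp_on p \<Omega> (\<lambda>x. \<psi> x $ j))"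

text \<open>For functions of class \<open>C\<^sup>n\<close> the order of differentiation is irrelevant, so the supremum
  over lists below is the maximum over multi-indices. Inserting \<open>0\<close> only matters for empty \<open>K\<close>.\<close>

definition Cp_seminorm :: "(real^'d) set \<Rightarrow> nat \<Rightarrow> (real^'d::finite \<Rightarrow> 'k::real_normed_vector) \<Rightarrow> real"
  where "Cp_seminorm K n f =
    Sup (insert 0 {norm (partials is f x) | is x. length is \<le> n \<and> x \<in> K})"

definition Cp_topology :: "enat \<Rightarrow> (real^'d) set \<Rightarrow> (real^'d::finite \<Rightarrow> 'k::real_normed_vector) topology"
  where "Cp_topology p \<Omega> = topology_generated_by
    {{g \<in> Cp_carrier p \<Omega>. Cp_seminorm K n (\<lambda>x. g x - f x) < e} | f K n e.
       f \<in> Cp_carrier p \<Omega> \<and> compact K \<and> K \<subseteq> \<Omega> \<and> enat n \<le> p \<and> 0 < e}"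

definition fun_scale :: "'a set \<Rightarrow> 'k::times \<Rightarrow> ('a \<Rightarrow> 'k) \<Rightarrow> 'a \<Rightarrow> 'k"
  where "fun_scale \<Omega> c f = restrict (\<lambda>x. c * f x) \<Omega>"

definition weighted_comp :: "'a set \<Rightarrow> ('a \<Rightarrow> 'k::times) \<Rightarrow> ('a \<Rightarrow> 'a) \<Rightarrow> ('a \<Rightarrow> 'k) \<Rightarrow> 'a \<Rightarrow> 'k"
  where "weighted_comp \<Omega> \<omega> \<psi> f = restrict (\<lambda>x. \<omega> x * f (\<psi> x)) \<Omega>"

section \<open>Dynamics of operators\<close>

text \<open>The vector space is given by its topology \<open>X\<close>, with carrier \<open>topspace X\<close>, and its scalar
  multiplication \<open>sc\<close>.\<close>

definition supercyclic :: "'a topology \<Rightarrow> ('k \<Rightarrow> 'a \<Rightarrow> 'a) \<Rightarrow> ('a \<Rightarrow> 'a) \<Rightarrow> bool"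
  where "supercyclic X sc T \<longleftrightarrow>
    (\<exists>g\<in>topspace X. X closure_of {sc c ((T ^^ n) g) | c n. True} = topspace X)"

definition strongly_supercyclic :: "'a topology \<Rightarrow> ('k \<Rightarrow> 'a \<Rightarrow> 'a) \<Rightarrow> ('a \<Rightarrow> 'a) \<Rightarrow> bool"
  where "strongly_supercyclic X sc T \<longleftrightarrow>
    (\<forall>m::nat \<Rightarrow> nat. strict_mono m \<and> (\<forall>k. 0 < m k) \<longrightarrow>
       (\<exists>g\<in>topspace X.
          X closure_of {sc c h | c h. h \<in> insert g (range (\<lambda>k. (T ^^ m k) g))} = topspace X))"

definition transitive :: "'a topology \<Rightarrow> ('a \<Rightarrow> 'a) \<Rightarrow> bool"
  where "transitive X T \<longleftrightarrow>
    (\<forall>U V. openin X U \<and> openin X V \<and> U \<noteq> {} \<and> V \<noteq> {} \<longrightarrow> (\<exists>n. (T ^^ n) ` U \<inter> V \<noteq> {}))"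

definition mixing :: "'a topology \<Rightarrow> ('a \<Rightarrow> 'a) \<Rightarrow> bool"
  where "mixing X T \<longleftrightarrow>
    (\<forall>U V. openin X U \<and> openin X V \<and> U \<noteq> {} \<and> V \<noteq> {} \<longrightarrow>
       (\<exists>N. \<forall>n\<ge>N. (T ^^ n) ` U \<inter> V \<noteq> {}))"

definition weakly_mixing :: "'a topology \<Rightarrow> ('a \<Rightarrow> 'a) \<Rightarrow> bool"
  where "weakly_mixing X T \<longleftrightarrow> transitive (prod_topology X X) (map_prod T T)"

section \<open>Run-away maps\<close>

definition run_away :: "'a::topological_space set \<Rightarrow> ('a \<Rightarrow> 'a) \<Rightarrow> bool"
  where "run_away \<Omega> \<psi> \<longleftrightarrow>
    (\<forall>K. compact K \<and> K \<subseteq> \<Omega> \<longrightarrow> (\<exists>n\<ge>1. (\<psi> ^^ n) ` K \<inter> K = {}))"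

definition strongly_run_away :: "'a::topological_space set \<Rightarrow> ('a \<Rightarrow> 'a) \<Rightarrow> bool"
  where "strongly_run_away \<Omega> \<psi> \<longleftrightarrow>
    (\<forall>K. compact K \<and> K \<subseteq> \<Omega> \<longrightarrow> (\<exists>N. \<forall>n\<ge>N. (\<psi> ^^ n) ` K \<inter> K = {}))"

end

(* For x and y = psi^n x the ratios of f, C f, C^2 f, ... at y are those of C^n f at x, since C acts on
   such ratios by composition with psi. If a compact set K meets all its images, an f close to 1 thus has
   no multiple of C^n f close to h, for a suitable h: at 2 d + 2 times of the orbit, a generic h has other
   ratios than 1 at all pairs of points of K. This needs orbits without repetition. Periodic points are
   excluded because the ratio of C^n g at x and at psi x would take finitely many values, fixed points
   because the logarithmic derivatives of C^n g would form a dense orbit of an affine map of R^d. Similarly,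
   if one of (i)-(iii) fails, two functionals map the range of C to a line.
   Conversely, a supercyclic vector is a locally finite sum of functions with disjoint compact supports,
   each of which is moved by a power of C to a given function on a given compact set. *)
theory Submission
  imports Defs
begin

section \<open>Continuously differentiable functions\<close>

primrec Ck :: "nat \<Rightarrow> (real^'d::finite) set \<Rightarrow> (real^'d \<Rightarrow> 'b::real_normed_vector) \<Rightarrow> bool" where
  "Ck 0 S f = continuous_on S f"
| "Ck (Suc n) S f = ((\<forall>x\<in>S. f differentiable (at x)) \<and>
     (\<forall>i. Ck n S (\<lambda>x. frechet_derivative f (at x) (axis i 1))))"

lemma frechet_derivative_cong_open:
  assumes "open S" "x \<in> S" "\<And>y. y \<in> S \<Longrightarrow> f y = g y"
  shows "f differentiable (at x) \<longleftrightarrow> g differentiable (at x)"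
    and "frechet_derivative f (at x) = frechet_derivative g (at x)"
proof -
  have "(f has_derivative D) (at x) \<longleftrightarrow> (g has_derivative D) (at x)" for D
    using assms has_derivative_transform_within_open[of _ D x UNIV S] by metis
  then show "f differentiable (at x) \<longleftrightarrow> g differentiable (at x)"
    "frechet_derivative f (at x) = frechet_derivative g (at x)"
    by (simp_all add: differentiable_def frechet_derivative_def)
qed

lemma Ck_cong:
  assumes "open S" "Ck n S f" "\<And>x. x \<in> S \<Longrightarrow> f x = g x"
  shows "Ck n S g"
  using assms(2,3)
proof (induction n arbitrary: f g)
  case 0
  then show ?case using continuous_on_cong by fastforce
next
  case (Suc n)
  have *: "frechet_derivative f (at x) (axis i 1) = frechet_derivative g (at x) (axis i 1)" if "x \<in> S" for x i
    using frechet_derivative_cong_open(2)[of S x f g] assms(1) Suc.prems(2) that by metis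
  have "Ck n S (\<lambda>x. frechet_derivative g (at x) (axis i 1))" for i
    by (rule Suc.IH[of "\<lambda>x. frechet_derivative f (at x) (axis i 1)"]) (use Suc.prems * in auto)
  moreover have "g differentiable (at x)" if "x \<in> S" for x
    using frechet_derivative_cong_open(1)[of S x f g] assms(1) Suc.prems that by auto
  ultimately show ?case by simp
qed

lemma Ck_SucI:
  assumes "open S" "\<And>x. x \<in> S \<Longrightarrow> (f has_derivative f' x) (at x)"
    and "\<And>i. Ck n S (\<lambda>x. f' x (axis i 1))"
  shows "Ck (Suc n) S f"
proof -
  have "f' x = frechet_derivative f (at x)" if "x \<in> S" for x
    using frechet_derivative_at assms(2) that by blast
  then show ?thesis
    using assms by (auto simp: differentiable_def intro: Ck_cong[OF assms(1) assms(3)])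
qed

lemma Ck_SucD:
  assumes "Ck (Suc n) S f"
  shows "x \<in> S \<Longrightarrow> (f has_derivative frechet_derivative f (at x)) (at x)"
    and "Ck n S (\<lambda>x. frechet_derivative f (at x) (axis i 1))"
  using assms by (auto simp: frechet_derivative_works)

lemma Ck_pred: "Ck (Suc n) S f \<Longrightarrow> Ck n S f"
proof (induction n arbitrary: f)
  case 0
  then show ?case
    by (auto intro!: differentiable_imp_continuous_on simp: differentiable_on_def differentiable_at_withinI)
next
  case (Suc n)
  then show ?case by auto
qed

declare Ck.simps(2) [simp del]

lemma Ck_le: "Ck n S f \<Longrightarrow> m \<le> n \<Longrightarrow> Ck m S f"
  by (induction n) (auto simp: le_Suc_eq dest: Ck_pred)

lemma Ck_continuous_on: "Ck n S f \<Longrightarrow> continuous_on S f"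
  using Ck_le[of n S f 0] by simp

lemma Ck_subset: "Ck n S f \<Longrightarrow> T \<subseteq> S \<Longrightarrow> Ck n T f"
  by (induction n arbitrary: f) (auto intro: continuous_on_subset simp: Ck.simps(2))

lemma Ck_local:
  assumes "open S" "\<And>x. x \<in> S \<Longrightarrow> \<exists>T. open T \<and> x \<in> T \<and> Ck n T f"
  shows "Ck n S f"
  using assms(2)
proof (induction n arbitrary: f)
  case 0
  show ?case
  proof -
    have "isCont f x" if "x \<in> S" for x
      using 0[OF that] continuous_on_eq_continuous_at by auto
    then show ?thesis by (simp add: continuous_at_imp_continuous_on)
  qed
next
  case (Suc n)
  have "f differentiable (at x)" if "x \<in> S" for x
    using Suc.prems[OF that] by (auto simp: Ck.simps(2))
  moreover have "Ck n S (\<lambda>x. frechet_derivative f (at x) (axis i 1))" for i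
    by (rule Suc.IH) (use Suc.prems in \<open>fastforce simp: Ck.simps(2)\<close>)
  ultimately show ?case by (simp add: Ck.simps(2))
qed

lemma Ck_const: "Ck n S (\<lambda>x. c)"
  by (induction n arbitrary: c) (auto simp: Ck.simps(2))

lemma Ck_add:
  assumes "open S" "Ck n S f" "Ck n S g"
  shows "Ck n S (\<lambda>x. f x + g x)"
  using assms(2,3)
proof (induction n arbitrary: f g)
  case 0
  then show ?case by (simp add: continuous_on_add)
next
  case (Suc n)
  show ?case
    by (rule Ck_SucI[where f' = "\<lambda>x v. frechet_derivative f (at x) v + frechet_derivative g (at x) v"])
      (use Suc assms(1) in \<open>auto intro: has_derivative_add Ck_SucD\<close>)
qed

lemma Ck_sum:
  assumes "open S" "\<And>i. i \<in> I \<Longrightarrow> Ck n S (f i)"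
  shows "Ck n S (\<lambda>x. \<Sum>i\<in>I. f i x)"
  using assms(2) by (induction I rule: infinite_finite_induct) (auto intro: Ck_const Ck_add assms(1))

lemma Ck_bilinear:
  assumes "open S" "bounded_bilinear B" "Ck n S f" "Ck n S g"
  shows "Ck n S (\<lambda>x. B (f x) (g x))"
  using assms(3,4)
proof (induction n arbitrary: f g)
  case 0
  then show ?case using bounded_bilinear.continuous_on[OF assms(2)] by auto
next
  case (Suc n)
  show ?case
  proof (rule Ck_SucI[where f' = "\<lambda>x v. B (f x) (frechet_derivative g (at x) v)
      + B (frechet_derivative f (at x) v) (g x)"])
    show "Ck n S (\<lambda>x. B (f x) (frechet_derivative g (at x) (axis i 1)) +
        B (frechet_derivative f (at x) (axis i 1)) (g x))" for i
      using Suc by (intro Ck_add assms(1) Suc.IH) (auto intro: Ck_pred Ck_SucD)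
  qed (use Suc.prems assms in \<open>auto intro!: bounded_bilinear.FDERIV intro: Ck_SucD\<close>)
qed

lemmas Ck_scaleR = Ck_bilinear[OF _ bounded_bilinear_scaleR]
lemmas Ck_mult = Ck_bilinear[OF _ bounded_bilinear_mult]

lemma Ck_diff:
  assumes "open S" "Ck n S f" "Ck n S g"
  shows "Ck n S (\<lambda>x. f x - g x)"
  using Ck_add[OF assms(1,2) Ck_scaleR[OF assms(1) Ck_const[of n S "- 1"] assms(3)]] by simp

lemma Ck_prod:
  fixes f :: "'i \<Rightarrow> real^'d::finite \<Rightarrow> 'a::real_normed_field"
  assumes "open S" "\<And>i. i \<in> I \<Longrightarrow> Ck n S (f i)"
  shows "Ck n S (\<lambda>x. \<Prod>i\<in>I. f i x)"
  using assms(2) by (induction I rule: infinite_finite_induct) (auto intro: Ck_const Ck_mult assms(1))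

lemma Ck_inverse:
  fixes f :: "real^'d::finite \<Rightarrow> 'a::real_normed_field"
  assumes "open S" "Ck n S f" "\<And>x. x \<in> S \<Longrightarrow> f x \<noteq> 0"
  shows "Ck n S (\<lambda>x. inverse (f x))"
  using assms(2)
proof (induction n)
  case 0
  then show ?case using assms(3) by (auto intro: continuous_on_inverse)
next
  case (Suc n)
  show ?case
  proof (rule Ck_SucI[where f' = "\<lambda>x v. (- 1) *\<^sub>R (inverse (f x) * frechet_derivative f (at x) v * inverse (f x))"])
    show "Ck n S (\<lambda>x. (- 1) *\<^sub>R (inverse (f x) * frechet_derivative f (at x) (axis i 1) * inverse (f x)))" for i
      using Suc by (intro Ck_scaleR Ck_mult Ck_const assms(1)) (auto intro: Ck_pred Ck_SucD)
    show "((\<lambda>x. inverse (f x)) has_derivative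
         (\<lambda>v. (- 1) *\<^sub>R (inverse (f x) * frechet_derivative f (at x) v * inverse (f x)))) (at x)"
      if "x \<in> S" for x
      using Deriv.has_derivative_inverse[OF assms(3)[OF that] Ck_SucD(1)[OF Suc.prems that]] by simp
  qed (use assms(1) in auto)
qed

lemma bounded_linear_axis: "bounded_linear (axis j :: 'b::real_normed_vector \<Rightarrow> 'b^'d::finite)"
proof (rule bounded_linear_intro[where K = 1])
  show "norm (axis j x :: 'b^'d) \<le> norm x * 1" for x
  proof -
    have "norm (axis j x :: 'b^'d) \<le> (\<Sum>i\<in>UNIV. norm ((axis j x :: 'b^'d) $ i))"
      unfolding norm_vec_def by (rule L2_set_le_sum) simp
    also have "\<dots> = norm x"
      by (simp add: axis_def if_distrib[of norm] cong: if_cong)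
    finally show ?thesis by simp
  qed
qed (auto simp: vec_eq_iff axis_def)

lemma sum_axis: "(\<Sum>j\<in>UNIV. axis j (y $ j)) = (y :: 'b::real_normed_vector^'d::finite)"
  by (simp add: vec_eq_iff axis_def)

lemma has_derivative_vec_components:
  fixes \<phi> :: "'a::real_normed_vector \<Rightarrow> 'b::real_normed_vector^'d::finite"
  assumes "\<And>j. ((\<lambda>x. \<phi> x $ j) has_derivative (\<lambda>v. \<phi>' v $ j)) F"
  shows "(\<phi> has_derivative \<phi>') F"
proof -
  have "((\<lambda>x. \<Sum>j\<in>UNIV. axis j (\<phi> x $ j)) has_derivative (\<lambda>v. \<Sum>j\<in>UNIV. axis j (\<phi>' v $ j))) F"
    by (intro has_derivative_sum bounded_linear.has_derivative[OF bounded_linear_axis] assms)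
  then show ?thesis
    by (simp add: sum_axis)
qed

lemma has_derivative_expand:
  fixes f' :: "real^'d::finite \<Rightarrow> 'b::real_normed_vector"
  assumes "(f has_derivative f') F"
  shows "f' v = (\<Sum>j\<in>UNIV. (v $ j) *\<^sub>R f' (axis j 1))"
proof -
  have l: "linear f'"
    using assms has_derivative_linear by blast
  have "f' v = f' (\<Sum>j\<in>UNIV. (v $ j) *\<^sub>R axis j 1)"
    by (simp add: basis_expansion flip: scalar_mult_eq_scaleR)
  then show ?thesis
    by (simp add: linear_sum[OF l] linear_cmul[OF l])
qed

lemma Ck_compose:
  fixes \<phi> :: "real^'e::finite \<Rightarrow> real^'d::finite"
  assumes "open S" "open T" "\<phi> ` S \<subseteq> T" "Ck n T f" "\<And>j. Ck n S (\<lambda>x. \<phi> x $ j)"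
  shows "Ck n S (\<lambda>x. f (\<phi> x))"
  using assms(4,5)
proof (induction n arbitrary: f)
  case 0
  have "continuous_on S (\<lambda>x. \<chi> j. \<phi> x $ j)"
    by (rule continuous_on_vec_lambda) (use 0 in auto)
  then have "continuous_on S \<phi>" by simp
  from continuous_on_compose2[OF _ this assms(3)] show ?case
    using 0 by simp
next
  case (Suc n)
  define \<phi>' where "\<phi>' x v = (\<chi> j. frechet_derivative (\<lambda>x. \<phi> x $ j) (at x) v)" for x v
  have d\<phi>: "(\<phi> has_derivative \<phi>' x) (at x)" if "x \<in> S" for x
    by (rule has_derivative_vec_components)
      (use Ck_SucD(1)[OF Suc.prems(2) that] in \<open>simp add: \<phi>'_def\<close>)
  show ?case
  proof (rule Ck_SucI[where f' = "\<lambda>x v. frechet_derivative f (at (\<phi> x)) (\<phi>' x v)"])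
    show "((\<lambda>x. f (\<phi> x)) has_derivative (\<lambda>v. frechet_derivative f (at (\<phi> x)) (\<phi>' x v))) (at x)"
      if "x \<in> S" for x
      using has_derivative_compose[OF d\<phi>[OF that], of f "frechet_derivative f (at (\<phi> x))"]
        Ck_SucD(1)[OF Suc.prems(1), of "\<phi> x"] that assms(3) by auto
    show "Ck n S (\<lambda>x. frechet_derivative f (at (\<phi> x)) (\<phi>' x (axis i 1)))" for i
    proof (rule Ck_cong[OF assms(1)])
      show "Ck n S (\<lambda>x. \<Sum>j\<in>UNIV. frechet_derivative (\<lambda>x. \<phi> x $ j) (at x) (axis i 1) *\<^sub>R
          (\<lambda>y. frechet_derivative f (at y) (axis j 1)) (\<phi> x))"
        by (intro Ck_sum Ck_scaleR assms(1) Ck_SucD(2)[OF Suc.prems(2)] Suc.IH)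
          (use Suc.prems in \<open>auto intro: Ck_SucD Ck_pred\<close>)
    next
      fix x assume "x \<in> S"
      then have "(f has_derivative frechet_derivative f (at (\<phi> x))) (at (\<phi> x))"
        using Ck_SucD(1)[OF Suc.prems(1)] assms(3) by blast
      from has_derivative_expand[OF this, of "\<phi>' x (axis i 1)"]
      show "(\<Sum>j\<in>UNIV. frechet_derivative (\<lambda>x. \<phi> x $ j) (at x) (axis i 1) *\<^sub>R
          (\<lambda>y. frechet_derivative f (at y) (axis j 1)) (\<phi> x)) = frechet_derivative f (at (\<phi> x)) (\<phi>' x (axis i 1))"
        by (simp add: \<phi>'_def)
    qed
  qed (use assms(1) in auto)
qed

lemma Ck_coord: "open S \<Longrightarrow> Ck n S (\<lambda>x. x $ i)"
proof (induction n)
  case 0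
  then show ?case by (auto intro: continuous_intros)
next
  case (Suc n)
  then show ?case
    by (intro Ck_SucI[where f' = "\<lambda>x v. v $ i"])
      (auto intro: Ck_const bounded_linear_vec_nth bounded_linear_imp_has_derivative)
qed

lemma partial_deriv_cong:
  assumes "open S" "x \<in> S" "\<And>y. y \<in> S \<Longrightarrow> f y = g y"
  shows "partial_deriv i f x = partial_deriv i g x"
proof -
  have "\<forall>\<^sub>F t in nhds 0. x + t *\<^sub>R axis i 1 \<in> S"
  proof -
    have "open ((\<lambda>t::real. x + t *\<^sub>R axis i 1) -` S)"
      by (rule open_vimage[OF assms(1)]) (auto intro!: continuous_intros)
    from eventually_nhds_in_open[OF this, of 0] show ?thesis
      using assms(2) by simp
  qed
  then have "\<forall>\<^sub>F t in nhds 0. f (x + t *\<^sub>R axis i 1) = g (x + t *\<^sub>R axis i 1)"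
    by eventually_elim (use assms(3) in auto)
  then show ?thesis
    unfolding partial_deriv_def by (intro vector_derivative_cong_eq) (auto elim: eventually_mono)
qed

lemma partials_Nil [simp]: "partials [] f = f"
  and partials_Cons: "partials (i # is) f = partial_deriv i (partials is f)"
  by (simp_all add: partials_def)

lemma partials_cong:
  fixes f g :: "real^'d::finite \<Rightarrow> 'b::real_normed_vector"
    and "is" :: "'d list"
  assumes "open S" "\<And>y. y \<in> S \<Longrightarrow> f y = g y" "x \<in> S"
  shows "partials is f x = partials is g x"
  using assms(3)
proof (induction "is" arbitrary: x)
  case (Cons i "is")
  then show ?case
    using partial_deriv_cong[OF assms(1), of x "partials is f"] by (simp add: partials_Cons)
qed (use assms(2) in simp)

lemma differentiable_line:
  assumes "f differentiable (at x)"
  shows "((\<lambda>t. f (x + t *\<^sub>R e)) has_vector_derivative frechet_derivative f (at x) e) (at 0)"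
proof -
  have f: "(f has_derivative frechet_derivative f (at x)) (at (x + 0 *\<^sub>R e))"
    using assms frechet_derivative_works by auto
  have "((\<lambda>t. x + t *\<^sub>R e) has_vector_derivative e) (at 0)"
    by (auto intro!: derivative_eq_intros)
  from vector_derivative_diff_chain_within[OF this[unfolded has_vector_derivative_def[symmetric]], of f "frechet_derivative f (at x)"]
  show ?thesis using f by (simp add: has_derivative_at_withinI o_def)
qed

lemma partial_deriv_frechet:
  assumes "f differentiable (at x)"
  shows "partial_deriv i f x = frechet_derivative f (at x) (axis i 1)"
  unfolding partial_deriv_def using differentiable_line[OF assms] vector_derivative_at by blast

text \<open>Moving from \<open>y\<close> to \<open>y + v\<close> one coordinate at a time, the mean value inequality
  controls each move by the continuity of the corresponding partial derivative.\<close>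

lemma has_derivative_partials:
  fixes f :: "real^'d::finite \<Rightarrow> 'b::real_normed_vector"
  assumes S: "open S" and x: "x \<in> S"
    and diff: "\<And>y i. y \<in> S \<Longrightarrow> (\<lambda>t. f (y + t *\<^sub>R axis i 1)) differentiable (at 0)"
    and cont: "\<And>i. continuous_on S (partial_deriv i f)"
  shows "(f has_derivative (\<lambda>v. \<Sum>i\<in>UNIV. v $ i *\<^sub>R partial_deriv i f x)) (at x)"
proof -
  have line: "((\<lambda>t. f (y + t *\<^sub>R axis i 1)) has_vector_derivative partial_deriv i f (y + s *\<^sub>R axis i 1)) (at s)"
    if "y + s *\<^sub>R axis i 1 \<in> S" for y i s
  proof -
    have "((\<lambda>t. f ((y + s *\<^sub>R axis i 1) + t *\<^sub>R axis i 1)) has_vector_derivative partial_deriv i f (y + s *\<^sub>R axis i 1)) (at (s - s))"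
      using diff[OF that] unfolding partial_deriv_def by (simp add: vector_derivative_works)
    moreover have "((\<lambda>t. t - s) has_real_derivative 1) (at s)"
      by (auto intro!: derivative_eq_intros)
    ultimately have "(((\<lambda>t. f ((y + s *\<^sub>R axis i 1) + t *\<^sub>R axis i 1)) \<circ> (\<lambda>t. t - s)) has_vector_derivative 1 *\<^sub>R partial_deriv i f (y + s *\<^sub>R axis i 1)) (at s)"
      by (intro vector_diff_chain_at) (auto simp: has_real_derivative_iff_has_vector_derivative)
    then show ?thesis by (simp add: o_def algebra_simps)
  qed
  have main: "\<exists>\<delta>>0. \<forall>y v. norm (y - x) < \<delta> \<longrightarrow> norm v < \<delta> \<longrightarrow>
      norm (f (y + (\<Sum>i\<in>I. v $ i *\<^sub>R axis i 1)) - f y - (\<Sum>i\<in>I. v $ i *\<^sub>R partial_deriv i f x))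
        \<le> e * (\<Sum>i\<in>I. \<bar>v $ i\<bar>)" if "0 < e" for e and I :: "'d set"
    using finite[of I]
  proof (induction I rule: finite_induct)
    case empty
    then show ?case by (auto intro: exI[of _ 1])
  next
    case (insert j I)
    obtain \<delta>1 where \<delta>1: "\<delta>1 > 0" "\<And>y v. norm (y - x) < \<delta>1 \<Longrightarrow> norm v < \<delta>1 \<Longrightarrow>
      norm (f (y + (\<Sum>i\<in>I. v $ i *\<^sub>R axis i 1)) - f y - (\<Sum>i\<in>I. v $ i *\<^sub>R partial_deriv i f x))
        \<le> e * (\<Sum>i\<in>I. \<bar>v $ i\<bar>)"
      using insert.IH by blast
    have "isCont (partial_deriv j f) x"
      using cont S x continuous_on_eq_continuous_at by blast
    then have "\<exists>r>0. \<forall>y. dist y x < r \<longrightarrow> dist (partial_deriv j f y) (partial_deriv j f x) < e"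
      using that by (simp add: continuous_at_eps_delta)
    then obtain r1 where r1: "r1 > 0" "\<And>y. dist y x < r1 \<Longrightarrow> dist (partial_deriv j f y) (partial_deriv j f x) < e"
      by auto
    obtain r2 where r2: "r2 > 0" "ball x r2 \<subseteq> S"
      using S x openE by blast
    define r where "r = min r1 r2"
    have r: "r > 0" "ball x r \<subseteq> S"
      "\<And>y. y \<in> ball x r \<Longrightarrow> norm (partial_deriv j f y - partial_deriv j f x) \<le> e"
      using r1 r2 by (force simp: r_def dist_norm norm_minus_commute)+
    define m where "m = real (CARD('d)) + 2"
    have m: "m > 0" unfolding m_def by simp
    define \<delta> where "\<delta> = min \<delta>1 (r / m)"
    show ?case
    proof (intro exI conjI allI impI)
      show "\<delta> > 0" using \<delta>1 r m by (simp add: \<delta>_def)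
      fix y v :: "real^'d"
      assume yv: "norm (y - x) < \<delta>" "norm v < \<delta>"
      define z where "z = y + (\<Sum>i\<in>I. v $ i *\<^sub>R axis i 1)"
      have zb: "z + s *\<^sub>R axis j 1 \<in> ball x r" if "\<bar>s\<bar> \<le> \<bar>v $ j\<bar>" for s
      proof -
        have vi: "\<bar>v $ i\<bar> \<le> norm v" for i by (rule component_le_norm_cart)
        have "norm (\<Sum>i\<in>I. v $ i *\<^sub>R (axis i 1 :: real^'d)) \<le> (\<Sum>i\<in>I. norm v)"
          by (rule sum_norm_le) (use vi in auto)
        also have "\<dots> \<le> real (CARD('d)) * norm v"
          using card_mono[of UNIV I] by (simp add: mult_right_mono)
        finally have 1: "norm (\<Sum>i\<in>I. v $ i *\<^sub>R (axis i 1 :: real^'d)) \<le> real (CARD('d)) * norm v" .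
        have 2: "norm (s *\<^sub>R axis j 1 :: real^'d) \<le> norm v"
          using that vi[of j] by simp
        have "norm (z + s *\<^sub>R axis j 1 - x) \<le> norm (y - x) + norm (\<Sum>i\<in>I. v $ i *\<^sub>R (axis i 1 :: real^'d)) + norm (s *\<^sub>R axis j 1 :: real^'d)"
          unfolding z_def by (rule order_trans[OF _ norm_triangle_le[OF add_mono[OF norm_triangle_ineq order_refl]]])
            (simp add: algebra_simps)
        also have "\<dots> \<le> norm (y - x) + (real (CARD('d)) + 1) * norm v"
          using 1 2 by (simp add: algebra_simps)
        also have "\<dots> < \<delta> + (real (CARD('d)) + 1) * \<delta>"
          using yv by (intro add_less_le_mono mult_left_mono) auto
        also have "\<dots> = m * \<delta>" by (simp add: m_def algebra_simps)
        also have "\<dots> \<le> r" using m by (simp add: \<delta>_def min_def field_simps)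
        finally show ?thesis by (simp add: dist_norm norm_minus_commute)
      qed
      define F where "F t = f (z + t *\<^sub>R axis j 1) - t *\<^sub>R partial_deriv j f x" for t
      have "norm (F (v $ j) - F 0) \<le> e * norm (v $ j - 0)"
      proof (rule differentiable_bound[where S = "closed_segment 0 (v $ j)"
            and f' = "\<lambda>s h. h *\<^sub>R (partial_deriv j f (z + s *\<^sub>R axis j 1) - partial_deriv j f x)"])
        fix s assume s: "s \<in> closed_segment 0 (v $ j)"
        then have s': "\<bar>s\<bar> \<le> \<bar>v $ j\<bar>" using segment_bound1[OF s] by auto
        have "((\<lambda>t. t *\<^sub>R partial_deriv j f x) has_vector_derivative partial_deriv j f x) (at s)"
          by (auto intro!: derivative_eq_intros)
        then have "(F has_vector_derivative partial_deriv j f (z + s *\<^sub>R axis j 1) - partial_deriv j f x) (at s)"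
          unfolding F_def using line[of z s j] zb[OF s'] r by (intro has_vector_derivative_diff) auto
        then show "(F has_derivative (\<lambda>h. h *\<^sub>R (partial_deriv j f (z + s *\<^sub>R axis j 1) - partial_deriv j f x)))
            (at s within closed_segment 0 (v $ j))"
          by (simp add: has_vector_derivative_def has_derivative_at_withinI)
        have "norm (partial_deriv j f (z + s *\<^sub>R axis j 1) - partial_deriv j f x) \<le> e"
          using zb[OF s'] r by blast
        then show "onorm (\<lambda>h. h *\<^sub>R (partial_deriv j f (z + s *\<^sub>R axis j 1) - partial_deriv j f x)) \<le> e"
          by (intro onorm_le) (metis mult.commute mult_left_mono abs_ge_zero norm_scaleR real_norm_def)
      qed auto
      moreover have "F (v $ j) - F 0 = f (z + (v $ j) *\<^sub>R axis j 1) - f z - (v $ j) *\<^sub>R partial_deriv j f x"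
        by (simp add: F_def)
      ultimately have 1: "norm (f (z + (v $ j) *\<^sub>R axis j 1) - f z - (v $ j) *\<^sub>R partial_deriv j f x) \<le> e * \<bar>v $ j\<bar>"
        by simp
      have 2: "norm (f z - f y - (\<Sum>i\<in>I. v $ i *\<^sub>R partial_deriv i f x)) \<le> e * (\<Sum>i\<in>I. \<bar>v $ i\<bar>)"
        unfolding z_def using \<delta>1(2) yv by (simp add: \<delta>_def)
      have eq: "f (y + (\<Sum>i\<in>insert j I. v $ i *\<^sub>R axis i 1)) - f y - (\<Sum>i\<in>insert j I. v $ i *\<^sub>R partial_deriv i f x)
        = (f (z + (v $ j) *\<^sub>R axis j 1) - f z - (v $ j) *\<^sub>R partial_deriv j f x) + (f z - f y - (\<Sum>i\<in>I. v $ i *\<^sub>R partial_deriv i f x))"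
        using insert.hyps by (simp add: z_def algebra_simps)
      show "norm (f (y + (\<Sum>i\<in>insert j I. v $ i *\<^sub>R axis i 1)) - f y - (\<Sum>i\<in>insert j I. v $ i *\<^sub>R partial_deriv i f x))
        \<le> e * (\<Sum>i\<in>insert j I. \<bar>v $ i\<bar>)"
        unfolding eq using norm_triangle_mono[OF 1 2] insert.hyps by (simp only: distrib_left sum.insert[OF insert.hyps])
    qed
  qed
  show ?thesis
    unfolding has_derivative_at_alt
  proof (intro conjI allI impI)
    show "bounded_linear (\<lambda>v. \<Sum>i\<in>UNIV. v $ i *\<^sub>R partial_deriv i f x)"
      by (intro bounded_linear_sum bounded_linear_scaleR_const bounded_linear_vec_nth)
    fix e :: real assume "e > 0"
    define e' where "e' = e / real (CARD('d))"
    have "e' > 0" using \<open>e > 0\<close> by (simp add: e'_def)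
    from main[OF this, of UNIV] obtain \<delta> where \<delta>: "\<delta> > 0" "\<And>y v. norm (y - x) < \<delta> \<Longrightarrow> norm v < \<delta> \<Longrightarrow>
      norm (f (y + (\<Sum>i\<in>UNIV. v $ i *\<^sub>R axis i 1)) - f y - (\<Sum>i\<in>UNIV. v $ i *\<^sub>R partial_deriv i f x))
        \<le> e' * (\<Sum>i\<in>UNIV. \<bar>v $ i\<bar>)" by blast
    show "\<exists>d>0. \<forall>y. norm (y - x) < d \<longrightarrow> norm (f y - f x - (\<Sum>i\<in>UNIV. (y - x) $ i *\<^sub>R partial_deriv i f x)) \<le> e * norm (y - x)"
    proof (intro exI conjI allI impI, rule \<delta>(1))
      fix y assume "norm (y - x) < \<delta>"
      have ex: "(\<Sum>i\<in>UNIV. (y - x) $ i *\<^sub>R axis i 1) = y - x"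
        by (metis (no_types, lifting) basis_expansion scalar_mult_eq_scaleR sum.cong)
      have "norm (f y - f x - (\<Sum>i\<in>UNIV. (y - x) $ i *\<^sub>R partial_deriv i f x)) \<le> e' * (\<Sum>i\<in>UNIV. \<bar>(y - x) $ i\<bar>)"
        using \<delta>(2)[of x "y - x"] \<open>norm (y - x) < \<delta>\<close> \<delta>(1) unfolding ex by simp
      also have "\<dots> \<le> e' * (\<Sum>i\<in>(UNIV::'d set). norm (y - x))"
        using \<open>e' > 0\<close> by (intro mult_left_mono sum_mono component_le_norm_cart) auto
      also have "\<dots> = e * norm (y - x)" by (simp add: e'_def)
      finally show "norm (f y - f x - (\<Sum>i\<in>UNIV. (y - x) $ i *\<^sub>R partial_deriv i f x)) \<le> e * norm (y - x)" .
    qed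
  qed
qed

lemma Ck_partials:
  fixes f :: "real^'d::finite \<Rightarrow> 'b::real_normed_vector"
    and "is" :: "'d list"
  assumes "open S" "Ck (length is + m) S f"
  shows "Ck m S (partials is f)"
  using assms(2)
proof (induction "is" arbitrary: m)
  case Nil
  then show ?case by simp
next
  case (Cons i "is")
  then have *: "Ck (Suc m) S (partials is f)" by simp
  show ?case
    by (rule Ck_cong[OF assms(1) Ck_SucD(2)[OF *, of i]])
      (use * in \<open>simp add: partials_Cons partial_deriv_frechet Ck.simps(2)\<close>)
qed

lemma Cp_on_iff_Ck:
  fixes f :: "real^'d::finite \<Rightarrow> 'b::real_normed_vector"
  assumes "open S"
  shows "Cp_on p S f \<longleftrightarrow> (\<forall>n. enat n \<le> p \<longrightarrow> Ck n S f)"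
proof
  assume C: "Cp_on p S f"
  have "Ck m S (partials is f)" if "enat (length is + m) \<le> p" for m and "is" :: "'d list"
    using that
  proof (induction m arbitrary: "is")
    case 0
    then show ?case using C by (simp add: Cp_on_def)
  next
    case (Suc m)
    have *: "Ck m S (partials (i # is) f)" for i
      using Suc.IH[of "i # is"] Suc.prems by simp
    have le: "enat (length (i # is)) \<le> p" for i
      using Suc.prems order_trans[of "enat (length (i # is))" "enat (length is + Suc m)" p] by auto
    have "(partials is f has_derivative (\<lambda>v. \<Sum>i\<in>UNIV. v $ i *\<^sub>R partial_deriv i (partials is f) x)) (at x)"
      if "x \<in> S" for x
      using C le that Ck_continuous_on[OF *]
      by (intro has_derivative_partials[OF assms]) (auto simp: Cp_on_def partials_Cons)
    then show ?case
    proof (rule Ck_SucI[OF assms])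
      show "Ck m S (\<lambda>x. \<Sum>j\<in>UNIV. axis i 1 $ j *\<^sub>R partial_deriv j (partials is f) x)" for i
        using *[of i] by (simp add: partials_Cons axis_def if_distrib[of "\<lambda>c. c *\<^sub>R _"] cong: if_cong)
    qed auto
  qed
  from this[of "[]"] show "\<forall>n. enat n \<le> p \<longrightarrow> Ck n S f" by simp
next
  assume C: "\<forall>n. enat n \<le> p \<longrightarrow> Ck n S f"
  show "Cp_on p S f"
    unfolding Cp_on_def
  proof (intro conjI allI impI ballI)
    fix i and "is" :: "'d list" and x assume "enat (length (i # is)) \<le> p" "x \<in> S"
    then have "Ck (Suc 0) S (partials is f)"
      using C assms by (intro Ck_partials) auto
    then have "partials is f differentiable (at x)"
      using \<open>x \<in> S\<close> by (simp add: Ck.simps(2))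
    from differentiable_line[OF this]
    show "(\<lambda>t. partials is f (x + t *\<^sub>R axis i 1)) differentiable (at 0)"
      using has_vector_derivative_def differentiableI_vector by blast
  next
    fix "is" :: "'d list" assume "enat (length is) \<le> p"
    then have "Ck 0 S (partials is f)"
      using C assms by (intro Ck_partials) auto
    then show "continuous_on S (partials is f)" by simp
  qed
qed

lemma Cp_on_const: "open S \<Longrightarrow> Cp_on p S (\<lambda>x. c)"
  by (simp add: Cp_on_iff_Ck Ck_const)

lemma Cp_on_add: "open S \<Longrightarrow> Cp_on p S f \<Longrightarrow> Cp_on p S g \<Longrightarrow> Cp_on p S (\<lambda>x. f x + g x)"
  by (simp add: Cp_on_iff_Ck Ck_add)

lemma Cp_on_diff: "open S \<Longrightarrow> Cp_on p S f \<Longrightarrow> Cp_on p S g \<Longrightarrow> Cp_on p S (\<lambda>x. f x - g x)"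
  by (simp add: Cp_on_iff_Ck Ck_diff)

lemma Cp_on_sum: "open S \<Longrightarrow> (\<And>i. i \<in> I \<Longrightarrow> Cp_on p S (f i)) \<Longrightarrow> Cp_on p S (\<lambda>x. \<Sum>i\<in>I. f i x)"
  by (simp add: Cp_on_iff_Ck Ck_sum)

lemma Cp_on_mult:
  fixes f g :: "real^'d::finite \<Rightarrow> 'a::real_normed_algebra"
  shows "open S \<Longrightarrow> Cp_on p S f \<Longrightarrow> Cp_on p S g \<Longrightarrow> Cp_on p S (\<lambda>x. f x * g x)"
  by (simp add: Cp_on_iff_Ck Ck_mult)

lemma Cp_on_scaleR:
  "open S \<Longrightarrow> Cp_on p S f \<Longrightarrow> Cp_on p S g \<Longrightarrow> Cp_on p S (\<lambda>x. f x *\<^sub>R g x)"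
  by (simp add: Cp_on_iff_Ck Ck_scaleR)

lemma Cp_on_prod:
  fixes f :: "'i \<Rightarrow> real^'d::finite \<Rightarrow> 'a::real_normed_field"
  shows "open S \<Longrightarrow> (\<And>i. i \<in> I \<Longrightarrow> Cp_on p S (f i)) \<Longrightarrow> Cp_on p S (\<lambda>x. \<Prod>i\<in>I. f i x)"
  by (simp add: Cp_on_iff_Ck Ck_prod)

lemma Cp_on_inverse:
  fixes f :: "real^'d::finite \<Rightarrow> 'a::real_normed_field"
  shows "open S \<Longrightarrow> Cp_on p S f \<Longrightarrow> (\<And>x. x \<in> S \<Longrightarrow> f x \<noteq> 0) \<Longrightarrow> Cp_on p S (\<lambda>x. inverse (f x))"
  by (simp add: Cp_on_iff_Ck Ck_inverse)

lemma Cp_on_compose: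
  fixes \<phi> :: "real^'e::finite \<Rightarrow> real^'d::finite"
  assumes "open S" "open T" "\<phi> ` S \<subseteq> T" "Cp_on p T f" "\<And>j. Cp_on p S (\<lambda>x. \<phi> x $ j)"
  shows "Cp_on p S (\<lambda>x. f (\<phi> x))"
  using assms(4,5) by (auto simp: Cp_on_iff_Ck assms(1,2) intro: Ck_compose[OF assms(1-3)])

lemma Cp_on_cong:
  "open S \<Longrightarrow> Cp_on p S f \<Longrightarrow> (\<And>x. x \<in> S \<Longrightarrow> f x = g x) \<Longrightarrow> Cp_on p S g"
  by (auto simp: Cp_on_iff_Ck intro: Ck_cong)

lemma Cp_on_subset: "open S \<Longrightarrow> open T \<Longrightarrow> Cp_on p S f \<Longrightarrow> T \<subseteq> S \<Longrightarrow> Cp_on p T f"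
  by (auto simp: Cp_on_iff_Ck intro: Ck_subset)

lemma Cp_on_local:
  assumes "open S" "\<And>x. x \<in> S \<Longrightarrow> \<exists>T. open T \<and> x \<in> T \<and> Cp_on p T f"
  shows "Cp_on p S f"
proof -
  have "Ck n S f" if n: "enat n \<le> p" for n
  proof (rule Ck_local[OF assms(1)])
    fix x assume "x \<in> S"
    then obtain T where "open T" "x \<in> T" "Cp_on p T f" using assms(2) by blast
    then show "\<exists>T. open T \<and> x \<in> T \<and> Ck n T f"
      using n by (auto simp: Cp_on_iff_Ck)
  qed
  then show ?thesis by (simp add: Cp_on_iff_Ck assms(1))
qed

lemma Cp_on_coord: "open S \<Longrightarrow> Cp_on p S (\<lambda>x. x $ i)"
  by (simp add: Cp_on_iff_Ck Ck_coord)

lemma Cp_on_continuous_on: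
  fixes f :: "real^'d::finite \<Rightarrow> 'b::real_normed_vector"
  assumes "Cp_on p S f"
  shows "continuous_on S f"
proof -
  have "enat (length ([] :: 'd list)) \<le> p \<longrightarrow> continuous_on S (partials [] f)"
    using assms unfolding Cp_on_def by blast
  then show ?thesis by (simp flip: zero_enat_def)
qed

lemma Cp_on_extend_zero:
  assumes "open W" "closed M" "M \<subseteq> W" "Cp_on p W f" "\<And>x. x \<notin> M \<Longrightarrow> f x = 0"
  shows "Cp_on p UNIV f"
proof (rule Cp_on_local)
  fix x
  show "\<exists>T. open T \<and> x \<in> T \<and> Cp_on p T f"
  proof (cases "x \<in> W")
    case True
    then show ?thesis using assms by blast
  next
    case False
    have "Cp_on p (- M) f"
      by (rule Cp_on_cong[OF _ Cp_on_const[of _ p 0]]) (use assms in auto)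
    then show ?thesis using assms False by (intro exI[of _ "- M"]) auto
  qed
qed auto

section \<open>Bump functions\<close>

definition flat_exp :: "nat \<Rightarrow> real \<Rightarrow> real" where
  "flat_exp m t = (if t > 0 then inverse t ^ m * exp (- inverse t) else 0)"

lemma flat_exp_tendsto: "(flat_exp m \<longlongrightarrow> 0) (at 0)"
proof -
  have "((\<lambda>t::real. inverse t ^ m / exp (inverse t)) \<longlongrightarrow> 0) (at_right 0)"
    using filterlim_compose[OF tendsto_power_div_exp_0 filterlim_inverse_at_top_right] .
  moreover have "\<forall>\<^sub>F t in at_right 0. inverse t ^ m / exp (inverse t) = flat_exp m t"
    by (auto simp: eventually_at_filter flat_exp_def exp_minus field_simps)
  ultimately have "(flat_exp m \<longlongrightarrow> 0) (at_right 0)"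
    using tendsto_cong by force
  moreover have "(flat_exp m \<longlongrightarrow> 0) (at_left 0)"
    by (rule tendsto_eventually) (auto simp: eventually_at_filter flat_exp_def)
  ultimately show ?thesis by (simp add: filterlim_at_split)
qed

lemma flat_exp_DERIV:
  "(flat_exp m has_real_derivative (flat_exp (m + 2) t - real m * flat_exp (m + 1) t)) (at t)"
proof (cases t "0::real" rule: linorder_cases)
  case less
  have "((\<lambda>t. 0) has_real_derivative 0) (at t)" by simp
  then have "(flat_exp m has_real_derivative 0) (at t)"
    by (rule has_field_derivative_transform_within_open[of _ _ _ "{..<0}"]) (use less in \<open>auto simp: flat_exp_def\<close>)
  then show ?thesis using less by (simp add: flat_exp_def)
next
  case equal
  have "((\<lambda>h. (flat_exp m (0 + h) - flat_exp m 0) / h) \<longlongrightarrow> 0) (at 0)"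
  proof (rule Lim_transform_eventually[OF flat_exp_tendsto[of "Suc m"]])
    show "\<forall>\<^sub>F h in at 0. flat_exp (Suc m) h = (flat_exp m (0 + h) - flat_exp m 0) / h"
      by (auto simp: eventually_at_filter flat_exp_def field_simps)
  qed
  then show ?thesis using equal by (simp add: DERIV_def flat_exp_def)
next
  case greater
  have "((\<lambda>t. inverse t ^ m) has_real_derivative - real m * inverse t ^ (m + 1)) (at t)"
  proof (induction m)
    case (Suc m)
    from DERIV_mult[OF DERIV_inverse[of t] this] show ?case
      using greater by (simp add: algebra_simps)
  qed simp
  moreover have "((\<lambda>t. exp (- inverse t)) has_real_derivative inverse t ^ 2 * exp (- inverse t)) (at t)"
    using greater by (auto intro!: derivative_eq_intros simp: power2_eq_square)
  ultimately have "((\<lambda>t. inverse t ^ m * exp (- inverse t)) has_real_derivative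
      (flat_exp (m + 2) t - real m * flat_exp (m + 1) t)) (at t)"
    by (rule DERIV_cong[OF DERIV_mult]) (use greater in \<open>simp add: flat_exp_def algebra_simps power2_eq_square\<close>)
  then show ?thesis
    by (rule has_field_derivative_transform_within_open[of _ _ _ "{0<..}"]) (use greater in \<open>auto simp: flat_exp_def\<close>)
qed

lemma Ck_flat_exp:
  assumes "open S" "Ck n S q"
  shows "Ck n S (\<lambda>x. flat_exp m (q x))"
  using assms(2)
proof (induction n arbitrary: m)
  case 0
  have "continuous_on UNIV (flat_exp m)"
    using flat_exp_DERIV DERIV_isCont continuous_at_imp_continuous_on by blast
  then show ?case
    using 0 continuous_on_compose2 by (metis Ck.simps(1) subset_UNIV)
next
  case (Suc n)
  show ?case
  proof (rule Ck_SucI[where f' = "\<lambda>x v. (flat_exp (m + 2) (q x) - real m * flat_exp (m + 1) (q x))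
      * frechet_derivative q (at x) v"])
    show "Ck n S (\<lambda>x. (flat_exp (m + 2) (q x) - real m * flat_exp (m + 1) (q x))
      * frechet_derivative q (at x) (axis i 1))" for i
      using Suc assms(1) by (intro Ck_mult Ck_diff Ck_const) (auto intro: Ck_pred Ck_SucD)
    show "((\<lambda>x. flat_exp m (q x)) has_derivative (\<lambda>v. (flat_exp (m + 2) (q x) - real m * flat_exp (m + 1) (q x))
      * frechet_derivative q (at x) v)) (at x)" if "x \<in> S" for x
      using has_derivative_compose[OF Ck_SucD(1)[OF Suc.prems that]
          flat_exp_DERIV[of m "q x", unfolded has_field_derivative_def]] .
  qed (use assms in auto)
qed

lemma flat_exp_nonneg: "0 \<le> flat_exp m t"
  and flat_exp_pos: "0 < t \<Longrightarrow> 0 < flat_exp m t"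
  and flat_exp_zero: "t \<le> 0 \<Longrightarrow> flat_exp m t = 0"
  by (auto simp: flat_exp_def)

definition ball_bump :: "real^'d::finite \<Rightarrow> real \<Rightarrow> real^'d \<Rightarrow> real" where
  "ball_bump a r x = (let s = (norm (x - a))\<^sup>2 in
     flat_exp 0 (4 * r\<^sup>2 - s) * inverse (flat_exp 0 (4 * r\<^sup>2 - s) + flat_exp 0 (s - r\<^sup>2)))"

lemma ball_bump:
  assumes "r > 0"
  shows "Ck n UNIV (ball_bump a r)"
    and "ball_bump a r x \<in> {0..1}"
    and "x \<in> ball a r \<Longrightarrow> ball_bump a r x = 1"
    and "x \<notin> cball a (2 * r) \<Longrightarrow> ball_bump a r x = 0"
proof -
  define s where "s x = (norm (x - a))\<^sup>2" for x
  have *: "flat_exp 0 (4 * r\<^sup>2 - s x) + flat_exp 0 (s x - r\<^sup>2) > 0" for x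
  proof (cases "s x < 4 * r\<^sup>2")
    case True
    then show ?thesis using flat_exp_pos[of "4 * r\<^sup>2 - s x" 0] flat_exp_nonneg[of 0 "s x - r\<^sup>2"] by simp
  next
    case False
    then have "s x - r\<^sup>2 > 0" using zero_less_power[OF assms, of 2] by linarith
    then show ?thesis using flat_exp_pos[of "s x - r\<^sup>2" 0] flat_exp_nonneg[of 0 "4 * r\<^sup>2 - s x"] by simp
  qed
  have def: "ball_bump a r = (\<lambda>x. flat_exp 0 (4 * r\<^sup>2 - s x) * inverse (flat_exp 0 (4 * r\<^sup>2 - s x) + flat_exp 0 (s x - r\<^sup>2)))"
    by (simp add: ball_bump_def s_def fun_eq_iff Let_def)
  have "s = (\<lambda>x. \<Sum>i\<in>UNIV. (x $ i - a $ i) * (x $ i - a $ i))"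
    by (auto simp: s_def fun_eq_iff power2_norm_eq_inner inner_vec_def)
  moreover have "Ck n UNIV (\<lambda>x. \<Sum>i\<in>UNIV. (x $ i - a $ i) * (x $ i - a $ i))"
    by (intro Ck_sum Ck_mult Ck_diff Ck_coord Ck_const) auto
  ultimately have s: "Ck n UNIV s" by simp
  have "flat_exp 0 (4 * r\<^sup>2 - s x) + flat_exp 0 (s x - r\<^sup>2) \<noteq> 0" for x
    using *[of x] by simp
  then show "Ck n UNIV (ball_bump a r)"
    unfolding def by (intro Ck_mult Ck_inverse Ck_add Ck_flat_exp Ck_diff Ck_const s) auto
  show "ball_bump a r x \<in> {0..1}"
    unfolding def using *[of x] flat_exp_nonneg by (auto simp: field_simps)
  show "ball_bump a r x = 1" if "x \<in> ball a r"
  proof -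
    have "s x \<le> r\<^sup>2"
      using that assms by (auto simp: s_def dist_norm norm_minus_commute intro: power_mono)
    then show ?thesis using *[of x] unfolding def by (simp add: flat_exp_zero)
  qed
  show "ball_bump a r x = 0" if "x \<notin> cball a (2 * r)"
  proof -
    have "(2 * r)\<^sup>2 \<le> s x"
      unfolding s_def using that assms by (intro power_mono) (auto simp: dist_norm norm_minus_commute)
    then show ?thesis unfolding def by (simp add: flat_exp_zero power_mult_distrib)
  qed
qed

lemma smooth_bump:
  fixes K U :: "(real^'d::finite) set"
  assumes "compact K" "open U" "K \<subseteq> U"
  obtains \<eta> :: "real^'d \<Rightarrow> real" and M V where "\<And>n. Ck n UNIV \<eta>" "\<And>x. \<eta> x \<in> {0..1}" "compact M" "M \<subseteq> U"
    "\<And>x. x \<notin> M \<Longrightarrow> \<eta> x = 0" "open V" "K \<subseteq> V" "V \<subseteq> M" "\<And>x. x \<in> V \<Longrightarrow> \<eta> x = 1"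
proof -
  have "\<forall>a\<in>K. \<exists>r>0. cball a (2 * r) \<subseteq> U"
  proof
    fix a assume "a \<in> K"
    then obtain e where "e > 0" "cball a e \<subseteq> U"
      using assms open_contains_cball by blast
    then show "\<exists>r>0. cball a (2 * r) \<subseteq> U" by (intro exI[of _ "e / 2"]) auto
  qed
  then obtain r where r: "\<And>a. a \<in> K \<Longrightarrow> r a > 0 \<and> cball a (2 * r a) \<subseteq> U"
    by metis
  have "K \<subseteq> (\<Union>a\<in>K. ball a (r a))" using r by auto
  then obtain F where F: "F \<subseteq> K" "finite F" "K \<subseteq> (\<Union>a\<in>F. ball a (r a))"
    using compactE_image[OF assms(1), of K "\<lambda>a. ball a (r a)"] by auto
  define \<eta> where "\<eta> x = 1 - (\<Prod>a\<in>F. 1 - ball_bump a (r a) x)" for x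
  define M where "M = (\<Union>a\<in>F. cball a (2 * r a))"
  define V where "V = (\<Union>a\<in>F. ball a (r a))"
  have rF: "r a > 0" if "a \<in> F" for a using that F r by auto
  show thesis
  proof
    show "Ck n UNIV \<eta>" for n
      unfolding \<eta>_def using rF by (intro Ck_diff Ck_const Ck_prod ball_bump) auto
    show "\<eta> x \<in> {0..1}" for x
    proof -
      have "0 \<le> (\<Prod>a\<in>F. 1 - ball_bump a (r a) x)" "(\<Prod>a\<in>F. 1 - ball_bump a (r a) x) \<le> 1"
        using ball_bump(2)[OF rF, of _ _ x] by (force intro!: prod_nonneg prod_le_1)+
      then show ?thesis by (simp add: \<eta>_def)
    qed
    show "compact M" "M \<subseteq> U" "open V" "K \<subseteq> V" using F r by (auto simp: M_def V_def)
    show "V \<subseteq> M"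
    proof
      fix x assume "x \<in> V"
      then obtain a where "a \<in> F" "x \<in> ball a (r a)" by (auto simp: V_def)
      then show "x \<in> M" using rF[of a] unfolding M_def by (intro UN_I[of a]) auto
    qed
    show "\<eta> x = 0" if "x \<notin> M" for x
    proof -
      have "ball_bump a (r a) x = 0" if "a \<in> F" for a
        using ball_bump(4)[OF rF[OF that], of x] that \<open>x \<notin> M\<close> by (auto simp: M_def)
      then show ?thesis by (simp add: \<eta>_def)
    qed
    show "\<eta> x = 1" if x: "x \<in> V" for x
    proof -
      obtain a where a: "a \<in> F" "x \<in> ball a (r a)"
        using x by (auto simp: V_def)
      have "ball_bump a (r a) x = 1"
        using ball_bump(3)[OF rF[OF a(1)] a(2)] .
      then have "(\<Prod>a\<in>F. 1 - ball_bump a (r a) x) = 0"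
        using F(2) a(1) by (intro prod_zero) auto
      then show ?thesis by (simp add: \<eta>_def)
    qed
  qed
qed

section \<open>Inverse maps\<close>

lemma Ck_det:
  assumes "open S" "\<And>i j. Ck n S (\<lambda>x. A x $ i $ j)"
  shows "Ck n S (\<lambda>x. det (A x :: real^'m^'m::finite))"
  unfolding det_def using assms by (intro Ck_sum Ck_mult Ck_prod Ck_const)

lemma Ck_map_derivative:
  fixes \<Phi> :: "real^'e::finite \<Rightarrow> real^'d::finite"
  assumes "\<And>j. Ck (Suc n) S (\<lambda>x. \<Phi> x $ j)" "x \<in> S"
  shows "(\<Phi> has_derivative (\<lambda>v. jacobian \<Phi> (at x) *v v)) (at x)"
    and "jacobian \<Phi> (at x) $ i $ j = frechet_derivative (\<lambda>x. \<Phi> x $ i) (at x) (axis j 1)"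
proof -
  have *: "(\<Phi> has_derivative (\<lambda>v. \<chi> j. frechet_derivative (\<lambda>x. \<Phi> x $ j) (at x) v)) (at x)"
    by (rule has_derivative_vec_components) (use Ck_SucD(1)[OF assms(1) assms(2)] in simp)
  then show "(\<Phi> has_derivative (\<lambda>v. jacobian \<Phi> (at x) *v v)) (at x)"
    using jacobian_works differentiableI by blast
  show "jacobian \<Phi> (at x) $ i $ j = frechet_derivative (\<lambda>x. \<Phi> x $ i) (at x) (axis j 1)"
    unfolding jacobian_def matrix_def frechet_derivative_at[OF *, symmetric] by simp
qed

lemma Ck_inv_into:
  fixes \<Phi> :: "real^'d::finite \<Rightarrow> real^'d"
  assumes S: "open S" "inj_on \<Phi> S" and C: "\<And>j. Ck (Suc n) S (\<lambda>x. \<Phi> x $ j)"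
    and det: "\<And>x. x \<in> S \<Longrightarrow> det (jacobian \<Phi> (at x)) \<noteq> 0"
  shows "open (\<Phi> ` S)" and "Ck (Suc n) (\<Phi> ` S) (\<lambda>y. inv_into S \<Phi> y $ k)"
proof -
  define G where "G = inv_into S \<Phi>"
  define A where "A x = jacobian \<Phi> (at x)" for x
  have d: "(\<Phi> has_derivative (\<lambda>v. A x *v v)) (at x)" if "x \<in> S" for x
    unfolding A_def by (rule Ck_map_derivative(1)[OF C that])
  have cont: "continuous_on S \<Phi>"
    using d by (meson continuous_at_imp_continuous_on has_derivative_continuous)
  show op: "open (\<Phi> ` S)"
    using invariance_of_domain[OF cont S] .
  have G: "G (\<Phi> x) = x" if "x \<in> S" for x
    using S that by (simp add: G_def)
  have GS: "G y \<in> S" "\<Phi> (G y) = y" if "y \<in> \<Phi> ` S" for y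
    using that by (auto simp: G_def inv_into_into f_inv_into_f)
  have "\<forall>x\<in>S. \<exists>B. A x ** B = mat 1"
    using det by (auto simp: A_def invertible_def simp flip: invertible_det_nz)
  then obtain B where inv: "\<And>x. x \<in> S \<Longrightarrow> A x ** B x = mat 1" by metis
  have dG: "(G has_derivative (\<lambda>v. B (G y) *v v)) (at y)" if "y \<in> \<Phi> ` S" for y
  proof -
    have "(G has_derivative (\<lambda>v. B (G y) *v v)) (at (\<Phi> (G y)))"
      by (rule has_derivative_inverse_strong[of S _ _ _ "\<lambda>v. A (G y) *v v"])
        (use S cont G GS[OF that] d inv in \<open>auto simp: fun_eq_iff matrix_vector_mul_assoc\<close>)
    then show ?thesis using GS[OF that] by simp
  qed
  have entry: "(B x *v axis i 1) $ k =
      det (\<chi> r j. if j = k then axis i 1 $ r else A x $ r $ j) * inverse (det (A x))" if "x \<in> S" for x i k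
  proof -
    have "A x *v (B x *v axis i 1) = axis i 1"
      using inv[OF that] by (simp add: matrix_vector_mul_assoc)
    then have "B x *v axis i 1 = (\<chi> k. det (\<chi> r j. if j = k then axis i 1 $ r else A x $ r $ j) / det (A x))"
      using cramer[of "A x"] det[OF that] by (simp add: A_def)
    then show ?thesis by (simp add: divide_inverse)
  qed
  have step: "Ck (Suc m) (\<Phi> ` S) (\<lambda>y. G y $ k)"
    if GC: "\<And>k. Ck m (\<Phi> ` S) (\<lambda>y. G y $ k)" and "m \<le> n" for m k
  proof (rule Ck_SucI[OF op, where f' = "\<lambda>y v. (B (G y) *v v) $ k"])
    show "((\<lambda>y. G y $ k) has_derivative (\<lambda>v. (B (G y) *v v) $ k)) (at y)" if "y \<in> \<Phi> ` S" for y
      by (rule bounded_linear.has_derivative[OF bounded_linear_vec_nth dG[OF that]])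
    have AG: "Ck m (\<Phi> ` S) (\<lambda>y. A (G y) $ i $ j)" for i j
    proof (rule Ck_compose[OF op S(1) _ _ GC])
      show "Ck m S (\<lambda>x. A x $ i $ j)"
      proof (rule Ck_cong[OF S(1)])
        show "Ck m S (\<lambda>x. frechet_derivative (\<lambda>x. \<Phi> x $ i) (at x) (axis j 1))"
          using Ck_le[OF Ck_SucD(2)[OF C] \<open>m \<le> n\<close>] .
      qed (use Ck_map_derivative(2)[OF C] in \<open>simp add: A_def\<close>)
    qed (use GS in auto)
    show "Ck m (\<Phi> ` S) (\<lambda>y. (B (G y) *v axis i 1) $ k)" for i
    proof (rule Ck_cong[OF op])
      have "Ck m (\<Phi> ` S) (\<lambda>y. if j = k then c else A (G y) $ r $ j)" for r j c
        using AG Ck_const by (cases "j = k") auto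
      moreover have "det (A (G y)) \<noteq> 0" if "y \<in> \<Phi> ` S" for y
        using GS[OF that] det by (simp add: A_def)
      ultimately show "Ck m (\<Phi> ` S) (\<lambda>y. det (\<chi> r j. if j = k then axis i 1 $ r else A (G y) $ r $ j) * inverse (det (A (G y))))"
        using AG by (intro Ck_mult Ck_inverse Ck_det op) simp_all
    qed (use entry GS in auto)
  qed
  have "Ck m (\<Phi> ` S) (\<lambda>y. G y $ k)" if "m \<le> Suc n" for m k
    using that
  proof (induction m arbitrary: k)
    case 0
    have "continuous_on (\<Phi> ` S) G"
      using dG by (meson continuous_at_imp_continuous_on has_derivative_continuous)
    then show ?case by (auto intro: continuous_intros)
  next
    case (Suc m)
    then show ?case using step[of m] by simp
  qed
  from this[of "Suc n"] show "Ck (Suc n) (\<Phi> ` S) (\<lambda>y. inv_into S \<Phi> y $ k)"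
    by (simp add: G_def)
qed

text \<open>The function \<open>u\<close> cuts off \<open>(h / w) \<circ> \<Phi>\<^sup>-\<^sup>1\<close> near \<open>\<Phi> ` K\<close>.\<close>

lemma glue:
  fixes \<Phi> :: "real^'d::finite \<Rightarrow> real^'d" and w h :: "real^'d \<Rightarrow> 'k::real_normed_field"
  assumes \<Omega>: "open \<Omega>" "1 \<le> p" and \<Phi>: "\<And>j. Cp_on p \<Omega> (\<lambda>x. \<Phi> x $ j)" "inj_on \<Phi> \<Omega>"
    and det: "\<And>x. x \<in> \<Omega> \<Longrightarrow> det (jacobian \<Phi> (at x)) \<noteq> 0"
    and w: "Cp_on p \<Omega> w" "\<And>x. x \<in> \<Omega> \<Longrightarrow> w x \<noteq> 0" and h: "Cp_on p \<Omega> h"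
    and K: "compact K" "K \<subseteq> \<Omega>" and U: "open U" "\<Phi> ` K \<subseteq> U"
  shows "\<exists>u M V. Cp_on p UNIV u \<and> compact M \<and> M \<subseteq> U \<and> (\<forall>x. x \<notin> M \<longrightarrow> u x = 0) \<and>
    open V \<and> K \<subseteq> V \<and> V \<subseteq> \<Omega> \<and> \<Phi> ` V \<subseteq> M \<and> (\<forall>x\<in>V. w x * u (\<Phi> x) = h x)"
proof -
  define W where "W = \<Phi> ` \<Omega>"
  define G where "G = inv_into \<Omega> \<Phi>"
  have Ck\<Phi>: "Ck (Suc n) \<Omega> (\<lambda>x. \<Phi> x $ j)" if "enat (Suc n) \<le> p" for n j
    using \<Phi>(1) that \<Omega> by (simp add: Cp_on_iff_Ck)
  have W: "open W"
    unfolding W_def using Ck_inv_into(1)[OF \<Omega>(1) \<Phi>(2) Ck\<Phi> det, of 0] \<Omega>(2) by (simp add: one_enat_def)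
  have GC: "Cp_on p W (\<lambda>y. G y $ k)" for k
    unfolding Cp_on_iff_Ck[OF W]
  proof (intro allI impI)
    have 1: "Ck (Suc n) W (\<lambda>y. G y $ k)" if "enat (Suc n) \<le> p" for n
      unfolding W_def G_def using Ck_inv_into(2)[OF \<Omega>(1) \<Phi>(2) Ck\<Phi> det, of n] that by simp
    show "Ck n W (\<lambda>y. G y $ k)" if "enat n \<le> p" for n
      using 1[of "n - 1"] Ck_pred[OF 1[of 0]] that \<Omega>(2) by (cases n) (auto simp: one_enat_def)
  qed
  have GW: "G ` W \<subseteq> \<Omega>" and G: "\<And>x. x \<in> \<Omega> \<Longrightarrow> G (\<Phi> x) = x"
    using \<Phi>(2) by (auto simp: W_def G_def inv_into_into)
  have cont: "continuous_on \<Omega> \<Phi>"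
    using continuous_on_vec_lambda[of \<Omega> "\<lambda>j x. \<Phi> x $ j"] \<Phi>(1) Cp_on_continuous_on by auto
  have "compact (\<Phi> ` K)" "\<Phi> ` K \<subseteq> U \<inter> W"
    using K U cont by (auto simp: W_def intro: compact_continuous_image continuous_on_subset)
  then obtain \<eta> M V where \<eta>: "\<And>n. Ck n UNIV \<eta>" "\<And>x. \<eta> x \<in> {0..1::real}" "compact M" "M \<subseteq> U \<inter> W"
    "\<And>x. x \<notin> M \<Longrightarrow> \<eta> x = 0" "open V" "\<Phi> ` K \<subseteq> V" "V \<subseteq> M" "\<And>x. x \<in> V \<Longrightarrow> \<eta> x = 1"
    using smooth_bump[of "\<Phi> ` K" "U \<inter> W"] U W by blast
  define u where "u y = \<eta> y *\<^sub>R (h (G y) * inverse (w (G y)))" for y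
  have "Cp_on p W u"
  proof -
    have "Cp_on p W \<eta>" using \<eta>(1) W Ck_subset[OF _ subset_UNIV] by (auto simp: Cp_on_iff_Ck)
    moreover have "Cp_on p \<Omega> (\<lambda>x. h x * inverse (w x))"
      using \<Omega> h w by (intro Cp_on_mult Cp_on_inverse)
    ultimately show ?thesis unfolding u_def
      using Cp_on_compose[OF W \<Omega>(1) GW, of p "\<lambda>x. h x * inverse (w x)"] GC by (intro Cp_on_scaleR W) auto
  qed
  then have "Cp_on p UNIV u"
    using \<eta> W by (intro Cp_on_extend_zero[of W M]) (auto simp: u_def compact_imp_closed)
  moreover have "open (\<Omega> \<inter> \<Phi> -` V)"
    using cont \<Omega>(1) \<eta>(6) by (simp add: continuous_on_open_vimage Int_commute)
  ultimately show ?thesis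
    using \<eta> G w(2) K by (intro exI[of _ u] exI[of _ M] exI[of _ "\<Omega> \<inter> \<Phi> -` V"]) (auto simp: u_def)
qed

section \<open>The topology of the space of continuously differentiable functions\<close>

lemma Cp_carrierD: "f \<in> Cp_carrier p \<Omega> \<Longrightarrow> Cp_on p \<Omega> f"
  by (simp add: Cp_carrier_def)

lemma restrict_Cp_carrier: "open \<Omega> \<Longrightarrow> Cp_on p \<Omega> f \<Longrightarrow> restrict f \<Omega> \<in> Cp_carrier p \<Omega>"
  by (auto simp: Cp_carrier_def intro: Cp_on_cong)

lemma partials_diff:
  fixes f g :: "real^'d::finite \<Rightarrow> 'b::real_normed_vector" and "is" :: "'d list"
  assumes "open \<Omega>" "Cp_on p \<Omega> f" "Cp_on p \<Omega> g" "enat (length is) \<le> p" "x \<in> \<Omega>"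
  shows "partials is (\<lambda>x. f x - g x) x = partials is f x - partials is g x"
  using assms(4,5)
proof (induction "is" arbitrary: x)
  case (Cons i "is")
  have len: "enat (length is) \<le> p"
    using Cons.prems(1) by (metis dual_order.trans enat_ord_simps(1) le_SucI length_Cons order_refl)
  have "partial_deriv i (partials is (\<lambda>x. f x - g x)) x = partial_deriv i (\<lambda>x. partials is f x - partials is g x) x"
    using Cons.IH[OF len] by (intro partial_deriv_cong[OF assms(1) Cons.prems(2)]) auto
  also have "\<dots> = partial_deriv i (partials is f) x - partial_deriv i (partials is g) x"
    unfolding partial_deriv_def using assms(2,3) Cons.prems
    by (intro vector_derivative_diff_at) (auto simp: Cp_on_def)
  finally show ?case by (simp add: partials_Cons)
qed simp

lemma finite_lists_le: "finite {is :: 'd::finite list. length is \<le> n}"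
  using finite_lists_length_le[OF finite[of "UNIV :: 'd set"], of n] by simp

lemma Cp_seminorm_less:
  fixes f :: "real^'d::finite \<Rightarrow> 'b::real_normed_vector" and "is" :: "'d list"
  assumes "Cp_on p \<Omega> f" "compact K" "K \<subseteq> \<Omega>" "enat n \<le> p"
    and "Cp_seminorm K n f < e" "length is \<le> n" "x \<in> K"
  shows "norm (partials is f x) < e"
proof -
  have "bdd_above ((\<lambda>x. norm (partials is f x)) ` K)" if "length is \<le> n" for "is" :: "'d list"
  proof -
    have "enat (length is) \<le> p"
      using that assms(4) by (metis dual_order.trans enat_ord_simps(1))
    then have "continuous_on K (\<lambda>x. norm (partials is f x))"
      using assms(1,3) by (intro continuous_on_norm) (auto simp: Cp_on_def intro: continuous_on_subset)
    then show ?thesis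
      using assms(2) by (intro bounded_imp_bdd_above compact_imp_bounded compact_continuous_image)
  qed
  then have "bdd_above (\<Union>is\<in>{is :: 'd list. length is \<le> n}. (\<lambda>x. norm (partials is f x)) ` K)"
    by (intro bdd_above_UN[OF finite_lists_le, THEN iffD2]) auto
  moreover have "(\<Union>is\<in>{is :: 'd list. length is \<le> n}. (\<lambda>x. norm (partials is f x)) ` K) =
      {norm (partials is f x) | is x. length is \<le> n \<and> x \<in> K}" by auto
  ultimately have "norm (partials is f x) \<le> Cp_seminorm K n f"
    unfolding Cp_seminorm_def using assms(6,7) by (intro cSup_upper) auto
  then show ?thesis using assms(5) by simp
qed

lemma Cp_seminorm_le:
  assumes "0 \<le> e" "\<And>is x. length is \<le> n \<Longrightarrow> x \<in> K \<Longrightarrow> norm (partials is f x) \<le> e"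
  shows "Cp_seminorm K n f \<le> e"
  unfolding Cp_seminorm_def using assms by (intro cSup_least) auto

definition Cp_nbhd :: "enat \<Rightarrow> (real^'d) set \<Rightarrow> (real^'d::finite \<Rightarrow> 'k::real_normed_vector) \<Rightarrow>
    (real^'d) set \<Rightarrow> nat \<Rightarrow> real \<Rightarrow> (real^'d \<Rightarrow> 'k) set" where
  "Cp_nbhd p \<Omega> f K n e = {g \<in> Cp_carrier p \<Omega>.
     \<forall>is x. length is \<le> n \<and> x \<in> K \<longrightarrow> norm (partials is g x - partials is f x) < e}"

lemma topspace_Cp_topology [simp]:
  "topspace (Cp_topology p \<Omega> :: (real^'d::finite \<Rightarrow> 'k::real_normed_vector) topology) = Cp_carrier p \<Omega>"
proof -
  have "f \<in> {g \<in> Cp_carrier p \<Omega>. Cp_seminorm {} 0 (\<lambda>x. g x - f x) < 1}" if "f \<in> Cp_carrier p \<Omega>"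
    for f :: "real^'d \<Rightarrow> 'k"
    using that by (simp add: Cp_seminorm_def)
  moreover have "compact ({} :: (real^'d) set) \<and> {} \<subseteq> \<Omega> \<and> enat 0 \<le> p \<and> (0::real) < 1"
    by (simp flip: zero_enat_def)
  ultimately show ?thesis
    unfolding Cp_topology_def topology_generated_by_topspace by blast
qed

lemma Cp_nbhd_open:
  fixes f :: "real^'d::finite \<Rightarrow> 'k::real_normed_vector"
  assumes "open \<Omega>" "f \<in> Cp_carrier p \<Omega>" "compact K" "K \<subseteq> \<Omega>" "enat n \<le> p" "0 < e"
  shows "\<exists>U. openin (Cp_topology p \<Omega>) U \<and> f \<in> U \<and> U \<subseteq> Cp_nbhd p \<Omega> f K n e"
proof (intro exI conjI)
  let ?U = "{g \<in> Cp_carrier p \<Omega>. Cp_seminorm K n (\<lambda>x. g x - f x) < e}"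
  show "openin (Cp_topology p \<Omega>) ?U"
    unfolding Cp_topology_def by (rule topology_generated_by_Basis) (use assms in blast)
  have len: "enat (length is) \<le> p" if "length is \<le> n" for "is" :: "'d list"
    using that assms(5) by (metis dual_order.trans enat_ord_simps(1))
  have "Cp_seminorm K n (\<lambda>x. f x - f x) \<le> 0"
    using partials_diff[OF assms(1) Cp_carrierD[OF assms(2)] Cp_carrierD[OF assms(2)] len] assms(4)
    by (intro Cp_seminorm_le) auto
  then show "f \<in> ?U" using assms by simp
  show "?U \<subseteq> Cp_nbhd p \<Omega> f K n e"
  proof
    fix g assume g: "g \<in> ?U"
    then have C: "Cp_on p \<Omega> g" "Cp_on p \<Omega> f" using assms(2) by (auto simp: Cp_carrier_def)
    have "norm (partials is g x - partials is f x) < e" if "length is \<le> n" "x \<in> K" for "is" x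
      using Cp_seminorm_less[OF Cp_on_diff[OF assms(1) C] assms(3-5) _ that] g that assms(4)
        partials_diff[OF assms(1) C len[OF that(1)]] by auto
    then show "g \<in> Cp_nbhd p \<Omega> f K n e" using g by (auto simp: Cp_nbhd_def)
  qed
qed

lemma openin_Cp_nbhd:
  fixes f :: "real^'d::finite \<Rightarrow> 'k::real_normed_vector"
  assumes "open \<Omega>" "openin (Cp_topology p \<Omega>) U" "f \<in> U"
  obtains K n e where "compact K" "K \<subseteq> \<Omega>" "enat n \<le> p" "0 < e" "Cp_nbhd p \<Omega> f K n e \<subseteq> U"
proof -
  have "\<forall>f\<in>U. \<exists>K n e. compact K \<and> K \<subseteq> \<Omega> \<and> enat n \<le> p \<and> 0 < e \<and> Cp_nbhd p \<Omega> f K n e \<subseteq> U"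
    using assms(2) unfolding Cp_topology_def openin_topology_generated_by_iff
  proof (induction rule: generate_topology_on.induct)
    case (Int a b)
    show ?case
    proof
      fix f assume f: "f \<in> a \<inter> b"
      from bspec[OF Int.IH(1) IntD1[OF f]] obtain K n e where
        1: "compact K \<and> K \<subseteq> \<Omega> \<and> enat n \<le> p \<and> 0 < e \<and> Cp_nbhd p \<Omega> f K n e \<subseteq> a" by (elim exE)
      from bspec[OF Int.IH(2) IntD2[OF f]] obtain K' n' e' where
        2: "compact K' \<and> K' \<subseteq> \<Omega> \<and> enat n' \<le> p \<and> 0 < e' \<and> Cp_nbhd p \<Omega> f K' n' e' \<subseteq> b" by (elim exE)
      have "Cp_nbhd p \<Omega> f (K \<union> K') (max n n') (min e e') \<subseteq> Cp_nbhd p \<Omega> f K n e \<inter> Cp_nbhd p \<Omega> f K' n' e'"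
        by (auto simp: Cp_nbhd_def)
      moreover have "enat (max n n') \<le> p" using 1 2 by (auto simp: max_def)
      ultimately show "\<exists>K n e. compact K \<and> K \<subseteq> \<Omega> \<and> enat n \<le> p \<and> 0 < e \<and> Cp_nbhd p \<Omega> f K n e \<subseteq> a \<inter> b"
        using 1 2 by (intro exI[of _ "K \<union> K'"] exI[of _ "max n n'"] exI[of _ "min e e'"]) auto
    qed
  next
    case (UN K)
    show ?case
    proof
      fix f assume "f \<in> \<Union>K"
      then obtain k where k: "k \<in> K" "f \<in> k" by blast
      from bspec[OF UN.IH[OF k(1)] k(2)] obtain K' n e where
        "compact K' \<and> K' \<subseteq> \<Omega> \<and> enat n \<le> p \<and> 0 < e \<and> Cp_nbhd p \<Omega> f K' n e \<subseteq> k" by (elim exE)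
      then show "\<exists>K' n e. compact K' \<and> K' \<subseteq> \<Omega> \<and> enat n \<le> p \<and> 0 < e \<and> Cp_nbhd p \<Omega> f K' n e \<subseteq> \<Union>K"
        using k(1) by (intro exI[of _ K'] exI[of _ n] exI[of _ e]) blast
    qed
  next
    case (Basis s)
    then obtain f0 K n e where s: "s = {g \<in> Cp_carrier p \<Omega>. Cp_seminorm K n (\<lambda>x. g x - f0 x) < e}"
      "f0 \<in> Cp_carrier p \<Omega>" "compact K" "K \<subseteq> \<Omega>" "enat n \<le> p" "0 < e" by blast
    have len: "enat (length is) \<le> p" if "length is \<le> n" for "is" :: "'d list"
      using that s(5) by (metis dual_order.trans enat_ord_simps(1))
    show ?case
    proof
      fix f assume "f \<in> s"
      then have f: "Cp_on p \<Omega> f" "Cp_seminorm K n (\<lambda>x. f x - f0 x) < e" using s by (auto simp: Cp_carrier_def)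
      then obtain r where r: "Cp_seminorm K n (\<lambda>x. f x - f0 x) < r" "r < e" using dense by blast
      have f0: "Cp_on p \<Omega> f0" using s by (simp add: Cp_carrier_def)
      define q where "q = max r (e / 2)"
      have q: "Cp_seminorm K n (\<lambda>x. f x - f0 x) < q" "q < e" "0 < q"
        using r s(6) by (auto simp: q_def max_def)
      have "Cp_nbhd p \<Omega> f K n ((e - q) / 2) \<subseteq> s"
      proof
        fix g assume g: "g \<in> Cp_nbhd p \<Omega> f K n ((e - q) / 2)"
        then have gC: "Cp_on p \<Omega> g" by (simp add: Cp_nbhd_def Cp_carrier_def)
        have "norm (partials is (\<lambda>x. g x - f0 x) x) \<le> (e + q) / 2" if *: "length is \<le> n" "x \<in> K" for "is" x
        proof -
          have x: "x \<in> \<Omega>" using * s by auto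
          have 1: "norm (partials is f x - partials is f0 x) < q"
            using Cp_seminorm_less[OF Cp_on_diff[OF assms(1) f(1) f0] s(3-5) q(1) *]
              partials_diff[OF assms(1) f(1) f0 len[OF *(1)] x] by simp
          have 2: "norm (partials is g x - partials is f x) < (e - q) / 2"
            using g * by (simp add: Cp_nbhd_def)
          have "partials is (\<lambda>x. g x - f0 x) x = (partials is g x - partials is f x) + (partials is f x - partials is f0 x)"
            using partials_diff[OF assms(1) gC f0 len[OF *(1)] x] by simp
          then have "norm (partials is (\<lambda>x. g x - f0 x) x) \<le> (e - q) / 2 + q"
            using 1 2 by (metis norm_triangle_mono less_imp_le)
          then show ?thesis by (simp add: field_simps)
        qed
        then have "Cp_seminorm K n (\<lambda>x. g x - f0 x) \<le> (e + q) / 2"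
          using q s(6) by (intro Cp_seminorm_le) auto
        then show "g \<in> s" using g q by (auto simp: s(1) Cp_nbhd_def)
      qed
      moreover have "0 < (e - q) / 2" using q by simp
      ultimately show "\<exists>K n e. compact K \<and> K \<subseteq> \<Omega> \<and> enat n \<le> p \<and> 0 < e \<and> Cp_nbhd p \<Omega> f K n e \<subseteq> s"
        using s(3-5) by blast
    qed
  qed auto
  then show thesis using assms(3) that by blast
qed

lemma Cp_dense_iff:
  fixes A :: "(real^'d::finite \<Rightarrow> 'k::real_normed_vector) set"
  assumes "open \<Omega>"
  shows "Cp_topology p \<Omega> closure_of A = topspace (Cp_topology p \<Omega>) \<longleftrightarrow>
    (\<forall>f K n e. f \<in> Cp_carrier p \<Omega> \<longrightarrow> compact K \<longrightarrow> K \<subseteq> \<Omega> \<longrightarrow> enat n \<le> p \<longrightarrow> 0 < e \<longrightarrow>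
       (\<exists>g\<in>A. g \<in> Cp_nbhd p \<Omega> f K n e))"
proof -
  have "Cp_topology p \<Omega> closure_of A = topspace (Cp_topology p \<Omega>) \<longleftrightarrow>
      (\<forall>f\<in>Cp_carrier p \<Omega>. \<forall>U. f \<in> U \<and> openin (Cp_topology p \<Omega>) U \<longrightarrow> (\<exists>g\<in>A. g \<in> U))"
    by (auto simp: closure_of_def)
  also have "\<dots> \<longleftrightarrow> (\<forall>f K n e. f \<in> Cp_carrier p \<Omega> \<longrightarrow> compact K \<longrightarrow> K \<subseteq> \<Omega> \<longrightarrow> enat n \<le> p \<longrightarrow> 0 < e \<longrightarrow>
       (\<exists>g\<in>A. g \<in> Cp_nbhd p \<Omega> f K n e))" (is "?L \<longleftrightarrow> ?R")
  proof
    assume L: ?L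
    show ?R
    proof (intro allI impI)
      fix f :: "real^'d \<Rightarrow> 'k" and K n e assume *: "f \<in> Cp_carrier p \<Omega>" "compact K" "K \<subseteq> \<Omega>" "enat n \<le> p" "0 < (e::real)"
      from Cp_nbhd_open[OF assms this] obtain U where
        U: "openin (Cp_topology p \<Omega>) U" "f \<in> U" "U \<subseteq> Cp_nbhd p \<Omega> f K n e" by blast
      then obtain g where "g \<in> A" "g \<in> U" using L *(1) by blast
      then show "\<exists>g\<in>A. g \<in> Cp_nbhd p \<Omega> f K n e" using U(3) by blast
    qed
  next
    assume R: ?R
    show ?L
    proof (intro ballI allI impI)
      fix f :: "real^'d \<Rightarrow> 'k" and U assume *: "f \<in> Cp_carrier p \<Omega>" "f \<in> U \<and> openin (Cp_topology p \<Omega>) U"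
      then obtain K n e where **: "compact K" "K \<subseteq> \<Omega>" "enat n \<le> p" "0 < e" "Cp_nbhd p \<Omega> f K n e \<subseteq> U"
        using openin_Cp_nbhd[OF assms] by blast
      then obtain g where "g \<in> A" "g \<in> Cp_nbhd p \<Omega> f K n e" using R *(1) by blast
      then show "\<exists>g\<in>A. g \<in> U" using **(5) by blast
    qed
  qed
  finally show ?thesis .
qed

lemma Cp_nbhd_agree:
  fixes f g :: "real^'d::finite \<Rightarrow> 'k::real_normed_vector"
  assumes "g \<in> Cp_carrier p \<Omega>" "open V" "K \<subseteq> V" "\<And>x. x \<in> V \<Longrightarrow> g x = f x" "0 < e"
  shows "g \<in> Cp_nbhd p \<Omega> f K n e"
proof -
  have "partials is g x = partials is f x" if "x \<in> K" for "is" :: "'d list" and x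
    by (rule partials_cong[OF assms(2,4)]) (use that assms(3) in auto)
  then show ?thesis using assms(1,5) by (simp add: Cp_nbhd_def)
qed

lemma continuous_map_partials:
  fixes "is" :: "'d::finite list"
  assumes "open \<Omega>" "x \<in> \<Omega>" "enat (length is) \<le> p"
  shows "continuous_map (Cp_topology p \<Omega>) euclidean
    (\<lambda>f :: real^'d \<Rightarrow> 'k::real_normed_vector. partials is f x)"
  unfolding continuous_map_def
proof (intro conjI allI impI)
  fix O' :: "'k set" assume O': "openin euclidean O'"
  show "openin (Cp_topology p \<Omega>) {f \<in> topspace (Cp_topology p \<Omega>). partials is f x \<in> O'}"
  proof (subst openin_subopen, rule ballI)
    fix f assume f: "f \<in> {f \<in> topspace (Cp_topology p \<Omega>). partials is f x \<in> O'}"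
    then obtain e where e: "e > 0" "\<And>y. dist y (partials is f x) < e \<Longrightarrow> y \<in> O'"
      using O' by (auto simp: open_dist)
    obtain U where U: "openin (Cp_topology p \<Omega>) U" "f \<in> U" "U \<subseteq> Cp_nbhd p \<Omega> f {x} (length is) e"
      using Cp_nbhd_open[OF assms(1), of f p "{x}" "length is" e] f e assms by auto
    then have "U \<subseteq> {f \<in> topspace (Cp_topology p \<Omega>). partials is f x \<in> O'}"
      using e(2) by (auto simp: Cp_nbhd_def dist_norm)
    then show "\<exists>T. openin (Cp_topology p \<Omega>) T \<and> f \<in> T \<and> T \<subseteq> {f \<in> topspace (Cp_topology p \<Omega>). partials is f x \<in> O'}"
      using U by blast
  qed
qed auto

lemma compact_exhaustion:
  fixes \<Omega> :: "'a::euclidean_space set"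
  assumes "open \<Omega>"
  shows "\<exists>C. (\<forall>n::nat. compact (C n) \<and> C n \<subseteq> \<Omega> \<and> C n \<subseteq> interior (C (Suc n))) \<and>
    (\<Union>n. C n) = \<Omega> \<and> (\<forall>K. compact K \<longrightarrow> K \<subseteq> \<Omega> \<longrightarrow> (\<exists>N. \<forall>n\<ge>N. K \<subseteq> C n))"
proof (rule open_Union_compact_subsets[OF assms])
  fix C :: "nat \<Rightarrow> 'a set"
  assume "\<And>n. compact (C n)" "\<And>n. C n \<subseteq> \<Omega>" "\<And>n. C n \<subseteq> interior (C (Suc n))" "\<Union> (range C) = \<Omega>"
    "\<And>K. compact K \<Longrightarrow> K \<subseteq> \<Omega> \<Longrightarrow> \<exists>N. \<forall>n\<ge>N. K \<subseteq> C n"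
  then show ?thesis by (intro exI[of _ C]) simp
qed

lemma Cp_separable:
  assumes "open \<Omega>"
  obtains D :: "nat \<Rightarrow> real^'d::finite \<Rightarrow> 'k::euclidean_space" where
    "\<And>i. D i \<in> Cp_carrier p \<Omega>"
    "\<And>f K n e. f \<in> Cp_carrier p \<Omega> \<Longrightarrow> compact K \<Longrightarrow> K \<subseteq> \<Omega> \<Longrightarrow> enat n \<le> p \<Longrightarrow> 0 < e \<Longrightarrow>
       \<exists>i. D i \<in> Cp_nbhd p \<Omega> f K n e"
proof -
  from compact_exhaustion[OF assms] obtain C where
    C0: "\<forall>n::nat. compact (C n) \<and> C n \<subseteq> \<Omega> \<and> C n \<subseteq> interior (C (Suc n))"
      "\<forall>K. compact K \<longrightarrow> K \<subseteq> \<Omega> \<longrightarrow> (\<exists>N. \<forall>n\<ge>N. K \<subseteq> C n)" by (elim exE conjE)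
  have C: "\<And>n. compact (C n)" "\<And>n. C n \<subseteq> \<Omega>" "\<And>K. compact K \<Longrightarrow> K \<subseteq> \<Omega> \<Longrightarrow> \<exists>N. \<forall>n\<ge>N. K \<subseteq> C n"
    using C0 by auto
  have "\<exists>Z. finite Z \<and> C m \<subseteq> (\<Union>z\<in>Z. ball z (1 / real (Suc N))) \<and> Z \<subseteq> C m" for m N
  proof -
    have "C m \<subseteq> (\<Union>z\<in>C m. ball z (1 / real (Suc N)))" by (auto intro!: centre_in_ball[THEN iffD2])
    then show ?thesis
      using compactE_image[OF C(1)[of m], of "C m" "\<lambda>z. ball z (1 / real (Suc N))"] by (metis open_ball)
  qed
  then obtain Z where Z: "\<And>m N. finite (Z m N)" "\<And>m N. C m \<subseteq> (\<Union>z\<in>Z m N. ball z (1 / real (Suc N)))"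
    "\<And>m N. Z m N \<subseteq> C m" by metis
  obtain Q :: "'k set" where Q: "countable Q" "\<And>X. open X \<Longrightarrow> X \<noteq> {} \<Longrightarrow> \<exists>d\<in>Q. d \<in> X"
    using countable_dense_exists by blast
  define data where "data m n N = Pi\<^sub>E ({is :: 'd list. length is \<le> n} \<times> Z m N) (\<lambda>_. Q)" for m n N
  define cond where "cond m n N M s f \<longleftrightarrow> f \<in> Cp_carrier p \<Omega> \<and>
    (\<forall>is z x. length is \<le> n \<longrightarrow> z \<in> Z m N \<longrightarrow> x \<in> C m \<inter> ball z (1 / real (Suc N)) \<longrightarrow>
       norm (partials is f x - s (is, z)) < 1 / real (Suc M))" for m n N M s and f :: "real^'d \<Rightarrow> 'k"
  define pick where "pick m n N M s = (SOME f. cond m n N M s f)" for m n N M s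
  have pick: "cond m n N M s (pick m n N M s)" if "cond m n N M s f" for m n N M s f
    unfolding pick_def by (rule someI[of _ f]) (rule that)
  define D0 where "D0 = (\<Union>m n N M. pick m n N M ` {s \<in> data m n N. \<exists>f. cond m n N M s f})"
  have "countable (data m n N)" for m n N
    unfolding data_def using Z(1) Q(1) by (intro countable_PiE finite_cartesian_product finite_lists_le) auto
  then have cD: "countable D0"
    unfolding D0_def by (intro countable_UN countable_image countable_Collect) auto
  have D0C: "d \<in> Cp_carrier p \<Omega>" if "d \<in> D0" for d
  proof -
    have "\<exists>m n N M s. cond m n N M s d"
      using that pick unfolding D0_def by fast
    then show ?thesis by (auto simp: cond_def)
  qed
  have main: "\<exists>d\<in>D0. d \<in> Cp_nbhd p \<Omega> f K n e"
    if f: "f \<in> Cp_carrier p \<Omega>" and K: "compact K" "K \<subseteq> \<Omega>" and n: "enat n \<le> p" and e: "0 < e" for f K n e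
  proof -
    obtain m where m: "K \<subseteq> C m" using C(3)[OF K] by blast
    obtain M where M: "1 / real (Suc M) < e / 2"
      using reals_Archimedean[of "e / 2"] e by (auto simp: inverse_eq_divide)
    define \<epsilon> where "\<epsilon> = 1 / real (Suc M)"
    have \<epsilon>: "\<epsilon> > 0" by (simp add: \<epsilon>_def)
    have "\<forall>is::'d list. length is \<le> n \<longrightarrow> (\<exists>\<delta>>0. \<forall>x\<in>C m. \<forall>z\<in>C m. dist x z < \<delta> \<longrightarrow> dist (partials is f x) (partials is f z) < \<epsilon> / 2)"
    proof (intro allI impI)
      fix "is" :: "'d list" assume "length is \<le> n"
      then have "enat (length is) \<le> p" using n by (metis dual_order.trans enat_ord_simps(1))
      then have "continuous_on (C m) (partials is f)"
        using f C(2) unfolding Cp_carrier_def Cp_on_def by (blast intro: continuous_on_subset)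
      then have "uniformly_continuous_on (C m) (partials is f)"
        using C(1) compact_uniformly_continuous by blast
      then have "\<exists>\<delta>>0. \<forall>x\<in>C m. \<forall>x'\<in>C m. dist x' x < \<delta> \<longrightarrow> dist (partials is f x') (partials is f x) < \<epsilon> / 2"
        using \<epsilon> unfolding uniformly_continuous_on_def by (metis half_gt_zero)
      then show "\<exists>\<delta>>0. \<forall>x\<in>C m. \<forall>z\<in>C m. dist x z < \<delta> \<longrightarrow> dist (partials is f x) (partials is f z) < \<epsilon> / 2"
        by blast
    qed
    then obtain \<delta> where \<delta>: "\<And>is::'d list. length is \<le> n \<Longrightarrow> \<delta> is > 0"
      "\<And>(is::'d list) x z. length is \<le> n \<Longrightarrow> x \<in> C m \<Longrightarrow> z \<in> C m \<Longrightarrow> dist x z < \<delta> is \<Longrightarrow>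
         dist (partials is f x) (partials is f z) < \<epsilon> / 2" by metis
    define \<Delta> where "\<Delta> = Min (\<delta> ` {is. length is \<le> n})"
    have ne: "{is :: 'd list. length is \<le> n} \<noteq> {}" by (auto intro: exI[of _ "[]"])
    then have "\<Delta> > 0"
      unfolding \<Delta>_def using \<delta>(1) finite_lists_le by (subst Min_gr_iff) auto
    then obtain N where "1 / real (Suc N) < \<Delta>"
      using reals_Archimedean by (auto simp: inverse_eq_divide)
    moreover have "\<Delta> \<le> \<delta> is" if "length is \<le> n" for "is"
      unfolding \<Delta>_def using that finite_lists_le by (intro Min_le) auto
    ultimately have N: "1 / real (Suc N) < \<delta> is" if "length is \<le> n" for "is"
      using that less_le_trans by blast
    have "\<exists>q\<in>Q. dist q y < \<epsilon> / 2" for y :: 'k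
      using Q(2)[of "ball y (\<epsilon> / 2)"] \<epsilon> by (auto simp: dist_commute)
    then obtain q where q: "\<And>y. q y \<in> Q" "\<And>y. dist (q y) y < \<epsilon> / 2" by metis
    define s where "s = restrict (\<lambda>(is, z). q (partials is f z)) ({is :: 'd list. length is \<le> n} \<times> Z m N)"
    have sd: "s \<in> data m n N" using q by (auto simp: s_def data_def)
    have cf: "cond m n N M s f"
      unfolding cond_def
    proof (intro conjI allI impI)
      fix "is" :: "'d list" and z x assume *: "length is \<le> n" "z \<in> Z m N" "x \<in> C m \<inter> ball z (1 / real (Suc N))"
      have "dist (partials is f x) (partials is f z) < \<epsilon> / 2"
        using \<delta>(2)[OF *(1), of x z] * N[OF *(1)] Z(3) by (force simp: dist_commute)
      then have "dist (partials is f x) (s (is, z)) < \<epsilon>"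
        using q(2)[of "partials is f z"] * dist_triangle[of "partials is f x" "q (partials is f z)" "partials is f z"]
        by (simp add: s_def dist_commute)
      then show "norm (partials is f x - s (is, z)) < 1 / real (Suc M)"
        by (simp add: dist_norm \<epsilon>_def)
    qed (use f in auto)
    define d where "d = pick m n N M s"
    have cd: "cond m n N M s d" unfolding d_def using cf by (rule pick)
    have "pick m n N M s \<in> pick m n N M ` {s \<in> data m n N. \<exists>f. cond m n N M s f}"
      using sd cf by (intro imageI) auto
    then have "d \<in> D0" unfolding D0_def d_def UN_iff by (intro bexI[OF _ UNIV_I])
    moreover have "norm (partials is d x - partials is f x) < e" if *: "length is \<le> n" "x \<in> K" for "is" x
    proof -
      obtain z where z: "z \<in> Z m N" "x \<in> C m \<inter> ball z (1 / real (Suc N))"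
        using subsetD[OF Z(2)[of m N] subsetD[OF m *(2)]] subsetD[OF m *(2)] by auto
      have "norm (partials is g x - s (is, z)) < e / 2" if "cond m n N M s g" for g
      proof -
        have "norm (partials is g x - s (is, z)) < 1 / real (Suc M)"
          using that z *(1) unfolding cond_def by simp
        then show ?thesis using M by (rule less_trans)
      qed
      from this[OF cd] this[OF cf]
      have "norm (partials is d x - s (is, z)) < e / 2" "norm (partials is f x - s (is, z)) < e / 2" .
      then show ?thesis using norm_triangle_half_l by blast
    qed
    ultimately show ?thesis using D0C by (auto simp: Cp_nbhd_def)
  qed
  have c0: "(restrict (\<lambda>x. 0) \<Omega> :: real^'d \<Rightarrow> 'k) \<in> Cp_carrier p \<Omega>"
    by (rule restrict_Cp_carrier[OF assms Cp_on_const[OF assms]])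
  have "\<exists>d\<in>D0. d \<in> Cp_nbhd p \<Omega> (restrict (\<lambda>x. 0) \<Omega>) {} 0 1"
    by (rule main[OF c0]) (simp_all flip: zero_enat_def)
  then have "D0 \<noteq> {}" by auto
  then have r: "range (from_nat_into D0) = D0" using cD by (rule range_from_nat_into)
  show thesis
  proof
    show "from_nat_into D0 i \<in> Cp_carrier p \<Omega>" for i
      by (rule D0C) (use r in auto)
    show "\<exists>i. from_nat_into D0 i \<in> Cp_nbhd p \<Omega> f K n e"
      if "f \<in> Cp_carrier p \<Omega>" "compact K" "K \<subseteq> \<Omega>" "enat n \<le> p" "0 < e" for f K n e
    proof -
      from main[OF that] have "\<exists>d\<in>range (from_nat_into D0). d \<in> Cp_nbhd p \<Omega> f K n e" unfolding r .
      then show ?thesis by simp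
    qed
  qed
qed

section \<open>Weighted composition operators\<close>

locale weighted_composition =
  fixes \<Omega> :: "(real^'d::finite) set" and p :: enat and \<psi> :: "real^'d \<Rightarrow> real^'d"
    and \<omega> :: "real^'d \<Rightarrow> 'k::{real_normed_field,euclidean_space}"
  assumes open_\<Omega>: "open \<Omega>" and p: "1 \<le> p"
    and \<psi>: "Cp_self_map p \<Omega> \<psi>" and \<omega>: "Cp_on p \<Omega> \<omega>"
begin

abbreviation X :: "(real^'d \<Rightarrow> 'k) topology" where "X \<equiv> Cp_topology p \<Omega>"
abbreviation C :: "(real^'d \<Rightarrow> 'k) \<Rightarrow> real^'d \<Rightarrow> 'k" where "C \<equiv> weighted_comp \<Omega> \<omega> \<psi>"

definition W :: "nat \<Rightarrow> real^'d \<Rightarrow> 'k" where "W n x = (\<Prod>j<n. \<omega> ((\<psi> ^^ j) x))"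

definition nondegenerate :: bool where
  "nondegenerate \<longleftrightarrow> (\<forall>x\<in>\<Omega>. \<omega> x \<noteq> 0) \<and> inj_on \<psi> \<Omega> \<and> (\<forall>x\<in>\<Omega>. det (jacobian \<psi> (at x)) \<noteq> 0)"

definition supercyclic_along :: "nat set \<Rightarrow> bool" where
  "supercyclic_along S \<longleftrightarrow> (\<exists>g\<in>topspace X. X closure_of {fun_scale \<Omega> c ((C ^^ n) g) | c n. n \<in> S} = topspace X)"

lemma iter_in: "x \<in> \<Omega> \<Longrightarrow> (\<psi> ^^ n) x \<in> \<Omega>"
  using \<psi> by (induction n) (auto simp: Cp_self_map_def)

lemma psi_in: "x \<in> \<Omega> \<Longrightarrow> \<psi> x \<in> \<Omega>"
  using iter_in[of x 1] by simp

lemma iter_Cp: "Cp_on p \<Omega> (\<lambda>x. (\<psi> ^^ n) x $ j)"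
proof (induction n arbitrary: j)
  case 0
  then show ?case using Cp_on_coord[OF open_\<Omega>] by simp
next
  case (Suc n)
  have "Cp_on p \<Omega> (\<lambda>x. \<psi> ((\<psi> ^^ n) x) $ j)"
    by (rule Cp_on_compose[OF open_\<Omega> open_\<Omega> _ _ Suc]) (use \<psi> iter_in in \<open>auto simp: Cp_self_map_def\<close>)
  then show ?case by simp
qed

lemma Cp_compose_iter: "Cp_on p \<Omega> f \<Longrightarrow> Cp_on p \<Omega> (\<lambda>x. f ((\<psi> ^^ n) x))"
  by (rule Cp_on_compose[OF open_\<Omega> open_\<Omega> _ _ iter_Cp]) (use iter_in in auto)

lemma W_Cp: "Cp_on p \<Omega> (W n)"
  unfolding W_def[abs_def] by (intro Cp_on_prod open_\<Omega> Cp_compose_iter \<omega>)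

lemma iter_continuous: "continuous_on \<Omega> (\<psi> ^^ n)"
  using continuous_on_vec_lambda[of \<Omega> "\<lambda>j x. (\<psi> ^^ n) x $ j"] Cp_on_continuous_on[OF iter_Cp] by simp

lemma W_add: "W (m + n) x = W m x * W n ((\<psi> ^^ m) x)"
  by (induction n) (simp_all add: W_def add.commute[of m] funpow_add)

lemma W_1 [simp]: "W 0 x = 1" "W (Suc 0) x = \<omega> x"
  by (simp_all add: W_def)

lemma C_iter: "x \<in> \<Omega> \<Longrightarrow> (C ^^ n) f x = W n x * f ((\<psi> ^^ n) x)"
proof (induction n arbitrary: x)
  case (Suc n)
  then show ?case
    using W_add[of 1 n x] psi_in by (simp add: weighted_comp_def funpow_swap1)
qed simp

lemma C_carrier: "f \<in> Cp_carrier p \<Omega> \<Longrightarrow> C f \<in> Cp_carrier p \<Omega>"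
  unfolding weighted_comp_def
  using Cp_compose_iter[of f 1] by (intro restrict_Cp_carrier Cp_on_mult open_\<Omega> \<omega>) (auto dest: Cp_carrierD)

lemma C_iter_carrier: "f \<in> Cp_carrier p \<Omega> \<Longrightarrow> (C ^^ n) f \<in> Cp_carrier p \<Omega>"
  by (induction n) (auto intro: C_carrier)

lemma fun_scale_carrier:
  fixes f :: "real^'d \<Rightarrow> 'k"
  shows "f \<in> Cp_carrier p \<Omega> \<Longrightarrow> fun_scale \<Omega> c f \<in> Cp_carrier p \<Omega>"
  unfolding fun_scale_def
  by (intro restrict_Cp_carrier open_\<Omega> Cp_on_mult[OF open_\<Omega> Cp_on_const[OF open_\<Omega>]] Cp_carrierD)

lemma fun_scale_1:
  fixes f :: "real^'d \<Rightarrow> 'k"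
  shows "f \<in> Cp_carrier p \<Omega> \<Longrightarrow> fun_scale \<Omega> 1 f = f"
  by (auto simp: fun_scale_def Cp_carrier_def restrict_def extensional_def)

lemma W_nonzero: "nondegenerate \<Longrightarrow> x \<in> \<Omega> \<Longrightarrow> W n x \<noteq> 0"
  using iter_in by (auto simp: W_def nondegenerate_def)

lemma iter_inj: "nondegenerate \<Longrightarrow> inj_on (\<psi> ^^ n) \<Omega>"
proof (induction n)
  case (Suc n)
  then have "inj_on (\<psi> \<circ> (\<psi> ^^ n)) \<Omega>"
    using iter_in by (intro comp_inj_on) (auto simp: nondegenerate_def intro: inj_on_subset)
  then show ?case by (simp add: comp_def)
qed simp

lemma iter_has_derivative:
  assumes "x \<in> \<Omega>"
  shows "((\<psi> ^^ n) has_derivative (\<lambda>v. jacobian (\<psi> ^^ n) (at x) *v v)) (at x)"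
proof (rule Ck_map_derivative(1)[OF _ assms])
  show "Ck (Suc 0) \<Omega> (\<lambda>x. (\<psi> ^^ n) x $ j)" for j
    using iter_Cp[of n j] p by (simp add: Cp_on_iff_Ck[OF open_\<Omega>] one_enat_def)
qed

lemma iter_det:
  assumes "nondegenerate" "x \<in> \<Omega>"
  shows "det (jacobian (\<psi> ^^ n) (at x)) \<noteq> 0"
proof (induction n)
  case 0
  have "jacobian (\<lambda>x. x) (at x) = (mat 1 :: real^'d^'d)"
    using frechet_derivative_at[OF has_derivative_ident[of "at x"]]
    by (simp add: jacobian_def id_def flip: matrix_id_mat_1)
  then show ?case by (simp add: id_def)
next
  case (Suc n)
  let ?A = "jacobian \<psi> (at ((\<psi> ^^ n) x))" and ?B = "jacobian (\<psi> ^^ n) (at x)"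
  have "((\<lambda>x. \<psi> ((\<psi> ^^ n) x)) has_derivative (\<lambda>v. ?A *v (?B *v v))) (at x)"
    using has_derivative_compose[OF iter_has_derivative[OF assms(2)]
        iter_has_derivative[OF iter_in[OF assms(2)], of 1 n]] by simp
  then have "((\<psi> ^^ Suc n) has_derivative (\<lambda>v. (?A ** ?B) *v v)) (at x)"
    by (simp add: matrix_vector_mul_assoc comp_def)
  then have "jacobian (\<psi> ^^ Suc n) (at x) = ?A ** ?B"
    by (simp only: jacobian_def[of "\<psi> ^^ Suc n"] frechet_derivative_at[symmetric] matrix_of_matrix_vector_mul)
  then show ?case
    using Suc assms iter_in by (simp add: det_mul nondegenerate_def del: funpow.simps)
qed

lemma glue_iter:
  assumes "nondegenerate" "Cp_on p \<Omega> h" "compact K" "K \<subseteq> \<Omega>" "open U" "(\<psi> ^^ n) ` K \<subseteq> U"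
  shows "\<exists>u M V. Cp_on p UNIV u \<and> compact M \<and> M \<subseteq> U \<and> (\<forall>x. x \<notin> M \<longrightarrow> u x = 0) \<and>
    open V \<and> K \<subseteq> V \<and> V \<subseteq> \<Omega> \<and> (\<psi> ^^ n) ` V \<subseteq> M \<and> (\<forall>x\<in>V. W n x * u ((\<psi> ^^ n) x) = h x)"
  using glue[OF open_\<Omega> p iter_Cp iter_inj[OF assms(1)] iter_det[OF assms(1)] W_Cp[of n] W_nonzero[OF assms(1)] assms(2-6)] .

lemma Cp_on_UNIV: "Cp_on p UNIV f \<Longrightarrow> Cp_on p \<Omega> f"
  using Cp_on_subset[OF open_UNIV open_\<Omega>] by simp

text \<open>The support of \<open>u\<close> avoids \<open>K\<close>, so \<open>f + u\<close> agrees with \<open>f\<close> near \<open>K\<close>.\<close>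

lemma ex_transfer:
  assumes nd: "nondegenerate" and K: "compact K" "K \<subseteq> \<Omega>" "(\<psi> ^^ n) ` K \<inter> K = {}"
    and f: "f \<in> Cp_carrier p \<Omega>" and h: "h \<in> Cp_carrier p \<Omega>"
  shows "\<exists>g V. g \<in> Cp_carrier p \<Omega> \<and> open V \<and> K \<subseteq> V \<and> (\<forall>x\<in>V. g x = f x \<and> (C ^^ n) g x = h x)"
proof -
  have 1: "Cp_on p \<Omega> (\<lambda>x. h x - (C ^^ n) f x)"
    using f h C_iter_carrier by (intro Cp_on_diff open_\<Omega>) (auto dest: Cp_carrierD)
  have 2: "open (- K)" "(\<psi> ^^ n) ` K \<subseteq> - K"
    using K by (auto simp: compact_imp_closed)
  from glue_iter[OF nd 1 K(1,2) 2] obtain u M V where u: "Cp_on p UNIV u" "compact M" "M \<subseteq> - K" "\<forall>x. x \<notin> M \<longrightarrow> u x = 0"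
    "open V" "K \<subseteq> V" "V \<subseteq> \<Omega>" "(\<psi> ^^ n) ` V \<subseteq> M" "\<forall>x\<in>V. W n x * u ((\<psi> ^^ n) x) = h x - (C ^^ n) f x"
    by (elim exE conjE)
  define g where "g = restrict (\<lambda>x. f x + u x) \<Omega>"
  show ?thesis
  proof (intro exI[of _ g] exI[of _ "V \<inter> - M"] conjI ballI)
    show "g \<in> Cp_carrier p \<Omega>"
      unfolding g_def by (intro restrict_Cp_carrier open_\<Omega> Cp_on_add[OF open_\<Omega> Cp_carrierD[OF f] Cp_on_UNIV[OF u(1)]])
    show "open (V \<inter> - M)" "K \<subseteq> V \<inter> - M"
      using u by (auto intro!: open_Int open_Compl simp: compact_imp_closed)
    show "g x = f x" if "x \<in> V \<inter> - M" for x
      using that u(4,7) by (auto simp: g_def)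
    show "(C ^^ n) g x = h x" if "x \<in> V \<inter> - M" for x
    proof -
      have x: "x \<in> \<Omega>" using that u(7) by auto
      then have "(C ^^ n) g x = W n x * f ((\<psi> ^^ n) x) + W n x * u ((\<psi> ^^ n) x)"
        using iter_in by (simp add: C_iter g_def distrib_left)
      then show ?thesis using u(9) that x by (simp add: C_iter)
    qed
  qed
qed

lemma ex_transfer_nbhd:
  assumes nd: "nondegenerate" and f: "f \<in> A" "openin X A" and h: "h \<in> B" "openin X B"
  shows "\<exists>K. compact K \<and> K \<subseteq> \<Omega> \<and> (\<forall>n. (\<psi> ^^ n) ` K \<inter> K = {} \<longrightarrow> (C ^^ n) ` A \<inter> B \<noteq> {})"
proof -
  have fh: "f \<in> Cp_carrier p \<Omega>" "h \<in> Cp_carrier p \<Omega>"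
    using f h openin_subset by fastforce+
  obtain K1 n1 e1 where 1: "compact K1" "K1 \<subseteq> \<Omega>" "enat n1 \<le> p" "0 < e1" "Cp_nbhd p \<Omega> f K1 n1 e1 \<subseteq> A"
    using openin_Cp_nbhd[OF open_\<Omega> f(2,1)] .
  obtain K2 n2 e2 where 2: "compact K2" "K2 \<subseteq> \<Omega>" "enat n2 \<le> p" "0 < e2" "Cp_nbhd p \<Omega> h K2 n2 e2 \<subseteq> B"
    using openin_Cp_nbhd[OF open_\<Omega> h(2,1)] .
  have K: "compact (K1 \<union> K2)" "K1 \<union> K2 \<subseteq> \<Omega>" using 1 2 by auto
  show ?thesis
  proof (intro exI[of _ "K1 \<union> K2"] conjI allI impI K)
    fix n assume n: "(\<psi> ^^ n) ` (K1 \<union> K2) \<inter> (K1 \<union> K2) = {}"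
    from ex_transfer[OF nd K n fh] obtain g V where g: "g \<in> Cp_carrier p \<Omega>" "open V" "K1 \<union> K2 \<subseteq> V"
      "\<forall>x\<in>V. g x = f x \<and> (C ^^ n) g x = h x"
      by (elim exE conjE)
    have "g \<in> Cp_nbhd p \<Omega> f K1 n1 e1"
      using g 1 by (intro Cp_nbhd_agree[of _ _ _ V]) auto
    moreover have "(C ^^ n) g \<in> Cp_nbhd p \<Omega> h K2 n2 e2"
      using g 2 by (intro Cp_nbhd_agree[of _ _ _ V] C_iter_carrier) auto
    ultimately show "(C ^^ n) ` A \<inter> B \<noteq> {}" using 1(5) 2(5) by blast
  qed
qed

lemma weakly_mixingI:
  assumes nd: "nondegenerate" and ra: "run_away \<Omega> \<psi>"
  shows "weakly_mixing X C"
  unfolding weakly_mixing_def transitive_def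
proof (intro allI impI)
  fix A B :: "((real^'d \<Rightarrow> 'k) \<times> (real^'d \<Rightarrow> 'k)) set"
  assume *: "openin (prod_topology X X) A \<and> openin (prod_topology X X) B \<and> A \<noteq> {} \<and> B \<noteq> {}"
  then obtain a1 a2 b1 b2 where ab: "(a1, a2) \<in> A" "(b1, b2) \<in> B" by auto
  obtain A1 A2 where A: "openin X A1" "openin X A2" "a1 \<in> A1" "a2 \<in> A2" "A1 \<times> A2 \<subseteq> A"
    using * ab(1) unfolding openin_prod_topology_alt by blast
  obtain B1 B2 where B: "openin X B1" "openin X B2" "b1 \<in> B1" "b2 \<in> B2" "B1 \<times> B2 \<subseteq> B"
    using * ab(2) unfolding openin_prod_topology_alt by blast
  from ex_transfer_nbhd[OF nd A(3,1) B(3,1)] obtain K1 where K1: "compact K1" "K1 \<subseteq> \<Omega>"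
    "\<forall>n. (\<psi> ^^ n) ` K1 \<inter> K1 = {} \<longrightarrow> (C ^^ n) ` A1 \<inter> B1 \<noteq> {}"
    by (elim exE conjE)
  from ex_transfer_nbhd[OF nd A(4,2) B(4,2)] obtain K2 where K2: "compact K2" "K2 \<subseteq> \<Omega>"
    "\<forall>n. (\<psi> ^^ n) ` K2 \<inter> K2 = {} \<longrightarrow> (C ^^ n) ` A2 \<inter> B2 \<noteq> {}"
    by (elim exE conjE)
  have "compact (K1 \<union> K2)" "K1 \<union> K2 \<subseteq> \<Omega>" using K1 K2 by auto
  then obtain n where n: "(\<psi> ^^ n) ` (K1 \<union> K2) \<inter> (K1 \<union> K2) = {}"
    using ra unfolding run_away_def by blast
  have "(C ^^ n) ` A1 \<inter> B1 \<noteq> {}" "(C ^^ n) ` A2 \<inter> B2 \<noteq> {}"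
    using n by (auto intro!: K1(3)[rule_format] K2(3)[rule_format])
  then obtain f1 f2 where f: "f1 \<in> A1" "(C ^^ n) f1 \<in> B1" "f2 \<in> A2" "(C ^^ n) f2 \<in> B2" by blast
  have "(map_prod C C ^^ n) (f1, f2) = ((C ^^ n) f1, (C ^^ n) f2)"
    by (induction n) auto
  then have "(map_prod C C ^^ n) (f1, f2) \<in> B" using f B(5) by auto
  moreover have "(f1, f2) \<in> A" using f A(5) by auto
  ultimately show "\<exists>n. (map_prod C C ^^ n) ` A \<inter> B \<noteq> {}" by blast
qed

lemma mixingI:
  assumes nd: "nondegenerate" and ra: "strongly_run_away \<Omega> \<psi>"
  shows "mixing X C"
  unfolding mixing_def
proof (intro allI impI)
  fix A B :: "(real^'d \<Rightarrow> 'k) set"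
  assume *: "openin X A \<and> openin X B \<and> A \<noteq> {} \<and> B \<noteq> {}"
  then obtain f h where fh: "f \<in> A" "h \<in> B" "openin X A" "openin X B" by auto
  from ex_transfer_nbhd[OF nd fh(1,3,2,4)] obtain K where K: "compact K" "K \<subseteq> \<Omega>"
    "\<forall>n. (\<psi> ^^ n) ` K \<inter> K = {} \<longrightarrow> (C ^^ n) ` A \<inter> B \<noteq> {}"
    by (elim exE conjE)
  obtain N where "\<forall>n\<ge>N. (\<psi> ^^ n) ` K \<inter> K = {}"
    using ra K(1,2) unfolding strongly_run_away_def by blast
  then show "\<exists>N. \<forall>n\<ge>N. (C ^^ n) ` A \<inter> B \<noteq> {}"
    using K(3) by (intro exI[of _ N]) simp
qed

text \<open>The vector \<open>g\<close> is a sum of functions \<open>u\<^sub>k\<close> with pairwise disjoint, locally finite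
  supports \<open>M\<^sub>k\<close>, chosen so that \<open>C\<^sup>n u\<^sub>k = h\<^sub>k\<close> near \<open>E\<^sub>k\<close> for a suitable \<open>n\<close> in \<open>S\<close>.\<close>

lemma supercyclic_alongI:
  assumes nd: "nondegenerate"
    and ra: "\<And>K. compact K \<Longrightarrow> K \<subseteq> \<Omega> \<Longrightarrow> \<exists>n\<in>S. (\<psi> ^^ n) ` K \<inter> K = {}"
  shows "supercyclic_along S"
proof -
  from compact_exhaustion[OF open_\<Omega>] obtain E where
    E: "\<forall>n::nat. compact (E n) \<and> E n \<subseteq> \<Omega> \<and> E n \<subseteq> interior (E (Suc n))" "(\<Union>n. E n) = \<Omega>"
      "\<forall>K. compact K \<longrightarrow> K \<subseteq> \<Omega> \<longrightarrow> (\<exists>N. \<forall>n\<ge>N. K \<subseteq> E n)" by (elim exE conjE)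
  obtain D :: "nat \<Rightarrow> real^'d \<Rightarrow> 'k" where D: "\<And>i. D i \<in> Cp_carrier p \<Omega>"
    "\<And>f K n e. f \<in> Cp_carrier p \<Omega> \<Longrightarrow> compact K \<Longrightarrow> K \<subseteq> \<Omega> \<Longrightarrow> enat n \<le> p \<Longrightarrow> 0 < e \<Longrightarrow>
       \<exists>i. D i \<in> Cp_nbhd p \<Omega> f K n e"
    using Cp_separable[OF open_\<Omega>] by blast
  define h where "h k = D (fst (prod_decode k))" for k
  have h: "Cp_on p \<Omega> (h k)" for k using D(1) by (simp add: h_def Cp_carrierD)
  define P where "P k = (\<lambda>(A, n, M, u, V). compact A \<and> A \<subseteq> \<Omega> \<and> E k \<subseteq> A \<and> M \<subseteq> \<Omega> \<and> compact M \<and> M \<inter> A = {} \<and> n \<in> S \<and>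
      Cp_on p UNIV u \<and> (\<forall>x. x \<notin> M \<longrightarrow> u x = 0) \<and> open V \<and> E k \<subseteq> V \<and> V \<subseteq> \<Omega> \<and> (\<psi> ^^ n) ` V \<subseteq> M \<and>
      (\<forall>x\<in>V. W n x * u ((\<psi> ^^ n) x) = h k x))" for k
  have step: "\<exists>s. P k s \<and> B \<subseteq> fst s" if B: "compact B" "B \<subseteq> \<Omega>" for B k
  proof -
    define A where "A = E k \<union> B"
    have A: "compact A" "A \<subseteq> \<Omega>" using B E(1) by (auto simp: A_def)
    then obtain n where n: "n \<in> S" "(\<psi> ^^ n) ` A \<inter> A = {}" using ra by blast
    have 1: "open (\<Omega> - A)" using A open_\<Omega> by (simp add: compact_imp_closed open_Diff)
    have 3: "compact (E k)" "E k \<subseteq> \<Omega>" using E(1) by auto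
    have 2: "(\<psi> ^^ n) ` E k \<subseteq> \<Omega> - A"
    proof (rule image_subsetI)
      fix y assume "y \<in> E k"
      then have "y \<in> A" "y \<in> \<Omega>" using 3(2) by (auto simp: A_def)
      then show "(\<psi> ^^ n) y \<in> \<Omega> - A" using n(2) iter_in by blast
    qed
    from glue_iter[OF nd h[of k] 3 1 2] obtain u M V where "Cp_on p UNIV u" "compact M" "M \<subseteq> \<Omega> - A" "\<forall>x. x \<notin> M \<longrightarrow> u x = 0"
      "open V" "E k \<subseteq> V" "V \<subseteq> \<Omega>" "(\<psi> ^^ n) ` V \<subseteq> M" "\<forall>x\<in>V. W n x * u ((\<psi> ^^ n) x) = h k x"
      by (elim exE conjE)
    then have "P k (A, n, M, u, V)" using A n by (auto simp: P_def A_def)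
    then show ?thesis by (intro exI[of _ "(A, n, M, u, V)"]) (auto simp: A_def)
  qed
  have "\<exists>s. P 0 s" using step[of "{}" 0] by auto
  moreover have "\<exists>s'. P (Suc k) s' \<and> fst s \<union> fst (snd (snd s)) \<subseteq> fst s'" if "P k s" for k s
    by (rule step) (use that in \<open>auto simp: P_def split: prod.splits\<close>)
  ultimately obtain s where s: "\<forall>k. P k (s k) \<and> fst (s k) \<union> fst (snd (snd (s k))) \<subseteq> fst (s (Suc k))"
    using dependent_nat_choice[of P "\<lambda>k s s'. fst s \<union> fst (snd (snd s)) \<subseteq> fst s'"] by blast
  define A where "A k = fst (s k)" for k
  define n where "n k = fst (snd (s k))" for k
  define M where "M k = fst (snd (snd (s k)))" for k
  define u where "u k = fst (snd (snd (snd (s k))))" for k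
  define V where "V k = snd (snd (snd (snd (s k))))" for k
  have Pk: "P k (A k, n k, M k, u k, V k)" for k
    using s by (simp add: A_def n_def M_def u_def V_def)
  have P: "E k \<subseteq> A k" "M k \<subseteq> \<Omega>" "M k \<inter> A k = {}" "n k \<in> S" "Cp_on p UNIV (u k)" "\<And>x. x \<notin> M k \<Longrightarrow> u k x = 0"
     "open (V k)" "E k \<subseteq> V k" "V k \<subseteq> \<Omega>" "(\<psi> ^^ n k) ` V k \<subseteq> M k"
     "\<And>x. x \<in> V k \<Longrightarrow> W (n k) x * u k ((\<psi> ^^ n k) x) = h k x" for k
    using Pk[of k] by (simp_all add: P_def)
  have AM: "A k \<union> M k \<subseteq> A (Suc k)" for k using s by (simp add: A_def M_def)
  have Amono: "A i \<subseteq> A k" if "i \<le> k" for i k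
    by (rule lift_Suc_mono_le[OF _ that, of A]) (rule order_trans[OF Un_upper1 AM])
  have Mdisj: "M i \<inter> M k = {}" if "i < k" for i k
    using Amono[of "Suc i" k] AM[of i] P(3)[of k] that by auto
  have Edisj: "M i \<inter> E k = {}" if "k \<le> i" for i k
    using Amono[OF that] P(1)[of k] P(3)[of i] by auto
  have only: "(\<Sum>i. u i x) = u k x" if "x \<in> M k" for k x
  proof -
    have "u i x = 0" if "i \<noteq> k" for i
      using Mdisj[of i k] Mdisj[of k i] \<open>x \<in> M k\<close> P(6)[of x i] that by (metis IntI empty_iff linorder_neqE_nat)
    then show ?thesis using suminf_finite[of "{k}" "\<lambda>i. u i x"] by auto
  qed
  define g where "g = restrict (\<lambda>x. \<Sum>i. u i x) \<Omega>"
  have gC: "g \<in> Cp_carrier p \<Omega>"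
    unfolding g_def
  proof (intro restrict_Cp_carrier open_\<Omega> Cp_on_local)
    fix x assume "x \<in> \<Omega>"
    then obtain k where k: "x \<in> interior (E k)" using E(1,2) by blast
    have 1: "(\<Sum>i<k. u i y) = (\<Sum>i. u i y)" if "y \<in> interior (E k)" for y
    proof (rule suminf_finite[symmetric])
      show "u i y = 0" if "i \<notin> {..<k}" for i
      proof (rule P(6))
        have "y \<in> E k" using \<open>y \<in> interior (E k)\<close> interior_subset by (rule subsetD[rotated])
        then show "y \<notin> M i" using Edisj[of k i] that by auto
      qed
    qed auto
    have 2: "Cp_on p (interior (E k)) (\<lambda>y. \<Sum>i<k. u i y)"
      by (rule Cp_on_sum[OF open_interior]) (rule Cp_on_subset[OF open_UNIV open_interior P(5) subset_UNIV])
    have "Cp_on p (interior (E k)) (\<lambda>x. \<Sum>i. u i x)"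
      by (rule Cp_on_cong[OF open_interior 2 1])
    then show "\<exists>T. open T \<and> x \<in> T \<and> Cp_on p T (\<lambda>x. \<Sum>i. u i x)"
      using k by (intro exI[of _ "interior (E k)"]) simp
  qed
  have gh: "(C ^^ n k) g x = h k x" if "x \<in> V k" for k x
  proof -
    have "(\<psi> ^^ n k) x \<in> M k" "x \<in> \<Omega>" using P(9,10) that by blast+
    then show ?thesis
      using only[of "(\<psi> ^^ n k) x" k] P(11)[OF that] iter_in by (simp add: C_iter g_def)
  qed
  have "X closure_of {fun_scale \<Omega> c ((C ^^ n) g) | c n. n \<in> S} = topspace X"
    unfolding Cp_dense_iff[OF open_\<Omega>]
  proof (intro allI impI)
    fix f :: "real^'d \<Rightarrow> 'k" and K m and e :: real
    assume *: "f \<in> Cp_carrier p \<Omega>" "compact K" "K \<subseteq> \<Omega>" "enat m \<le> p" "0 < e"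
    obtain i where i: "D i \<in> Cp_nbhd p \<Omega> f K m e" using D(2)[OF *] by blast
    obtain N where N: "\<forall>n\<ge>N. K \<subseteq> E n" using E(3) *(2,3) by blast
    define k where "k = prod_encode (i, N)"
    have "h k = D i" by (simp add: h_def k_def)
    have "K \<subseteq> V k" using N P(8)[of k] le_prod_encode_2[of N i] unfolding k_def by blast
    have eq: "partials is ((C ^^ n k) g) x = partials is (D i) x" if "length is \<le> m" "x \<in> K" for "is" x
      using that by (intro partials_cong[OF P(7)[of k]]) (use gh \<open>h k = D i\<close> \<open>K \<subseteq> V k\<close> in auto)
    have "(C ^^ n k) g \<in> Cp_nbhd p \<Omega> f K m e"
      using i eq C_iter_carrier[OF gC] by (simp add: Cp_nbhd_def)
    moreover have "(C ^^ n k) g \<in> {fun_scale \<Omega> c ((C ^^ n) g) | c n. n \<in> S}"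
      using fun_scale_1[OF C_iter_carrier[OF gC]] P(4) by (intro CollectI exI[of _ 1] exI[of _ "n k"]) simp
    ultimately show "\<exists>g'\<in>{fun_scale \<Omega> c ((C ^^ n) g) | c n. n \<in> S}. g' \<in> Cp_nbhd p \<Omega> f K m e" by blast
  qed
  then show ?thesis using gC unfolding supercyclic_along_def by auto
qed

end

section \<open>Obstructions to density\<close>

lemma continuous_on_det: "continuous_on S f \<Longrightarrow> continuous_on S (\<lambda>x. det (f x :: real^'n^'n::finite))"
  unfolding det_def by (intro continuous_intros)

lemma det_zero_imp_kernel:
  fixes A :: "real^'n^'n::finite"
  assumes "det A = 0"
  obtains v where "v \<noteq> 0" "A *v v = 0"
proof -
  have "\<not> inj ((*v) A)"
    using assms invertible_det_nz[of A] by (simp add: invertible_left_inverse flip: matrix_left_invertible_injective)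
  then show thesis
    using that linear_injective_0[of "(*v) A"] by auto
qed

text \<open>If \<open>1\<close> is an eigenvalue of \<open>M\<close>, some functional takes an arithmetic progression of values
  along the orbit. Otherwise the differences \<open>w\<close> form a dense orbit of \<open>M\<close>; for suitable exponents
  \<open>m\<close>, the determinant \<open>Q\<close> is then multiplied by \<open>det M\<close> at each step, although it vanishes
  somewhere and is unbounded.\<close>

lemma no_dense_affine_orbit:
  fixes M :: "real^'d^'d::finite"
  assumes rec: "\<And>n. z (Suc n) = M *v z n + b"
  shows "closure (range z) \<noteq> UNIV"
proof
  assume dense: "closure (range z) = UNIV"
  define N where "N = M - mat 1"
  have N: "N *v x = M *v x - x" for x by (simp add: N_def matrix_vector_mult_diff_rdistrib)
  show False
  proof (cases "det N = 0")
    case True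
    then obtain v where v: "v \<noteq> 0" "transpose N *v v = 0"
      using det_zero_imp_kernel[of "transpose N"] by auto
    have "v \<bullet> (N *v x) = 0" for x
      using v(2) by (simp add: transpose_matrix_vector flip: dot_lmul_matrix)
    then have "v \<bullet> (M *v x) = v \<bullet> x" for x
      by (simp add: N inner_diff_right)
    then have "v \<bullet> z (Suc n) = v \<bullet> z n + v \<bullet> b" for n
      by (simp add: rec inner_right_distrib)
    then have z: "v \<bullet> z n = v \<bullet> z 0 + real n * (v \<bullet> b)" for n
      by (induction n) (auto simp: algebra_simps)
    show False
    proof (cases "v \<bullet> b \<ge> 0")
      case True
      have "closure (range z) \<subseteq> {x. v \<bullet> x \<ge> v \<bullet> z 0}"
      proof (rule closure_minimal[OF _ closed_halfspace_ge])
        show "range z \<subseteq> {x. v \<bullet> x \<ge> v \<bullet> z 0}"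
        proof (rule image_subsetI)
          fix n show "z n \<in> {x. v \<bullet> x \<ge> v \<bullet> z 0}"
            using True z[of n] mult_nonneg_nonneg[of "real n" "v \<bullet> b"] by simp
        qed
      qed
      then have "z 0 - v \<in> {x. v \<bullet> x \<ge> v \<bullet> z 0}" using dense by blast
      then show False using inner_gt_zero_iff[THEN iffD2, OF v(1)] by (simp add: inner_diff_right)
    next
      case False
      have "closure (range z) \<subseteq> {x. v \<bullet> x \<le> v \<bullet> z 0}"
      proof (rule closure_minimal[OF _ closed_halfspace_le])
        show "range z \<subseteq> {x. v \<bullet> x \<le> v \<bullet> z 0}"
        proof (rule image_subsetI)
          fix n show "z n \<in> {x. v \<bullet> x \<le> v \<bullet> z 0}"
            using False z[of n] mult_nonneg_nonpos[of "real n" "v \<bullet> b"] by simp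
        qed
      qed
      then have "z 0 + v \<in> {x. v \<bullet> x \<le> v \<bullet> z 0}" using dense by blast
      then show False using inner_gt_zero_iff[THEN iffD2, OF v(1)] by (simp add: inner_right_distrib)
    qed
  next
    case False
    define h where "h x = N *v x + b" for x
    define w where "w n = h (z n)" for n
    have w: "w (Suc n) = M *v w n" for n
      by (simp add: w_def h_def N rec matrix_vector_right_distrib matrix_vector_mult_diff_distrib)
    have wn: "w n = ((*v) M ^^ n) (w 0)" for n by (induction n) (auto simp: w)
    have wdense: "closure (range w) = UNIV"
    proof -
      have "surj h"
      proof (rule surjI)
        fix y
        show "h (THE x. h x = y) = y"
        proof (rule theI')
          show "\<exists>!x. h x = y"
            using cramer[OF False, of _ "y - b"] by (auto simp: h_def eq_diff_eq)
        qed
      qed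
      have "continuous_on (closure (range z)) h"
        unfolding h_def by (intro continuous_intros)
      then have "h ` closure (range z) \<subseteq> closure (h ` range z)"
        by (rule image_closure_subset) (auto intro: closure_subset[THEN subsetD])
      then show ?thesis
        using \<open>surj h\<close> dense by (simp add: w_def[abs_def] image_image top_le)
    qed
    have "\<exists>f. (\<forall>k. f k \<in> range w) \<and> f \<longlonglongrightarrow> axis i 1" for i :: 'd
      using wdense closure_sequential[of "axis i 1" "range w"] by auto
    then obtain f where f: "\<And>i k. f i k \<in> range w" "\<And>i::'d. f i \<longlonglongrightarrow> axis i 1" by metis
    have "(\<lambda>k. \<chi> i. f i k) \<longlonglongrightarrow> ((\<chi> i. axis i 1) :: real^'d^'d)"
      by (rule vec_tendstoI) (simp add: f(2))
    moreover have "isCont det ((\<chi> i. axis i 1) :: real^'d^'d)"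
      using continuous_on_det[OF continuous_on_id, of UNIV] continuous_on_eq_continuous_at by blast
    ultimately have "(\<lambda>k. det (\<chi> i. f i k)) \<longlonglongrightarrow> det ((\<chi> i. axis i 1) :: real^'d^'d)"
      using isCont_tendsto_compose by blast
    moreover have "((\<chi> i. axis i 1) :: real^'d^'d) = mat 1"
      by (auto simp: mat_def axis_def vec_eq_iff)
    ultimately have "(\<lambda>k. det (\<chi> i. f i k)) \<longlonglongrightarrow> 1" by simp
    then have "\<forall>\<^sub>F k in sequentially. det (\<chi> i. f i k) > 0"
      by (rule order_tendstoD) simp
    from eventually_happens'[OF sequentially_bot this]
    obtain k where k: "det (\<chi> i. f i k) > 0" by (elim exE)
    have "\<exists>n. f i k = w n" for i using f(1)[of i k] by (simp add: image_iff)
    then obtain m where m: "\<And>i. f i k = w (m i)" by metis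
    define Q where "Q x = det (\<chi> i. ((*v) M ^^ m i) x)" for x
    have Q0: "Q (w 0) \<noteq> 0" using k by (simp add: Q_def m wn[symmetric])
    have comm: "((*v) M ^^ j) (M *v x) = M *v ((*v) M ^^ j) x" for j x
      by (simp add: funpow_swap1)
    have QM: "Q (M *v x) = det M * Q x" for x
    proof -
      have "(\<chi> i. ((*v) M ^^ m i) (M *v x)) = (\<chi> i. ((*v) M ^^ m i) x) ** transpose M"
        unfolding comm by (simp add: vec_eq_iff matrix_matrix_mult_def matrix_vector_mult_def transpose_def mult.commute)
      then show ?thesis by (simp add: Q_def det_mul)
    qed
    have Qw: "Q (w n) = det M ^ n * Q (w 0)" for n by (induction n) (auto simp: w QM)
    have lin: "linear ((*v) M ^^ j)" for j
    proof (induction j)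
      case (Suc j)
      from linear_compose[OF this matrix_vector_mul_linear[of M]] show ?case by (simp add: comp_def)
    qed (simp add: linear_id[unfolded id_def])
    have cont: "continuous_on UNIV Q"
      unfolding Q_def using lin
      by (intro continuous_on_det continuous_on_vec_lambda linear_continuous_on linear_conv_bounded_linear[THEN iffD1])
    have zero: "Q 0 = 0"
      unfolding Q_def by (rule det_zero_row(1)) (simp add: row_def lin linear_0 vec_eq_iff)
    have two: "Q (2 *\<^sub>R x) = 2 ^ CARD('d) * Q x" for x
      using det_rows_mul[of "\<lambda>_. 2" "\<lambda>i. ((*v) M ^^ m i) x"]
      by (simp add: Q_def linear_cmul[OF lin] scalar_mult_eq_scaleR)
    show False
    proof (cases "\<bar>det M\<bar> \<le> 1")
      case True
      have "closure (range w) \<subseteq> {x. \<bar>Q x\<bar> \<le> \<bar>Q (w 0)\<bar>}"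
      proof (rule closure_minimal)
        show "range w \<subseteq> {x. \<bar>Q x\<bar> \<le> \<bar>Q (w 0)\<bar>}"
        proof (rule image_subsetI)
          fix n
          have "\<bar>det M\<bar> ^ n * \<bar>Q (w 0)\<bar> \<le> 1 * \<bar>Q (w 0)\<bar>"
            using True by (intro mult_right_mono power_le_one) auto
          then show "w n \<in> {x. \<bar>Q x\<bar> \<le> \<bar>Q (w 0)\<bar>}"
            by (simp add: Qw[of n] abs_mult power_abs)
        qed
        show "closed {x. \<bar>Q x\<bar> \<le> \<bar>Q (w 0)\<bar>}"
          by (intro closed_Collect_le continuous_intros cont)
      qed
      then have "\<bar>Q (2 *\<^sub>R w 0)\<bar> \<le> \<bar>Q (w 0)\<bar>" using wdense by blast
      then have "2 ^ CARD('d) * \<bar>Q (w 0)\<bar> \<le> 1 * \<bar>Q (w 0)\<bar>" by (simp add: two abs_mult)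
      then have "(2::real) ^ CARD('d) \<le> 1" using Q0 by (simp only: mult_le_cancel_right)
      moreover have "(1::real) < 2 ^ CARD('d)" by (intro one_less_power) auto
      ultimately show False by simp
    next
      case False
      have "closure (range w) \<subseteq> {x. \<bar>Q (w 0)\<bar> \<le> \<bar>Q x\<bar>}"
      proof (rule closure_minimal)
        show "range w \<subseteq> {x. \<bar>Q (w 0)\<bar> \<le> \<bar>Q x\<bar>}"
        proof (rule image_subsetI)
          fix n
          have "1 * \<bar>Q (w 0)\<bar> \<le> \<bar>det M\<bar> ^ n * \<bar>Q (w 0)\<bar>"
            using False by (intro mult_right_mono one_le_power) auto
          then show "w n \<in> {x. \<bar>Q (w 0)\<bar> \<le> \<bar>Q x\<bar>}"
            by (simp add: Qw[of n] abs_mult power_abs)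
        qed
        show "closed {x. \<bar>Q (w 0)\<bar> \<le> \<bar>Q x\<bar>}"
          by (intro closed_Collect_le continuous_intros cont)
      qed
      then have "\<bar>Q (w 0)\<bar> \<le> \<bar>Q 0\<bar>" using wdense by blast
      then show False using zero Q0 by simp
    qed
  qed
qed

definition aff :: "(real^'d::finite) set \<Rightarrow> 'k::real_normed_vector \<Rightarrow> 'k^'d \<Rightarrow> real^'d \<Rightarrow> real^'d \<Rightarrow> 'k" where
  "aff \<Omega> a w x0 = restrict (\<lambda>x. a + (\<Sum>i\<in>UNIV. (x $ i - x0 $ i) *\<^sub>R w $ i)) \<Omega>"

lemma partials1_eq:
  assumes "(f has_derivative f') (at x)"
  shows "partials [i] f x = f' (axis i 1)"
  using partial_deriv_frechet[of f x i] frechet_derivative_at[OF assms] assms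
  by (auto simp: partials_Cons differentiable_def)

lemma aff_carrier: "open \<Omega> \<Longrightarrow> aff \<Omega> a w x0 \<in> Cp_carrier p \<Omega>"
  unfolding aff_def
  by (intro restrict_Cp_carrier Cp_on_add Cp_on_sum Cp_on_scaleR Cp_on_diff Cp_on_const Cp_on_coord)

lemma aff_partials:
  assumes "open \<Omega>" "x \<in> \<Omega>"
  shows "partials [i] (aff \<Omega> a w x0) x = w $ i"
proof -
  have "((\<lambda>x. a + (\<Sum>i\<in>UNIV. (x $ i - x0 $ i) *\<^sub>R w $ i)) has_derivative
      (\<lambda>v. 0 + (\<Sum>i\<in>UNIV. (v $ i - 0) *\<^sub>R w $ i))) (at x)"
    by (intro has_derivative_add has_derivative_const has_derivative_sum has_derivative_scaleR_left
        has_derivative_diff bounded_linear_imp_has_derivative bounded_linear_vec_nth)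
  from partials1_eq[OF this, of i]
  have "partials [i] (\<lambda>x. a + (\<Sum>i\<in>UNIV. (x $ i - x0 $ i) *\<^sub>R w $ i)) x = w $ i"
    by (simp add: axis_def if_distrib[of "\<lambda>c. c *\<^sub>R _"] cong: if_cong)
  then show ?thesis
    using partials_cong[OF assms(1) _ assms(2), of "aff \<Omega> a w x0"] by (simp add: aff_def)
qed

lemma continuous_map_compose_euclidean:
  fixes f :: "'a \<Rightarrow> 'b::topological_space" and h :: "'b \<Rightarrow> 'c::topological_space"
  assumes "continuous_map X euclidean f" "continuous_on UNIV h"
  shows "continuous_map X euclidean (\<lambda>x. h (f x))"
  using continuous_map_compose[OF assms(1), of euclidean h] assms(2)
  by (simp add: comp_def continuous_map_iff_continuous2)

lemma continuous_map_Pair_euclidean: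
  fixes f :: "'a \<Rightarrow> 'b::topological_space" and h :: "'a \<Rightarrow> 'c::topological_space"
  assumes "continuous_map X euclidean f" "continuous_map X euclidean h"
  shows "continuous_map X euclidean (\<lambda>x. (f x, h x))"
  using continuous_map_pairedI[OF assms] by simp

context weighted_composition
begin

definition D :: "(real^'d \<Rightarrow> 'k) \<Rightarrow> real^'d \<Rightarrow> real^'d \<Rightarrow> 'k" where
  "D f x v = (\<Sum>i\<in>UNIV. v $ i *\<^sub>R partials [i] f x)"

lemma has_derivative_D:
  assumes "Cp_on p \<Omega> f" "x \<in> \<Omega>"
  shows "(f has_derivative D f x) (at x)"
proof -
  have "Ck (Suc 0) \<Omega> f"
    using assms(1) p by (simp add: Cp_on_iff_Ck[OF open_\<Omega>] one_enat_def)
  from Ck_SucD(1)[OF this assms(2)] have d: "(f has_derivative frechet_derivative f (at x)) (at x)" .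
  have "frechet_derivative f (at x) = D f x"
  proof
    fix v
    show "frechet_derivative f (at x) v = D f x v"
      unfolding D_def by (subst has_derivative_expand[OF d]) (simp add: partials1_eq[OF d])
  qed
  then show ?thesis using d by simp
qed

lemma D_C:
  assumes f: "f \<in> Cp_carrier p \<Omega>" and x: "x \<in> \<Omega>"
  shows "D (C f) x v = \<omega> x * D f (\<psi> x) (jacobian \<psi> (at x) *v v) + D \<omega> x v * f (\<psi> x)"
proof -
  have 1: "(\<psi> has_derivative (\<lambda>v. jacobian \<psi> (at x) *v v)) (at x)"
    using iter_has_derivative[OF x, of 1] by simp
  have 2: "((\<lambda>x. f (\<psi> x)) has_derivative (\<lambda>v. D f (\<psi> x) (jacobian \<psi> (at x) *v v))) (at x)"
    by (rule has_derivative_compose[OF 1 has_derivative_D[OF Cp_carrierD[OF f] psi_in[OF x]]])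
  have 3: "(C f has_derivative (\<lambda>v. \<omega> x * D f (\<psi> x) (jacobian \<psi> (at x) *v v) + D \<omega> x v * f (\<psi> x))) (at x)"
    by (rule has_derivative_transform_within_open[OF has_derivative_mult[OF has_derivative_D[OF \<omega> x] 2] open_\<Omega> x])
      (simp add: weighted_comp_def)
  show ?thesis
    by (rule fun_cong[OF has_derivative_unique[OF has_derivative_D[OF Cp_carrierD[OF C_carrier[OF f]] x] 3]])
qed

lemma D_axis: "D f x (axis i 1) = partials [i] f x"
  by (simp add: D_def axis_def if_distrib[of "\<lambda>c. c *\<^sub>R _"] cong: if_cong)

lemma D_scale:
  assumes "f \<in> Cp_carrier p \<Omega>" "x \<in> \<Omega>"
  shows "D (fun_scale \<Omega> c f) x v = c * D f x v"
proof -
  have "((\<lambda>x. c * f x) has_derivative (\<lambda>v. c * D f x v)) (at x)"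
    using has_derivative_D[OF Cp_carrierD] assms by (intro has_derivative_mult_right) auto
  then have "(fun_scale \<Omega> c f has_derivative (\<lambda>v. c * D f x v)) (at x)"
    by (rule has_derivative_transform_within_open[OF _ open_\<Omega> assms(2)]) (simp add: fun_scale_def)
  from fun_cong[OF has_derivative_unique[OF has_derivative_D[OF Cp_carrierD[OF fun_scale_carrier[OF assms(1)]] assms(2)] this]]
  show ?thesis .
qed

lemma fun_scale_apply: "x \<in> \<Omega> \<Longrightarrow> fun_scale \<Omega> c f x = c * f x"
  by (simp add: fun_scale_def)

lemma continuous_map_eval: "x \<in> \<Omega> \<Longrightarrow> continuous_map X euclidean (\<lambda>f. f x)"
  using continuous_map_partials[OF open_\<Omega>, of x "[]" p] by (simp flip: zero_enat_def)

lemma continuous_map_partials1: "x \<in> \<Omega> \<Longrightarrow> continuous_map X euclidean (\<lambda>f :: real^'d \<Rightarrow> 'k. partials [i] f x)"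
  using continuous_map_partials[OF open_\<Omega>, of x "[i]" p] p by (simp add: one_enat_def)

definition functional_pair :: "((real^'d \<Rightarrow> 'k) \<Rightarrow> 'k \<times> 'k) \<Rightarrow> bool" where
  "functional_pair L \<longleftrightarrow> continuous_map X euclidean L \<and> (\<forall>z. \<exists>f\<in>Cp_carrier p \<Omega>. L f = z) \<and>
     (\<forall>f\<in>Cp_carrier p \<Omega>. \<forall>c. L (fun_scale \<Omega> c f) = (c * fst (L f), c * snd (L f)))"

lemma functional_pair_eval:
  assumes "x0 \<in> \<Omega>" "x1 \<in> \<Omega>" "x0 \<noteq> x1"
  shows "functional_pair (\<lambda>f. (f x0, f x1))"
  unfolding functional_pair_def
proof (intro conjI allI ballI)
  show "continuous_map X euclidean (\<lambda>f :: real^'d \<Rightarrow> 'k. (f x0, f x1))"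
    using assms by (intro continuous_map_Pair_euclidean continuous_map_eval)
  fix z :: "'k \<times> 'k"
  define d where "d = (x1 - x0) \<bullet> (x1 - x0)"
  define w where "w = (\<chi> i. ((x1 - x0) $ i / d) *\<^sub>R (snd z - fst z))"
  have "d \<noteq> 0" using assms by (simp add: d_def)
  have "(\<Sum>i\<in>UNIV. (x1 $ i - x0 $ i) *\<^sub>R w $ i) =
      (\<Sum>i\<in>UNIV. (x1 $ i - x0 $ i) * (x1 $ i - x0 $ i) / d) *\<^sub>R (snd z - fst z)"
    by (simp add: w_def scaleR_sum_left)
  also have "\<dots> = (d / d) *\<^sub>R (snd z - fst z)"
    by (subst (2) d_def) (simp add: inner_vec_def flip: sum_divide_distrib)
  finally have "(\<Sum>i\<in>UNIV. (x1 $ i - x0 $ i) *\<^sub>R w $ i) = (d / d) *\<^sub>R (snd z - fst z)" .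
  then have "aff \<Omega> (fst z) w x0 x1 = snd z"
    using \<open>d \<noteq> 0\<close> assms by (simp add: aff_def)
  moreover have "aff \<Omega> (fst z) w x0 x0 = fst z" using assms by (simp add: aff_def)
  ultimately show "\<exists>f\<in>Cp_carrier p \<Omega>. (f x0, f x1) = z"
    using aff_carrier[OF open_\<Omega>] by (intro bexI[of _ "aff \<Omega> (fst z) w x0"]) auto
qed (use assms in \<open>auto simp: fun_scale_apply\<close>)

lemma functional_pair_D:
  assumes "x \<in> \<Omega>" "v \<noteq> 0"
  shows "functional_pair (\<lambda>f. (f x, D f x v))"
  unfolding functional_pair_def
proof (intro conjI allI ballI)
  have "continuous_map X euclidean (\<lambda>f :: real^'d \<Rightarrow> 'k. D f x v)"
    unfolding D_def
    by (intro continuous_map_sum continuous_map_compose_euclidean[OF continuous_map_partials1[OF assms(1)]])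
      (auto intro: continuous_intros)
  then show "continuous_map X euclidean (\<lambda>f :: real^'d \<Rightarrow> 'k. (f x, D f x v))"
    using assms by (intro continuous_map_Pair_euclidean continuous_map_eval)
  fix z :: "'k \<times> 'k"
  define d where "d = v \<bullet> v"
  define w where "w = (\<chi> i. (v $ i / d) *\<^sub>R snd z)"
  have "d \<noteq> 0" using assms by (simp add: d_def)
  have "D (aff \<Omega> (fst z) w x) x v = (\<Sum>i\<in>UNIV. v $ i * v $ i / d) *\<^sub>R snd z"
    unfolding D_def aff_partials[OF open_\<Omega> assms(1)] by (simp add: w_def scaleR_sum_left)
  also have "(\<Sum>i\<in>UNIV. v $ i * v $ i / d) = d / d"
    by (subst (2) d_def) (simp add: inner_vec_def flip: sum_divide_distrib)
  finally have "D (aff \<Omega> (fst z) w x) x v = snd z" using \<open>d \<noteq> 0\<close> by simp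
  moreover have "aff \<Omega> (fst z) w x x = fst z" using assms by (simp add: aff_def)
  ultimately show "\<exists>f\<in>Cp_carrier p \<Omega>. (f x, D f x v) = z"
    using aff_carrier[OF open_\<Omega>] by (intro bexI[of _ "aff \<Omega> (fst z) w x"]) auto
qed (use assms in \<open>auto simp: fun_scale_apply D_scale\<close>)

lemma orbit_not_in_lines:
  assumes L: "functional_pair L" and g: "g \<in> Cp_carrier p \<Omega>"
    and dense: "X closure_of {fun_scale \<Omega> c ((C ^^ n) g) | c n. n \<in> S} = topspace X"
    and P: "finite P" "(0, 0) \<notin> P" "\<And>n. n \<in> S \<Longrightarrow> \<exists>(a, b)\<in>P. fst (L ((C ^^ n) g)) * b = snd (L ((C ^^ n) g)) * a"
  shows False
proof -
  define A where "A = {fun_scale \<Omega> c ((C ^^ n) g) | c n. n \<in> S}"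
  define F where "F = (\<Union>q\<in>P. {z. fst z * snd q = snd z * fst q})"
  have "closed F"
    unfolding F_def using P(1) by (intro closed_UN ballI closed_Collect_eq continuous_intros)
  have "L ` A \<subseteq> F"
  proof
    fix z assume "z \<in> L ` A"
    then obtain c n where n: "n \<in> S" "z = L (fun_scale \<Omega> c ((C ^^ n) g))" by (auto simp: A_def)
    then have z: "z = (c * fst (L ((C ^^ n) g)), c * snd (L ((C ^^ n) g)))"
      using L C_iter_carrier[OF g] by (auto simp: functional_pair_def)
    obtain q where q: "q \<in> P" "fst (L ((C ^^ n) g)) * snd q = snd (L ((C ^^ n) g)) * fst q"
      using P(3)[OF n(1)] by force
    have "z \<in> {z. fst z * snd q = snd z * fst q}" using q(2) by (simp add: z mult.assoc)
    then show "z \<in> F" using q(1) unfolding F_def by (rule UN_I[rotated])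
  qed
  then have "closure (L ` A) \<subseteq> F"
    using \<open>closed F\<close> by (rule closure_minimal)
  moreover have "L ` (X closure_of A) \<subseteq> euclidean closure_of (L ` A)"
    using L by (intro continuous_map_image_closure_subset) (simp add: functional_pair_def)
  ultimately have "L ` Cp_carrier p \<Omega> \<subseteq> F"
    using dense by (simp add: A_def)
  have inF: "(1, t) \<in> F" for t
  proof -
    have "\<exists>f\<in>Cp_carrier p \<Omega>. L f = (1, t)" using L unfolding functional_pair_def by simp
    then have "(1, t) \<in> L ` Cp_carrier p \<Omega>" by force
    then show ?thesis using \<open>L ` Cp_carrier p \<Omega> \<subseteq> F\<close> by (rule subsetD[rotated])
  qed
  have "t \<in> (\<lambda>q. snd q / fst q) ` P" for t
  proof -
    obtain q where q: "q \<in> P" "snd q = t * fst q" using inF[of t] by (auto simp: F_def)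
    then have "fst q \<noteq> 0" using P(2) by (metis mult_zero_right prod.collapse)
    then have "t = snd q / fst q" using q by simp
    then show ?thesis using q(1) by (rule image_eqI)
  qed
  then have "UNIV \<subseteq> (\<lambda>q. snd q / fst q) ` P" by blast
  then have "finite (UNIV :: 'k set)" using P(1) finite_surj by blast
  then show False using infinite_UNIV_char_0 by blast
qed

lemma degenerate_line:
  assumes "\<not> nondegenerate"
  shows "\<exists>L a b. functional_pair L \<and> (a, b) \<noteq> (0, 0) \<and>
    (\<forall>f\<in>Cp_carrier p \<Omega>. fst (L (C f)) * b = snd (L (C f)) * a)"
proof -
  consider (zero) x where "x \<in> \<Omega>" "\<omega> x = 0"
    | (inj) x y where "x \<in> \<Omega>" "y \<in> \<Omega>" "x \<noteq> y" "\<psi> x = \<psi> y" "\<omega> x \<noteq> 0"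
    | (det) x where "x \<in> \<Omega>" "det (jacobian \<psi> (at x)) = 0" "\<omega> x \<noteq> 0"
    using assms unfolding nondegenerate_def inj_on_def by blast
  then show ?thesis
  proof cases
    case zero
    obtain r where r: "r > 0" "ball x r \<subseteq> \<Omega>" using open_\<Omega> zero(1) openE by blast
    define y where "y = x + (r / 2) *\<^sub>R axis undefined 1"
    have "y \<in> ball x r" "y \<noteq> x" using r(1) by (auto simp: y_def dist_norm axis_eq_0_iff)
    then have "functional_pair (\<lambda>f. (f x, f y))"
      using zero r by (intro functional_pair_eval) auto
    moreover have "C f x = 0" for f using zero by (simp add: weighted_comp_def)
    ultimately show ?thesis
      by (intro exI[of _ "\<lambda>f. (f x, f y)"] exI[of _ 0] exI[of _ 1]) auto
  next
    case inj
    then show ?thesis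
      by (intro exI[of _ "\<lambda>f. (f x, f y)"] exI[of _ "\<omega> x"] exI[of _ "\<omega> y"])
        (auto simp: weighted_comp_def intro: functional_pair_eval)
  next
    case det
    obtain v where v: "v \<noteq> 0" "jacobian \<psi> (at x) *v v = 0" using det_zero_imp_kernel det(2) by blast
    have "D (C f) x v = D \<omega> x v * f (\<psi> x)" if "f \<in> Cp_carrier p \<Omega>" for f
      using D_C[OF that det(1), of v] v(2) by (simp add: D_def)
    then show ?thesis
      using functional_pair_D[OF det(1) v(1)] det
      by (intro exI[of _ "\<lambda>f. (f x, D f x v)"] exI[of _ "\<omega> x"] exI[of _ "D \<omega> x v"])
        (auto simp: weighted_comp_def)
  qed
qed

lemma supercyclic_along_imp_nondegenerate:
  assumes "supercyclic_along S"
  shows "nondegenerate"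
proof (rule ccontr)
  assume "\<not> nondegenerate"
  then obtain L a b where L: "functional_pair L" "(a, b) \<noteq> (0, 0)"
    "\<And>f. f \<in> Cp_carrier p \<Omega> \<Longrightarrow> fst (L (C f)) * b = snd (L (C f)) * a"
    using degenerate_line by blast
  obtain g where g: "g \<in> Cp_carrier p \<Omega>"
    "X closure_of {fun_scale \<Omega> c ((C ^^ n) g) | c n. n \<in> S} = topspace X"
    using assms unfolding supercyclic_along_def by auto
  define P where "P = insert (a, b) ({L g} - {(0, 0)})"
  have "\<exists>(a, b)\<in>P. fst (L ((C ^^ n) g)) * b = snd (L ((C ^^ n) g)) * a" for n
  proof (cases n)
    case 0
    show ?thesis
    proof (cases "L g = (0, 0)")
      case True
      then show ?thesis using 0 by (intro bexI[of _ "(a, b)"]) (auto simp: P_def)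
    next
      case False
      then show ?thesis using 0 by (intro bexI[of _ "L g"]) (auto simp: P_def split: prod.splits)
    qed
  next
    case (Suc m)
    then show ?thesis
      using L(3)[OF C_iter_carrier[OF g(1), of m]] by (intro bexI[of _ "(a, b)"]) (auto simp: P_def)
  qed
  then show False
    using orbit_not_in_lines[OF L(1) g, of P] L(2) by (auto simp: P_def)
qed

lemma transitive_imp_nondegenerate:
  assumes "transitive X C"
  shows "nondegenerate"
proof (rule ccontr)
  assume "\<not> nondegenerate"
  then obtain L a b where L: "functional_pair L" "(a, b) \<noteq> (0, 0)"
    "\<And>f. f \<in> Cp_carrier p \<Omega> \<Longrightarrow> fst (L (C f)) * b = snd (L (C f)) * a"
    using degenerate_line by blast
  define U' where "U' = {z :: 'k \<times> 'k. norm z < 1}"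
  define V' where "V' = {z :: 'k \<times> 'k. 1 < norm z} \<inter> {z. fst z * b \<noteq> snd z * a}"
  define U where "U = {f \<in> topspace X. L f \<in> U'}"
  define V where "V = {f \<in> topspace X. L f \<in> V'}"
  have "open U'" "open V'"
    unfolding U'_def V'_def by (intro open_Int open_Collect_less open_Collect_neq continuous_intros)+
  moreover have "continuous_map X euclidean L" using L(1) by (simp add: functional_pair_def)
  ultimately have op: "openin X U" "openin X V"
    unfolding U_def V_def by (simp_all add: openin_continuous_map_preimage del: topspace_Cp_topology)
  have surj: "\<exists>f\<in>topspace X. L f = z" for z using L(1) unfolding functional_pair_def topspace_Cp_topology by blast
  have "(0, 0) \<in> U'" by (simp add: U'_def)
  moreover obtain f where "f \<in> topspace X" "L f = (0, 0)" using surj[of "(0, 0)"] ..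
  ultimately have "f \<in> U" by (simp add: U_def)
  then have "U \<noteq> {}" by blast
  have "\<exists>z. z \<in> V'"
  proof (cases "b = 0")
    case True
    then show ?thesis using L(2) by (intro exI[of _ "(0, 2)"]) (auto simp: V'_def norm_Pair)
  next
    case False
    then show ?thesis by (intro exI[of _ "(2, 0)"]) (auto simp: V'_def norm_Pair)
  qed
  then obtain y where y: "y \<in> V'" ..
  obtain f where "f \<in> topspace X" "L f = y" using surj[of y] ..
  then have "f \<in> V" using y by (simp add: V_def)
  then have "V \<noteq> {}" by blast
  then obtain n where "(C ^^ n) ` U \<inter> V \<noteq> {}"
    using assms op \<open>U \<noteq> {}\<close> unfolding transitive_def by blast
  then obtain f where f: "f \<in> U" "(C ^^ n) f \<in> V" by blast
  show False
  proof (cases n)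
    case 0
    then show False using f by (auto simp: U_def V_def U'_def V'_def)
  next
    case (Suc m)
    have "(C ^^ m) f \<in> Cp_carrier p \<Omega>" using f(1) by (intro C_iter_carrier) (simp add: U_def)
    from L(3)[OF this] show False using f(2) Suc by (simp add: V_def V'_def)
  qed
qed

lemma no_fixed_point:
  assumes sc: "supercyclic_along S" and x: "x \<in> \<Omega>"
  shows "\<psi> x \<noteq> x"
proof
  assume fp: "\<psi> x = x"
  have nd: nondegenerate using sc by (rule supercyclic_along_imp_nondegenerate)
  obtain g where g: "g \<in> Cp_carrier p \<Omega>"
    "X closure_of {fun_scale \<Omega> c ((C ^^ n) g) | c n. n \<in> S} = topspace X"
    using sc unfolding supercyclic_along_def by auto
  define A where "A = {fun_scale \<Omega> c ((C ^^ n) g) | c n. n \<in> S}"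
  define L where "L f = (f x, (\<chi> i. partials [i] f x))" for f :: "real^'d \<Rightarrow> 'k"
  define u where "u n = (C ^^ n) g" for n
  have uC: "u n \<in> Cp_carrier p \<Omega>" for n unfolding u_def using g(1) by (rule C_iter_carrier)
  have "continuous_on UNIV (axis i :: 'k \<Rightarrow> 'k^'d)" for i
    by (rule linear_continuous_on[OF bounded_linear_axis])
  then have "continuous_map X euclidean (\<lambda>f :: real^'d \<Rightarrow> 'k. \<Sum>i\<in>UNIV. axis i (partials [i] f x))"
    by (intro continuous_map_sum continuous_map_compose_euclidean[OF continuous_map_partials1[OF x]]) auto
  moreover have "(\<Sum>i\<in>UNIV. axis i (partials [i] f x)) = (\<chi> i. partials [i] f x)" for f :: "real^'d \<Rightarrow> 'k"
    using sum_axis[of "\<chi> i. partials [i] f x"] by simp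
  ultimately have "continuous_map X euclidean L"
    unfolding L_def using x by (intro continuous_map_Pair_euclidean continuous_map_eval) simp_all
  then have "L ` (X closure_of A) \<subseteq> euclidean closure_of (L ` A)"
    by (rule continuous_map_image_closure_subset)
  then have dense: "z \<in> closure (L ` A)" for z
  proof -
    have "L (aff \<Omega> (fst z) (snd z) x) = z"
      unfolding L_def aff_partials[OF open_\<Omega> x] using x by (simp add: aff_def)
    moreover have "aff \<Omega> (fst z) (snd z) x \<in> X closure_of A"
      using g(2) aff_carrier[OF open_\<Omega>] by (simp add: A_def)
    ultimately show ?thesis
      using \<open>L ` (X closure_of A) \<subseteq> euclidean closure_of (L ` A)\<close> unfolding euclidean_closure_of by (metis image_subset_iff)
  qed
  have LA: "\<exists>c n. z = (c * u n x, \<chi> i. c * partials [i] (u n) x)" if z: "z \<in> L ` A" for z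
  proof -
    obtain c n where "z = L (fun_scale \<Omega> c (u n))" using z unfolding A_def u_def by blast
    then have "z = (c * u n x, \<chi> i. c * partials [i] (u n) x)"
      using D_scale[OF uC x, of c n "axis i 1" for i] x by (simp add: L_def fun_scale_apply D_axis)
    then show ?thesis by blast
  qed
  have iter: "(\<psi> ^^ n) x = x" for n by (induction n) (auto simp: fp)
  have gx: "g x \<noteq> 0"
  proof
    assume "g x = 0"
    then have "u n x = 0" for n by (simp add: u_def C_iter x iter)
    then have "L ` A \<subseteq> {z. fst z = 0}" using LA by fastforce
    then have "closure (L ` A) \<subseteq> {z. fst z = 0}"
      by (rule closure_minimal) (intro closed_Collect_eq continuous_intros)
    then show False using dense[of "(1, 0)"] by auto
  qed
  have ux: "u n x \<noteq> 0" for n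
    using gx W_nonzero[OF nd x] by (simp add: u_def C_iter x iter)
  obtain \<beta> :: 'k where \<beta>: "\<beta> \<in> Basis" using nonempty_Basis by blast
  define R where "R z = (\<chi> i. (snd z $ i / fst z) \<bullet> \<beta>)" for z :: "'k \<times> ('k^'d)"
  define z where "z n = (\<chi> i. (partials [i] (u n) x / u n x) \<bullet> \<beta>)" for n
  have "closure (range z) = UNIV"
  proof -
    have "y \<in> closure (range z)" for y
    proof -
      define q :: "'k \<times> ('k^'d)" where "q = (1, \<chi> i. y $ i *\<^sub>R \<beta>)"
      have Rq: "R q = y" using \<beta> by (simp add: R_def q_def vec_eq_iff)
      have "isCont R q"
        unfolding R_def isCont_def
      proof (rule vec_tendstoI)
        fix i
        show "((\<lambda>z. (\<chi> i. (snd z $ i / fst z) \<bullet> \<beta>) $ i) \<longlongrightarrow> (\<chi> i. (snd q $ i / fst q) \<bullet> \<beta>) $ i) (at q)"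
          unfolding vec_lambda_beta by (intro tendsto_intros) (simp add: q_def)
      qed
      have op: "open {z :: 'k \<times> ('k^'d). fst z \<noteq> 0}" by (intro open_Collect_neq continuous_intros)
      have q: "q \<in> closure (L ` A \<inter> {z. fst z \<noteq> 0})"
        using open_Int_closure_subset[OF op, of "L ` A"] dense[of q] by (auto simp: q_def Int_commute)
      then obtain s where s: "\<And>k. s k \<in> L ` A \<inter> {z. fst z \<noteq> 0}" "s \<longlonglongrightarrow> q"
        unfolding closure_sequential by blast
      have lim: "(\<lambda>k. R (s k)) \<longlonglongrightarrow> y"
        using isCont_tendsto_compose[OF \<open>isCont R q\<close> s(2)] Rq by simp
      have "R (s k) \<in> range z" for k
      proof -
        obtain c n where cn: "s k = (c * u n x, \<chi> i. c * partials [i] (u n) x)" using LA s(1) by blast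
        then have "c \<noteq> 0" using s(1)[of k] by auto
        then have "R (s k) = z n" by (simp add: R_def z_def cn)
        then show ?thesis by simp
      qed
      then show ?thesis
        unfolding closure_sequential using lim by (intro exI[of _ "\<lambda>k. R (s k)"] conjI allI)
    qed
    then show ?thesis by blast
  qed
  moreover have "z (Suc n) = transpose (jacobian \<psi> (at x)) *v z n + (\<chi> i. (partials [i] \<omega> x / \<omega> x) \<bullet> \<beta>)" for n
  proof -
    have "z (Suc n) $ i = (\<Sum>j\<in>UNIV. jacobian \<psi> (at x) $ j $ i * z n $ j) + (partials [i] \<omega> x / \<omega> x) \<bullet> \<beta>" for i
    proof -
      have \<omega>x: "\<omega> x \<noteq> 0" using nd x by (simp add: nondegenerate_def)
      have "partials [i] (u (Suc n)) x = \<omega> x * D (u n) x (jacobian \<psi> (at x) *v axis i 1) + partials [i] \<omega> x * u n x"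
        using D_C[OF uC[of n] x, of "axis i 1"] by (simp add: u_def D_axis fp)
      moreover have "u (Suc n) x = \<omega> x * u n x"
        using x by (simp add: u_def weighted_comp_def fp)
      ultimately have "partials [i] (u (Suc n)) x / u (Suc n) x =
          D (u n) x (jacobian \<psi> (at x) *v axis i 1) / u n x + partials [i] \<omega> x / \<omega> x"
        using \<omega>x ux[of n] by (simp add: add_divide_distrib)
      moreover have "D (u n) x (jacobian \<psi> (at x) *v axis i 1) / u n x =
          (\<Sum>j\<in>UNIV. jacobian \<psi> (at x) $ j $ i *\<^sub>R (partials [j] (u n) x / u n x))"
        by (simp add: D_def divide_inverse sum_distrib_right matrix_vector_mult_basis column_def)
      ultimately show ?thesis
        by (simp add: z_def inner_add_left inner_sum_left)
    qed
    then show ?thesis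
      by (simp add: vec_eq_iff matrix_vector_mult_def transpose_def)
  qed
  ultimately show False using no_dense_affine_orbit by blast
qed

lemma no_periodic_point:
  assumes sc: "supercyclic_along S" and x: "x \<in> \<Omega>" and q: "q > 0"
  shows "(\<psi> ^^ q) x \<noteq> x"
proof
  assume per: "(\<psi> ^^ q) x = x"
  have nd: nondegenerate using sc by (rule supercyclic_along_imp_nondegenerate)
  obtain g where g: "g \<in> Cp_carrier p \<Omega>"
    "X closure_of {fun_scale \<Omega> c ((C ^^ n) g) | c n. n \<in> S} = topspace X"
    using sc unfolding supercyclic_along_def by auto
  have x': "\<psi> x \<in> \<Omega>" using psi_in[OF x] .
  define r where "r y = (\<omega> x * g y, \<omega> y * g (\<psi> y))" for y
  define P where "P = insert (1, 0) (r ` (\<lambda>j. (\<psi> ^^ j) x) ` {..<q} - {(0, 0)})"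
  have "\<exists>(a, b)\<in>P. (C ^^ n) g x * b = (C ^^ n) g (\<psi> x) * a" for n
  proof -
    define y where "y = (\<psi> ^^ n) x"
    have "W n x * \<omega> y = \<omega> x * W n (\<psi> x)"
      using W_add[of 1 n x] W_add[of n 1 x] by (simp add: y_def)
    moreover have "(C ^^ n) g x = W n x * g y" "(C ^^ n) g (\<psi> x) = W n (\<psi> x) * g (\<psi> y)"
      using x x' by (simp_all add: C_iter y_def funpow_swap1)
    ultimately have eq: "(C ^^ n) g x * snd (r y) = (C ^^ n) g (\<psi> x) * fst (r y)"
      unfolding r_def by (simp add: algebra_simps)
    show ?thesis
    proof (cases "r y = (0, 0)")
      case True
      then have "g (\<psi> y) = 0"
        using nd iter_in[OF x] by (auto simp: r_def nondegenerate_def y_def)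
      then have "(C ^^ n) g (\<psi> x) = 0" using x' by (simp add: C_iter y_def funpow_swap1)
      then show ?thesis by (intro bexI[of _ "(1, 0)"]) (auto simp: P_def)
    next
      case False
      have "y = (\<psi> ^^ (n mod q)) x"
        unfolding y_def using funpow_mod_eq[OF per] by simp
      then have "r y \<in> P" using False q by (auto simp: P_def)
      then show ?thesis using eq by (intro bexI[of _ "r y"]) (auto split: prod.splits)
    qed
  qed
  then show False
    using orbit_not_in_lines[OF functional_pair_eval[OF x x' no_fixed_point[OF sc x, symmetric]] g, of P]
    by (auto simp: P_def)
qed

end

section \<open>Necessity of the run-away condition\<close>

lemma compact_bound:
  fixes f :: "'a::topological_space \<Rightarrow> 'b::real_normed_vector"
  assumes "continuous_on \<Omega>' f" "compact K" "K \<subseteq> \<Omega>'"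
  shows "\<exists>B\<ge>0. \<forall>x\<in>K. norm (f x) \<le> B"
proof -
  have "bounded (f ` K)"
    using assms by (intro compact_imp_bounded compact_continuous_image) (auto intro: continuous_on_subset)
  then obtain B where "\<forall>x\<in>K. norm (f x) \<le> B" unfolding bounded_iff by auto
  then show ?thesis by (intro exI[of _ "max B 0"]) auto
qed

context weighted_composition
begin

lemma const_carrier: "restrict (\<lambda>x. a) \<Omega> \<in> Cp_carrier p \<Omega>"
  by (rule restrict_Cp_carrier[OF open_\<Omega> Cp_on_const[OF open_\<Omega>]])

lemma Cp_nbhd_0D: "g \<in> Cp_nbhd p \<Omega> f K 0 e \<Longrightarrow> x \<in> K \<Longrightarrow> norm (g x - f x) < e"
  unfolding Cp_nbhd_def by force

lemma iter_compact: "compact K \<Longrightarrow> K \<subseteq> \<Omega> \<Longrightarrow> compact ((\<psi> ^^ n) ` K)"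
  by (rule compact_continuous_image[OF continuous_on_subset[OF iter_continuous]])

lemma supercyclic_along_approx:
  assumes sc: "supercyclic_along S" and FH: "F \<in> Cp_carrier p \<Omega>" "H \<in> Cp_carrier p \<Omega>"
    and K: "compact K" "K \<subseteq> \<Omega>" and \<delta>: "0 < \<delta>" and x1: "x1 \<in> K" "\<delta> \<le> norm (F x1)"
  shows "\<exists>f n c. n \<in> S \<and> (\<forall>x\<in>K. norm (f x - F x) < \<delta>) \<and> (\<forall>x\<in>K. norm (c * (C ^^ n) f x - H x) < \<delta>)"
proof -
  have nd: nondegenerate using sc by (rule supercyclic_along_imp_nondegenerate)
  obtain g where g: "g \<in> Cp_carrier p \<Omega>"
    "X closure_of {fun_scale \<Omega> c ((C ^^ n) g) | c n. n \<in> S} = topspace X"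
    using sc unfolding supercyclic_along_def by auto
  have dense: "\<exists>c n. n \<in> S \<and> (\<forall>x\<in>K. norm (c * (C ^^ n) g x - f x) < e)"
    if "f \<in> Cp_carrier p \<Omega>" "compact K" "K \<subseteq> \<Omega>" "0 < e" for f K e
  proof -
    have "enat 0 \<le> p" by (simp flip: zero_enat_def)
    then have "\<exists>a\<in>{fun_scale \<Omega> c ((C ^^ n) g) | c n. n \<in> S}. a \<in> Cp_nbhd p \<Omega> f K 0 e"
      using g(2)[unfolded Cp_dense_iff[OF open_\<Omega>]] that by simp
    then obtain c n where "n \<in> S" and *: "fun_scale \<Omega> c ((C ^^ n) g) \<in> Cp_nbhd p \<Omega> f K 0 e" by auto
    have "norm (c * (C ^^ n) g x - f x) < e" if "x \<in> K" for x
      using Cp_nbhd_0D[OF * that] \<open>K \<subseteq> \<Omega>\<close> that by (auto simp: fun_scale_def)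
    then show ?thesis using \<open>n \<in> S\<close> by blast
  qed
  obtain c0 j where j: "j \<in> S" "\<forall>x\<in>K. norm (c0 * (C ^^ j) g x - F x) < \<delta>"
    using dense[OF FH(1) K \<delta>] by blast
  have "c0 \<noteq> 0" using j(2) x1 by force
  obtain B where B: "B \<ge> 0" "\<forall>x\<in>K. norm (W j x) \<le> B"
    using compact_bound[OF Cp_on_continuous_on[OF W_Cp] K] by blast
  from glue_iter[OF nd Cp_carrierD[OF FH(2)] K open_UNIV subset_UNIV, of j] obtain u V where
    u: "Cp_on p UNIV u" "K \<subseteq> V" "\<forall>x\<in>V. W j x * u ((\<psi> ^^ j) x) = H x" by (elim exE conjE)
  have pos: "\<delta> / (B + 1) > 0" using B \<delta> by simp
  have sub: "(\<psi> ^^ j) ` K \<subseteq> \<Omega>" using K(2) iter_in by blast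
  obtain c1 n where n: "n \<in> S" "\<forall>y\<in>(\<psi> ^^ j) ` K. norm (c1 * (C ^^ n) g y - restrict u \<Omega> y) < \<delta> / (B + 1)"
    using dense[OF restrict_Cp_carrier[OF open_\<Omega> Cp_on_UNIV[OF u(1)]] iter_compact[OF K] sub pos] by blast
  define f where "f x = c0 * (C ^^ j) g x" for x
  have "norm (c1 / c0 * (C ^^ n) f x - H x) < \<delta>" if x: "x \<in> K" for x
  proof -
    have x\<Omega>: "x \<in> \<Omega>" using x K by auto
    let ?y = "(\<psi> ^^ j) x"
    have y\<Omega>: "?y \<in> \<Omega>" "(\<psi> ^^ n) x \<in> \<Omega>" using iter_in[OF x\<Omega>] by auto
    have swap: "(\<psi> ^^ j) ((\<psi> ^^ n) x) = (\<psi> ^^ n) ?y"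
      by (metis add.commute comp_apply funpow_add)
    have "W n x * W j ((\<psi> ^^ n) x) = W j x * W n ?y"
      using W_add[of n j x] W_add[of j n x] by (simp add: add.commute)
    then have "W n x * W j ((\<psi> ^^ n) x) * g ((\<psi> ^^ n) ?y) = W j x * W n ?y * g ((\<psi> ^^ n) ?y)" by simp
    then have "(C ^^ n) f x = c0 * (W j x * (C ^^ n) g ?y)"
      using x\<Omega> y\<Omega> by (simp add: C_iter f_def swap mult_ac)
    moreover have "H x = W j x * u ?y" using u x by auto
    ultimately have "c1 / c0 * (C ^^ n) f x - H x = W j x * (c1 * (C ^^ n) g ?y - u ?y)"
      using \<open>c0 \<noteq> 0\<close> by (simp add: algebra_simps)
    then have "norm (c1 / c0 * (C ^^ n) f x - H x) = norm (W j x) * norm (c1 * (C ^^ n) g ?y - u ?y)"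
      by (simp add: norm_mult)
    also have "\<dots> \<le> B * (\<delta> / (B + 1))"
      using B x n(2) y\<Omega>(1) by (intro mult_mono) (auto intro: less_imp_le)
    also have "\<dots> < \<delta>" using B(1) \<delta> by (simp add: field_simps)
    finally show ?thesis .
  qed
  moreover have "\<forall>x\<in>K. norm (f x - F x) < \<delta>" using j(2) by (simp add: f_def)
  ultimately show ?thesis using n(1) by (intro exI[of _ f] exI[of _ n] exI[of _ "c1 / c0"]) simp
qed

definition defect :: "('j::finite \<Rightarrow> nat) \<Rightarrow> (real^'d \<Rightarrow> 'k) \<Rightarrow> (real^'d \<Rightarrow> 'k) \<Rightarrow> real^'d \<Rightarrow> real^'d \<Rightarrow> real" where
  "defect \<tau> u f x y = (\<Sum>j\<in>UNIV. norm (u ((\<psi> ^^ \<tau> j) x) * W (\<tau> j) x * f y - u x * W (\<tau> j) y * f ((\<psi> ^^ \<tau> j) y)))"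

text \<open>Since \<open>C\<close> acts on the ratios of \<open>f, C f, C\<^sup>2 f, \<dots>\<close> by composition with \<open>\<psi>\<close>, the ratios of
  \<open>u = c C\<^sup>n f\<close> at \<open>x\<close> and those of \<open>f\<close> at \<open>\<psi>\<^sup>n x\<close> coincide.\<close>

lemma defect_orbit:
  assumes "x \<in> \<Omega>"
  shows "defect \<tau> (\<lambda>z. c * (C ^^ n) f z) f x ((\<psi> ^^ n) x) = 0"
proof -
  have eq: "c * (C ^^ n) f ((\<psi> ^^ t) x) * W t x * f ((\<psi> ^^ n) x) =
      c * (C ^^ n) f x * W t ((\<psi> ^^ n) x) * f ((\<psi> ^^ t) ((\<psi> ^^ n) x))" for t
  proof -
    have "W t x * W n ((\<psi> ^^ t) x) = W n x * W t ((\<psi> ^^ n) x)"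
      using W_add[of t n x] W_add[of n t x] by (simp add: add.commute)
    moreover have "(\<psi> ^^ n) ((\<psi> ^^ t) x) = (\<psi> ^^ t) ((\<psi> ^^ n) x)"
      by (metis add.commute comp_apply funpow_add)
    ultimately show ?thesis
      using assms iter_in by (simp add: C_iter mult_ac)
  qed
  show ?thesis
    unfolding defect_def
  proof (rule sum.neutral, rule ballI)
    fix j
    show "norm (c * (C ^^ n) f ((\<psi> ^^ \<tau> j) x) * W (\<tau> j) x * f ((\<psi> ^^ n) x) -
        c * (C ^^ n) f x * W (\<tau> j) ((\<psi> ^^ n) x) * f ((\<psi> ^^ \<tau> j) ((\<psi> ^^ n) x))) = 0"
      unfolding eq by simp
  qed
qed

lemma defect_continuous:
  assumes "continuous_on \<Omega> h"
  shows "continuous_on (\<Omega> \<times> \<Omega>) (\<lambda>z. defect \<tau> h (\<lambda>_. 1) (fst z) (snd z))"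
proof -
  have 1: "continuous_on (\<Omega> \<times> \<Omega>) (\<lambda>z. g (fst z))" "continuous_on (\<Omega> \<times> \<Omega>) (\<lambda>z. g (snd z))"
    if "continuous_on \<Omega> g" for g :: "real^'d \<Rightarrow> 'k"
    by (rule continuous_on_compose2[OF that]; auto intro: continuous_intros)+
  have "continuous_on \<Omega> (\<lambda>x. h ((\<psi> ^^ n) x))" for n
    by (rule continuous_on_compose2[OF assms iter_continuous]) (use iter_in in auto)
  then show ?thesis
    unfolding defect_def using assms Cp_on_continuous_on[OF W_Cp]
    by (intro continuous_intros 1)
qed

lemma defect_robust:
  fixes \<tau> :: "'j::finite \<Rightarrow> nat"
  assumes h: "continuous_on \<Omega> h" and K: "compact K" "K \<subseteq> \<Omega>" and A: "compact A" "A \<subseteq> K"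
    and pos: "\<And>x y. x \<in> A \<Longrightarrow> y \<in> K \<Longrightarrow> 0 < defect \<tau> h (\<lambda>_. 1) x y"
  shows "\<exists>\<delta>>0. \<delta> \<le> 1 \<and> (\<forall>u f. (\<forall>z\<in>K \<union> (\<Union>j. (\<psi> ^^ \<tau> j) ` K). norm (u z - h z) < \<delta> \<and> norm (f z - 1) < \<delta>) \<longrightarrow>
    (\<forall>x\<in>A. \<forall>y\<in>K. 0 < defect \<tau> u f x y))"
proof (cases "A \<times> K = {}")
  case True
  then show ?thesis by (intro exI[of _ 1]) auto
next
  case False
  define Z where "Z = K \<union> (\<Union>j. (\<psi> ^^ \<tau> j) ` K)"
  have Z: "compact Z" "Z \<subseteq> \<Omega>"
    unfolding Z_def using K iter_compact[OF K] iter_in by (auto intro!: compact_Un compact_UN)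
  have "\<exists>z\<in>A \<times> K. \<forall>z'\<in>A \<times> K. defect \<tau> h (\<lambda>_. 1) (fst z) (snd z) \<le> defect \<tau> h (\<lambda>_. 1) (fst z') (snd z')"
    using False A K
    by (intro continuous_attains_inf compact_Times continuous_on_subset[OF defect_continuous[OF h]]) auto
  then obtain z where z: "z \<in> A \<times> K"
    "\<forall>z'\<in>A \<times> K. defect \<tau> h (\<lambda>_. 1) (fst z) (snd z) \<le> defect \<tau> h (\<lambda>_. 1) (fst z') (snd z')" by (elim bexE)
  define m where "m = defect \<tau> h (\<lambda>_. 1) (fst z) (snd z)"
  have m: "m > 0" "\<And>x y. x \<in> A \<Longrightarrow> y \<in> K \<Longrightarrow> m \<le> defect \<tau> h (\<lambda>_. 1) x y"
    using pos[of "fst z" "snd z"] z(1) bspec[OF z(2), of "(_, _)"] by (auto simp: m_def)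
  obtain H where H: "H \<ge> 0" "\<forall>z\<in>Z. norm (h z) \<le> H" using compact_bound[OF h Z] by blast
  have "\<exists>B\<ge>0. \<forall>x\<in>K. norm (W (\<tau> j) x) \<le> B" for j
    by (rule compact_bound[OF Cp_on_continuous_on[OF W_Cp] K])
  then obtain B0 where B0: "\<And>j. B0 j \<ge> 0" "\<And>j x. x \<in> K \<Longrightarrow> norm (W (\<tau> j) x) \<le> B0 j" by metis
  define T where "T = (\<Sum>j\<in>(UNIV :: 'j set). 2 * B0 j * (H + 2))"
  have T: "T \<ge> 0" unfolding T_def using B0 H by (intro sum_nonneg) auto
  define \<delta> where "\<delta> = min 1 (m / (2 * (T + 1)))"
  have \<delta>: "\<delta> > 0" "\<delta> \<le> 1" using m T by (auto simp: \<delta>_def)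
  have "\<delta> * T < m"
  proof -
    have "\<delta> * T \<le> m / (2 * (T + 1)) * T" using T by (intro mult_right_mono) (auto simp: \<delta>_def)
    also have "\<dots> < m"
    proof -
      have "0 \<le> T * m" using m(1) T by simp
      then have "0 < T * m + m * 2" using m(1) by linarith
      then show ?thesis using T by (simp add: field_simps)
    qed
    finally show ?thesis .
  qed
  have "0 < defect \<tau> u f x y"
    if uf: "\<forall>z\<in>Z. norm (u z - h z) < \<delta> \<and> norm (f z - 1) < \<delta>" and xy: "x \<in> A" "y \<in> K" for u f x y
  proof -
    have prod: "norm (u z * f z' - h z) \<le> \<delta> * (H + 2)" if z: "z \<in> Z" "z' \<in> Z" for z z'
    proof -
      have "norm (u z) \<le> norm (u z - h z) + norm (h z)" by (metis diff_add_cancel norm_triangle_ineq)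
      then have "norm (u z) \<le> H + 1" using uf z H(2) \<delta>(2) by force
      then have "norm (u z) * norm (f z' - 1) \<le> (H + 1) * \<delta>"
        using uf z H(1) by (intro mult_mono) (auto intro: less_imp_le)
      moreover have "u z * f z' - h z = u z * (f z' - 1) + (u z - h z)" by (simp add: algebra_simps)
      then have "norm (u z * f z' - h z) \<le> norm (u z) * norm (f z' - 1) + norm (u z - h z)"
        by (metis norm_mult norm_triangle_ineq)
      ultimately show ?thesis using uf z by (force simp: algebra_simps)
    qed
    have xyZ: "x \<in> Z" "y \<in> Z" "(\<psi> ^^ \<tau> j) x \<in> Z" "(\<psi> ^^ \<tau> j) y \<in> Z" "x \<in> K" for j
      using xy A(2) by (auto simp: Z_def)
    have summand: "norm (h ((\<psi> ^^ \<tau> j) x) * W (\<tau> j) x * 1 - h x * W (\<tau> j) y * 1) \<le>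
        norm (u ((\<psi> ^^ \<tau> j) x) * W (\<tau> j) x * f y - u x * W (\<tau> j) y * f ((\<psi> ^^ \<tau> j) y)) + \<delta> * (2 * B0 j * (H + 2))" for j
    proof -
      let ?x = "(\<psi> ^^ \<tau> j) x" and ?y = "(\<psi> ^^ \<tau> j) y"
      have "norm (W (\<tau> j) x * (u ?x * f y - h ?x)) \<le> B0 j * (\<delta> * (H + 2))"
        unfolding norm_mult using B0(1)[of j] B0(2)[OF xyZ(5)] prod[OF xyZ(3,2)] by (intro mult_mono) auto
      moreover have "norm (W (\<tau> j) y * (u x * f ?y - h x)) \<le> B0 j * (\<delta> * (H + 2))"
        unfolding norm_mult using B0(1)[of j] B0(2)[OF xy(2)] prod[OF xyZ(1,4)] by (intro mult_mono) auto
      moreover have "h ?x * W (\<tau> j) x * 1 - h x * W (\<tau> j) y * 1 =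
          (u ?x * W (\<tau> j) x * f y - u x * W (\<tau> j) y * f ?y) - W (\<tau> j) x * (u ?x * f y - h ?x) + W (\<tau> j) y * (u x * f ?y - h x)"
        by (simp add: algebra_simps)
      ultimately show ?thesis
        using norm_triangle_ineq[of "(u ?x * W (\<tau> j) x * f y - u x * W (\<tau> j) y * f ?y) - W (\<tau> j) x * (u ?x * f y - h ?x)" "W (\<tau> j) y * (u x * f ?y - h x)"]
          norm_triangle_ineq4[of "u ?x * W (\<tau> j) x * f y - u x * W (\<tau> j) y * f ?y" "W (\<tau> j) x * (u ?x * f y - h ?x)"]
        by (simp add: algebra_simps)
    qed
    have "m \<le> defect \<tau> h (\<lambda>_. 1) x y" using m(2) xy by blast
    also have "\<dots> \<le> defect \<tau> u f x y + \<delta> * T"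
      unfolding defect_def T_def sum_distrib_left sum.distrib[symmetric] by (rule sum_mono) (rule summand)
    finally show ?thesis using \<open>\<delta> * T < m\<close> by simp
  qed
  then show ?thesis using \<delta> unfolding Z_def by (intro exI[of _ \<delta>]) simp
qed

lemma separating_bumps:
  fixes \<tau> :: "'j::finite \<Rightarrow> nat"
  assumes x0: "x0 \<in> \<Omega>" and inj: "inj (\<lambda>j. (\<psi> ^^ \<tau> j) x0)"
  shows "\<exists>(\<phi> :: 'j \<Rightarrow> real^'d \<Rightarrow> real) r. 0 < r \<and> (\<forall>n i. Ck n UNIV (\<phi> i)) \<and> (\<forall>i x. \<phi> i x \<in> {0..1}) \<and>
    (\<forall>x\<in>cball x0 r. \<forall>i j. \<phi> i ((\<psi> ^^ \<tau> j) x) = (if i = j then 1 else 0))"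
proof -
  define y where "y j = (\<psi> ^^ \<tau> j) x0" for j
  have y: "y i = y j \<Longrightarrow> i = j" for i j using inj by (auto simp: y_def inj_on_def)
  have "\<exists>(\<phi> :: real^'d \<Rightarrow> real) V M. (\<forall>n. Ck n UNIV \<phi>) \<and> (\<forall>x. \<phi> x \<in> {0..1}) \<and> open V \<and> y j \<in> V \<and> (\<forall>x\<in>V. \<phi> x = 1) \<and>
      compact M \<and> (\<forall>i. i \<noteq> j \<longrightarrow> y i \<notin> M) \<and> (\<forall>x. x \<notin> M \<longrightarrow> \<phi> x = 0)" for j
  proof -
    have fin: "finite (y ` (UNIV - {j}))" by simp
    have "open (- (y ` (UNIV - {j})))" using finite_imp_closed[OF fin] by (simp add: open_Compl)
    moreover have "{y j} \<subseteq> - (y ` (UNIV - {j}))" using y by blast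
    ultimately show ?thesis
    proof (rule smooth_bump[OF compact_sing])
      fix \<phi> :: "real^'d \<Rightarrow> real" and M V
      assume "\<And>n. Ck n UNIV \<phi>" "\<And>x. \<phi> x \<in> {0..1}" "compact M" "M \<subseteq> - (y ` (UNIV - {j}))"
        "\<And>x. x \<notin> M \<Longrightarrow> \<phi> x = 0" "open V" "{y j} \<subseteq> V" "V \<subseteq> M" "\<And>x. x \<in> V \<Longrightarrow> \<phi> x = 1"
      then show ?thesis by (intro exI[of _ \<phi>] exI[of _ V] exI[of _ M]) auto
    qed
  qed
  then have "\<forall>j. \<exists>(\<phi> :: real^'d \<Rightarrow> real) V M. (\<forall>n. Ck n UNIV \<phi>) \<and> (\<forall>x. \<phi> x \<in> {0..1}) \<and> open V \<and> y j \<in> V \<and> (\<forall>x\<in>V. \<phi> x = 1) \<and>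
      compact M \<and> (\<forall>i. i \<noteq> j \<longrightarrow> y i \<notin> M) \<and> (\<forall>x. x \<notin> M \<longrightarrow> \<phi> x = 0)" by (rule allI)
  from this[THEN choice] obtain \<phi> :: "'j \<Rightarrow> real^'d \<Rightarrow> real" where
    "\<forall>j. \<exists>V M. (\<forall>n. Ck n UNIV (\<phi> j)) \<and> (\<forall>x. \<phi> j x \<in> {0..1}) \<and> open V \<and> y j \<in> V \<and> (\<forall>x\<in>V. \<phi> j x = 1) \<and>
      compact M \<and> (\<forall>i. i \<noteq> j \<longrightarrow> y i \<notin> M) \<and> (\<forall>x. x \<notin> M \<longrightarrow> \<phi> j x = 0)" by (elim exE)
  from this[THEN choice] obtain V where
    "\<forall>j. \<exists>M. (\<forall>n. Ck n UNIV (\<phi> j)) \<and> (\<forall>x. \<phi> j x \<in> {0..1}) \<and> open (V j) \<and> y j \<in> V j \<and> (\<forall>x\<in>V j. \<phi> j x = 1) \<and>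
      compact M \<and> (\<forall>i. i \<noteq> j \<longrightarrow> y i \<notin> M) \<and> (\<forall>x. x \<notin> M \<longrightarrow> \<phi> j x = 0)" by (elim exE)
  from this[THEN choice] obtain M where
    *: "\<forall>j. (\<forall>n. Ck n UNIV (\<phi> j)) \<and> (\<forall>x. \<phi> j x \<in> {0..1}) \<and> open (V j) \<and> y j \<in> V j \<and> (\<forall>x\<in>V j. \<phi> j x = 1) \<and>
      compact (M j) \<and> (\<forall>i. i \<noteq> j \<longrightarrow> y i \<notin> M j) \<and> (\<forall>x. x \<notin> M j \<longrightarrow> \<phi> j x = 0)" by (elim exE)
  define N where "N i j = (if i = j then V i else - M i)" for i j
  have N: "open (N i j)" "y j \<in> N i j" "\<And>z. z \<in> N i j \<Longrightarrow> \<phi> i z = (if i = j then 1 else 0)" for i j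
    using * by (auto simp: N_def compact_imp_closed open_Compl)
  define G where "G = (\<Inter>i. \<Inter>j. \<Omega> \<inter> (\<psi> ^^ \<tau> j) -` N i j)"
  have "open G"
    unfolding G_def using N(1) open_\<Omega> iter_continuous
    by (intro open_INT finite ballI) (simp add: continuous_on_open_vimage Int_commute)
  moreover have "x0 \<in> G" using N(2) x0 by (auto simp: G_def y_def)
  ultimately obtain r where r: "r > 0" "cball x0 r \<subseteq> G" using open_contains_cball by blast
  have "\<phi> i ((\<psi> ^^ \<tau> j) x) = (if i = j then 1 else 0)" if "x \<in> cball x0 r" for x i j
  proof (rule N(3))
    have "x \<in> G" using that r(2) by (rule subsetD[rotated])
    then show "(\<psi> ^^ \<tau> j) x \<in> N i j" by (simp add: G_def)
  qed
  then show ?thesis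
    using r(1) * by (intro exI[of _ \<phi>] exI[of _ r]) auto
qed

text \<open>The parameters \<open>a\<close> for which the perturbed function is bad lie in the image of a map from a
  space of dimension \<open>2 d + k\<close> to one of dimension \<open>(2 d + 2) k\<close>.\<close>

lemma defect_perturb:
  fixes \<tau> :: "('d + 'd + bool) \<Rightarrow> nat"
  assumes nd: nondegenerate and h: "Cp_on p \<Omega> h" and K: "compact K" "K \<subseteq> \<Omega>" and A: "compact A" "A \<subseteq> K"
    and pos: "\<And>x y. x \<in> A \<Longrightarrow> y \<in> K \<Longrightarrow> 0 < defect \<tau> h (\<lambda>_. 1) x y"
    and \<phi>: "\<And>n i. Ck n UNIV (\<phi> i)" "\<And>i x. \<phi> i x \<in> {0..1::real}"
    and V: "\<And>x i j. x \<in> V \<Longrightarrow> \<phi> i ((\<psi> ^^ \<tau> j) x) = (if i = j then 1 else 0)"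
  shows "\<exists>h'. Cp_on p \<Omega> h' \<and> (\<forall>x\<in>A \<union> (V \<inter> K). \<forall>y\<in>K. 0 < defect \<tau> h' (\<lambda>_. 1) x y)"
proof -
  obtain \<delta> where \<delta>: "\<delta> > 0" "\<forall>u f. (\<forall>z\<in>K \<union> (\<Union>j. (\<psi> ^^ \<tau> j) ` K). norm (u z - h z) < \<delta> \<and> norm (f z - 1) < \<delta>) \<longrightarrow>
    (\<forall>x\<in>A. \<forall>y\<in>K. 0 < defect \<tau> u f x y)"
    using defect_robust[OF Cp_on_continuous_on[OF h] K A pos] by blast
  define G :: "(real^'d) \<times> (real^'d) \<times> 'k \<Rightarrow> 'k^('d + 'd + bool)" where
    "G q = (\<chi> j. snd (snd q) * W (\<tau> j) (fst (snd q)) * inverse (W (\<tau> j) (fst q)) - h ((\<psi> ^^ \<tau> j) (fst q)))" for q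
  have "negligible (G ` (\<Omega> \<times> \<Omega> \<times> UNIV))"
  proof (rule negligible_differentiable_image_lowdim)
    have "DIM('k) \<ge> 1" using DIM_positive[where 'a = 'k] by linarith
    then have "2 * CARD('d) * 1 \<le> 2 * CARD('d) * DIM('k)" by (intro mult_le_mono2)
    then have "2 * CARD('d) + DIM('k) < (2 * CARD('d) + 2) * DIM('k)"
      using \<open>DIM('k) \<ge> 1\<close> unfolding distrib_right by linarith
    then show "DIM((real^'d) \<times> (real^'d) \<times> 'k) < DIM('k^('d + 'd + bool))"
      by (simp add: mult_2)
    have diff: "g differentiable (at x)" if "Cp_on p \<Omega> g" "x \<in> \<Omega>" for g :: "real^'d \<Rightarrow> 'k" and x
      using has_derivative_D[OF that] by (rule differentiableI)
    have comp: "(\<lambda>q. g (s q)) differentiable (at q)"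
      if "Cp_on p \<Omega> g" "s q \<in> \<Omega>" "bounded_linear s" for g :: "real^'d \<Rightarrow> 'k" and s :: "(real^'d) \<times> (real^'d) \<times> 'k \<Rightarrow> real^'d" and q
      using differentiable_chain_at[OF bounded_linear_imp_differentiable[OF that(3)] diff[OF that(1,2)]]
      by (simp add: comp_def)
    have g: "(\<lambda>q. snd (snd q) * W t (fst (snd q)) * inverse (W t (fst q)) - h ((\<psi> ^^ t) (fst q))) differentiable (at q)"
      if q: "q \<in> \<Omega> \<times> \<Omega> \<times> (UNIV :: 'k set)" for q t
    proof (intro differentiable_diff differentiable_mult)
      show "(\<lambda>q. W t (fst (snd q))) differentiable (at q)"
        using q by (intro comp W_Cp bounded_linear_compose[OF bounded_linear_fst bounded_linear_snd, unfolded comp_def]) auto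
      show "(\<lambda>q. inverse (W t (fst q))) differentiable (at q)"
        using q by (intro comp[of "\<lambda>x. inverse (W t x)"] Cp_on_inverse[OF open_\<Omega> W_Cp W_nonzero[OF nd]] bounded_linear_fst) auto
      show "(\<lambda>q. h ((\<psi> ^^ t) (fst q))) differentiable (at q)"
        using q by (intro comp[of "\<lambda>x. h ((\<psi> ^^ t) x)"] Cp_compose_iter h bounded_linear_fst) auto
      show "(\<lambda>q. snd (snd q)) differentiable (at q)"
        by (intro bounded_linear_imp_differentiable bounded_linear_compose[OF bounded_linear_snd bounded_linear_snd, unfolded comp_def])
    qed
    have "G differentiable (at q)" if q: "q \<in> \<Omega> \<times> \<Omega> \<times> (UNIV :: 'k set)" for q
    proof (rule differentiableI[OF has_derivative_vec_components])
      fix j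
      show "((\<lambda>q. G q $ j) has_derivative (\<lambda>v. (\<chi> j. frechet_derivative (\<lambda>q. G q $ j) (at q) v) $ j)) (at q)"
        using g[OF q, of "\<tau> j"] unfolding frechet_derivative_works by (simp add: G_def)
    qed
    then show "G differentiable_on \<Omega> \<times> \<Omega> \<times> UNIV"
      by (simp add: differentiable_on_def differentiable_at_withinI)
  qed
  define \<eta> where "\<eta> = \<delta> / (real (CARD('d + 'd + bool)) + 1)"
  have "\<eta> > 0" using \<delta> by (simp add: \<eta>_def)
  then have "\<not> negligible (ball (0 :: 'k^('d + 'd + bool)) \<eta>)"
    by (intro open_not_negligible) auto
  then obtain a where a: "a \<in> ball 0 \<eta>" "a \<notin> G ` (\<Omega> \<times> \<Omega> \<times> UNIV)"
    using negligible_subset[OF \<open>negligible (G ` (\<Omega> \<times> \<Omega> \<times> UNIV))\<close>] by blast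
  define h' where "h' x = h x + (\<Sum>i\<in>UNIV. \<phi> i x *\<^sub>R a $ i)" for x
  have "Cp_on p \<Omega> (\<phi> i)" for i
    by (simp add: Cp_on_iff_Ck[OF open_\<Omega>] Ck_subset[OF \<phi>(1) subset_UNIV])
  then have Cp: "Cp_on p \<Omega> h'"
    unfolding h'_def[abs_def] by (intro Cp_on_add Cp_on_sum Cp_on_scaleR Cp_on_const open_\<Omega> h)
  have close: "norm (h' z - h z) < \<delta>" for z
  proof -
    have "norm (h' z - h z) \<le> (\<Sum>i\<in>(UNIV :: ('d + 'd + bool) set). \<eta>)"
      unfolding h'_def add_diff_cancel_left'
    proof (rule sum_norm_le)
      fix i
      have "norm (\<phi> i z *\<^sub>R a $ i) \<le> 1 * norm (a $ i)"
        unfolding norm_scaleR using \<phi>(2)[of i z] by (intro mult_right_mono) auto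
      also have "\<dots> \<le> \<eta>" using a(1) Finite_Cartesian_Product.norm_nth_le[of a i] by simp
      finally show "norm (\<phi> i z *\<^sub>R a $ i) \<le> \<eta>" .
    qed
    also have "\<dots> < \<delta>" using \<delta>(1) unfolding \<eta>_def by (simp add: field_simps del: card_UNIV_bool)
    finally show ?thesis .
  qed
  have "0 < defect \<tau> h' (\<lambda>_. 1) x y" if "x \<in> V \<inter> K" "y \<in> K" for x y
  proof (rule ccontr)
    assume "\<not> 0 < defect \<tau> h' (\<lambda>_. 1) x y"
    moreover have "0 \<le> defect \<tau> h' (\<lambda>_. 1) x y" unfolding defect_def by (rule sum_nonneg) simp
    ultimately have "defect \<tau> h' (\<lambda>_. 1) x y = 0" by simp
    then have eq: "h' ((\<psi> ^^ \<tau> j) x) * W (\<tau> j) x = h' x * W (\<tau> j) y" for j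
      unfolding defect_def by (subst (asm) sum_nonneg_eq_0_iff) auto
    have xy: "x \<in> \<Omega>" "y \<in> \<Omega>" using that K by auto
    have "h' ((\<psi> ^^ \<tau> j) x) = h ((\<psi> ^^ \<tau> j) x) + a $ j" for j
      using V[of x] that by (simp add: h'_def if_distrib[of "\<lambda>c. c *\<^sub>R _"] cong: if_cong)
    then have "a $ j = h' x * W (\<tau> j) y * inverse (W (\<tau> j) x) - h ((\<psi> ^^ \<tau> j) x)" for j
      using eq[of j] W_nonzero[OF nd xy(1), of "\<tau> j"] by (simp add: field_simps)
    then have "a = G (x, y, h' x)" by (simp add: G_def vec_eq_iff)
    then show False using a(2) xy by auto
  qed
  moreover have "\<forall>x\<in>A. \<forall>y\<in>K. 0 < defect \<tau> h' (\<lambda>_. 1) x y"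
    using close \<delta> by simp
  ultimately show ?thesis using Cp by (intro exI[of _ h']) auto
qed

lemma ex_positive_defect:
  fixes \<tau> :: "('d + 'd + bool) \<Rightarrow> nat"
  assumes nd: nondegenerate and K: "compact K" "K \<subseteq> \<Omega>"
    and inj: "\<And>x. x \<in> K \<Longrightarrow> inj (\<lambda>j. (\<psi> ^^ \<tau> j) x)"
  shows "\<exists>h. Cp_on p \<Omega> h \<and> (\<forall>x\<in>K. \<forall>y\<in>K. 0 < defect \<tau> h (\<lambda>_. 1) x y)"
proof -
  define good where "good x0 r \<longleftrightarrow> 0 < r \<and> (\<exists>\<phi>. (\<forall>n i. Ck n UNIV (\<phi> i)) \<and> (\<forall>i x. \<phi> i x \<in> {0..1::real}) \<and>
    (\<forall>x\<in>cball x0 r. \<forall>i j. \<phi> i ((\<psi> ^^ \<tau> j) x) = (if i = j then 1 else 0)))" for x0 r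
  have "\<exists>r. good x0 r" if x0: "x0 \<in> K" for x0
  proof -
    from separating_bumps[OF subsetD[OF K(2) x0] inj[OF x0]] obtain \<phi> r where
      "0 < r" "\<forall>n i. Ck n UNIV (\<phi> i)" "\<forall>i x. \<phi> i x \<in> {0..1::real}"
      "\<forall>x\<in>cball x0 r. \<forall>i j. \<phi> i ((\<psi> ^^ \<tau> j) x) = (if i = j then 1 else 0)" by (elim exE conjE)
    then show ?thesis unfolding good_def by (intro exI[of _ r] conjI exI[of _ \<phi>])
  qed
  then obtain r where r: "\<And>x0. x0 \<in> K \<Longrightarrow> good x0 (r x0)" by metis
  have "K \<subseteq> (\<Union>x0\<in>K. ball x0 (r x0))" using r by (auto simp: good_def)
  then obtain F where F: "F \<subseteq> K" "finite F" "K \<subseteq> (\<Union>x0\<in>F. ball x0 (r x0))"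
    using compactE_image[OF K(1), of K "\<lambda>x0. ball x0 (r x0)"] by auto
  have "\<exists>h. Cp_on p \<Omega> h \<and> (\<forall>x\<in>(\<Union>x0\<in>F. cball x0 (r x0)) \<inter> K. \<forall>y\<in>K. 0 < defect \<tau> h (\<lambda>_. 1) x y)"
    using F(2,1)
  proof (induction F rule: finite_induct)
    case empty
    then show ?case using Cp_on_const[OF open_\<Omega>] by auto
  next
    case (insert x0 F)
    then obtain h where h: "Cp_on p \<Omega> h" "\<forall>x\<in>(\<Union>x0\<in>F. cball x0 (r x0)) \<inter> K. \<forall>y\<in>K. 0 < defect \<tau> h (\<lambda>_. 1) x y"
      by auto
    have "good x0 (r x0)" using r insert.prems by simp
    then obtain \<phi> where \<phi>: "\<forall>n i. Ck n UNIV (\<phi> i)" "\<forall>i x. \<phi> i x \<in> {0..1::real}"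
      "\<forall>x\<in>cball x0 (r x0). \<forall>i j. \<phi> i ((\<psi> ^^ \<tau> j) x) = (if i = j then 1 else 0)"
      unfolding good_def by (elim exE conjE)
    have A: "compact ((\<Union>x0\<in>F. cball x0 (r x0)) \<inter> K)" "(\<Union>x0\<in>F. cball x0 (r x0)) \<inter> K \<subseteq> K"
      using insert.hyps K(1) by (auto intro!: closed_Int_compact closed_UN)
    have "\<exists>h'. Cp_on p \<Omega> h' \<and> (\<forall>x\<in>(\<Union>x0\<in>F. cball x0 (r x0)) \<inter> K \<union> cball x0 (r x0) \<inter> K. \<forall>y\<in>K. 0 < defect \<tau> h' (\<lambda>_. 1) x y)"
      by (rule defect_perturb[OF nd h(1) K A, of \<tau> \<phi>]) (use h(2) \<phi> in auto)
    then show ?case by (simp add: Int_Un_distrib2 Un_commute)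
  qed
  then obtain h where h: "Cp_on p \<Omega> h" "\<forall>x\<in>(\<Union>x0\<in>F. cball x0 (r x0)) \<inter> K. \<forall>y\<in>K. 0 < defect \<tau> h (\<lambda>_. 1) x y"
    by blast
  have "K \<subseteq> (\<Union>x0\<in>F. cball x0 (r x0)) \<inter> K" using F(3) by force
  then show ?thesis using h by blast
qed

lemma supercyclic_along_run_away:
  assumes sc: "supercyclic_along S" and K: "compact K" "K \<subseteq> \<Omega>"
  shows "\<exists>n\<in>S. (\<psi> ^^ n) ` K \<inter> K = {}"
proof (rule ccontr)
  assume *: "\<not> (\<exists>n\<in>S. (\<psi> ^^ n) ` K \<inter> K = {})"
  have nd: nondegenerate using sc by (rule supercyclic_along_imp_nondegenerate)
  obtain \<tau> :: "('d + 'd + bool) \<Rightarrow> nat" where \<tau>: "inj \<tau>"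
    using finite_imp_inj_to_nat_seg[OF finite[of "UNIV :: ('d + 'd + bool) set"]] by auto
  have ne: "(\<psi> ^^ i) x \<noteq> (\<psi> ^^ j) x" if "i < j" "x \<in> \<Omega>" for i j x
  proof
    assume "(\<psi> ^^ i) x = (\<psi> ^^ j) x"
    moreover have "(\<psi> ^^ j) x = (\<psi> ^^ i) ((\<psi> ^^ (j - i)) x)"
      using that by (metis add_diff_inverse_nat comp_apply funpow_add less_imp_not_less)
    ultimately have "x = (\<psi> ^^ (j - i)) x"
      using iter_inj[OF nd, of i] that iter_in unfolding inj_on_def by metis
    then show False using no_periodic_point[OF sc that(2), of "j - i"] that by simp
  qed
  have inj: "inj (\<lambda>j. (\<psi> ^^ \<tau> j) x)" if "x \<in> K" for x
    unfolding inj_on_def using ne \<tau> K(2) that by (metis injD linorder_neqE_nat subsetD)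
  from ex_positive_defect[OF nd K inj] obtain h where
    h: "Cp_on p \<Omega> h" "\<forall>x\<in>K. \<forall>y\<in>K. 0 < defect \<tau> h (\<lambda>_. 1) x y" by blast
  define Z where "Z = K \<union> (\<Union>j. (\<psi> ^^ \<tau> j) ` K)"
  have Z: "compact Z" "Z \<subseteq> \<Omega>"
    unfolding Z_def using K iter_compact[OF K] iter_in by (auto intro!: compact_Un compact_UN)
  obtain \<delta> where \<delta>: "\<delta> > 0" "\<delta> \<le> 1" "\<forall>u f. (\<forall>z\<in>Z. norm (u z - h z) < \<delta> \<and> norm (f z - 1) < \<delta>) \<longrightarrow>
    (\<forall>x\<in>K. \<forall>y\<in>K. 0 < defect \<tau> u f x y)"
    using defect_robust[OF Cp_on_continuous_on[OF h(1)] K K(1) subset_refl, of \<tau>] h(2) unfolding Z_def by blast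
  have "S \<noteq> {}"
  proof
    assume "S = {}"
    then have "Cp_carrier p \<Omega> = ({} :: (real^'d \<Rightarrow> 'k) set)" using sc by (simp add: supercyclic_along_def)
    then show False using const_carrier by blast
  qed
  then obtain x1 where x1: "x1 \<in> K" using * by blast
  then have x1Z: "x1 \<in> Z" "x1 \<in> \<Omega>" using K by (auto simp: Z_def)
  from supercyclic_along_approx[OF sc const_carrier[of 1] restrict_Cp_carrier[OF open_\<Omega> h(1)] Z \<delta>(1) x1Z(1)]
  obtain f n c where f: "n \<in> S" "\<forall>x\<in>Z. norm (f x - restrict (\<lambda>x. 1) \<Omega> x) < \<delta>"
    "\<forall>x\<in>Z. norm (c * (C ^^ n) f x - restrict h \<Omega> x) < \<delta>"
    using \<delta>(2) x1Z by auto
  have "(\<psi> ^^ n) ` K \<inter> K \<noteq> {}" using * f(1) by blast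
  then obtain x where x: "x \<in> K" "(\<psi> ^^ n) x \<in> K" by auto
  have "0 < defect \<tau> (\<lambda>z. c * (C ^^ n) f z) f x ((\<psi> ^^ n) x)"
    using \<delta>(3)[rule_format, of "\<lambda>z. c * (C ^^ n) f z" f] f(2,3) x Z(2) by (auto simp: subset_iff)
  then show False using defect_orbit[of x \<tau> c n f] x K by auto
qed

text \<open>Where \<open>x\<close> and \<open>y = \<psi>\<^sup>n x\<close> both lie in \<open>K\<close>, the quotient of \<open>C\<^sup>n f\<^sub>2\<close> and \<open>C\<^sup>n f\<^sub>1\<close> at \<open>x\<close> is
  that of \<open>f\<^sub>2\<close> and \<open>f\<^sub>1\<close> at \<open>y\<close>; but the first is close to \<open>3\<close> and the second to \<open>1\<close>.\<close>

lemma ex_ratio_sets: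
  assumes K: "compact K" "K \<subseteq> \<Omega>"
  shows "\<exists>U V. openin X U \<and> openin X V \<and> U \<noteq> {} \<and> V \<noteq> {} \<and>
    (\<forall>n. (C ^^ n) ` U \<inter> U \<noteq> {} \<and> (C ^^ n) ` U \<inter> V \<noteq> {} \<longrightarrow> (\<psi> ^^ n) ` K \<inter> K = {})"
proof -
  have p0: "enat 0 \<le> p" by (simp flip: zero_enat_def)
  have ex: "\<exists>U. openin X U \<and> U \<noteq> {} \<and> (\<forall>f\<in>U. \<forall>x\<in>K. norm (f x - a) < 1 / 4)" for a :: 'k
  proof -
    obtain U where U: "openin X U" "restrict (\<lambda>x. a) \<Omega> \<in> U" "U \<subseteq> Cp_nbhd p \<Omega> (restrict (\<lambda>x. a) \<Omega>) K 0 (1 / 4)"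
      using Cp_nbhd_open[OF open_\<Omega> const_carrier[of a] K p0, of "1 / 4"] by auto
    have "norm (f x - a) < 1 / 4" if "f \<in> U" "x \<in> K" for f x
      using Cp_nbhd_0D[OF subsetD[OF U(3) that(1)] that(2)] that(2) K(2) by auto
    then show ?thesis using U(1,2) by (intro exI[of _ U]) auto
  qed
  from ex[of 1] obtain U where U: "openin X U" "U \<noteq> {}" "\<forall>f\<in>U. \<forall>x\<in>K. norm (f x - 1) < 1 / 4" by (elim exE conjE)
  from ex[of 3] obtain V where V: "openin X V" "V \<noteq> {}" "\<forall>f\<in>V. \<forall>x\<in>K. norm (f x - 3) < 1 / 4" by (elim exE conjE)
  have "(\<psi> ^^ n) ` K \<inter> K = {}" if n: "(C ^^ n) ` U \<inter> U \<noteq> {}" "(C ^^ n) ` U \<inter> V \<noteq> {}" for n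
  proof (rule ccontr)
    assume "(\<psi> ^^ n) ` K \<inter> K \<noteq> {}"
    then obtain x where x: "x \<in> K" "(\<psi> ^^ n) x \<in> K" by auto
    define y where "y = (\<psi> ^^ n) x"
    obtain f1 where f1: "f1 \<in> U" "(C ^^ n) f1 \<in> U" using n(1) by auto
    obtain f2 where f2: "f2 \<in> U" "(C ^^ n) f2 \<in> V" using n(2) by auto
    have x\<Omega>: "x \<in> \<Omega>" using x K by auto
    have eq: "(C ^^ n) f1 x * f2 y = (C ^^ n) f2 x * f1 y"
      using x\<Omega> by (simp add: C_iter y_def)
    have near: "norm z \<le> norm a + 1 / 4" "norm a - 1 / 4 \<le> norm z" if "norm (z - a) < 1 / 4" for z a :: 'k
      using that norm_triangle_ineq2[of z a] norm_triangle_ineq2[of a z] by (auto simp: norm_minus_commute)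
    have "norm ((C ^^ n) f1 x * f2 y) \<le> (5 / 4) * (5 / 4)"
      unfolding norm_mult using U(3) f1(2) f2(1) x near[of _ 1] by (intro mult_mono) (auto simp: y_def)
    moreover have "(11 / 4) * (3 / 4) \<le> norm ((C ^^ n) f2 x * f1 y)"
      unfolding norm_mult using U(3) V(3) f1(1) f2(2) x near(2)[of _ 1] near(2)[of _ 3]
      by (intro mult_mono) (auto simp: y_def)
    ultimately show False using eq by simp
  qed
  then show ?thesis using U V by (intro exI[of _ U] exI[of _ V]) simp
qed

lemma weakly_mixing_pair:
  assumes wm: "weakly_mixing X C" and op: "openin X U1" "openin X U2" "openin X V1" "openin X V2"
    and ne: "U1 \<noteq> {}" "U2 \<noteq> {}" "V1 \<noteq> {}" "V2 \<noteq> {}"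
  shows "\<exists>n. (C ^^ n) ` U1 \<inter> V1 \<noteq> {} \<and> (C ^^ n) ` U2 \<inter> V2 \<noteq> {}"
proof -
  have "openin (prod_topology X X) (U1 \<times> U2) \<and> openin (prod_topology X X) (V1 \<times> V2) \<and> U1 \<times> U2 \<noteq> {} \<and> V1 \<times> V2 \<noteq> {}"
    using op ne by (simp add: openin_prod_Times_iff)
  from wm[unfolded weakly_mixing_def transitive_def, rule_format, OF this]
  obtain n where n: "(map_prod C C ^^ n) ` (U1 \<times> U2) \<inter> (V1 \<times> V2) \<noteq> {}" by (elim exE)
  have "map_prod C C ^^ n = map_prod (C ^^ n) (C ^^ n)"
    by (induction n) (auto simp: fun_eq_iff)
  then have "(map_prod C C ^^ n) ` (U1 \<times> U2) = ((C ^^ n) ` U1) \<times> ((C ^^ n) ` U2)"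
    by (simp add: map_prod_surj_on[OF refl refl])
  then show ?thesis using n by (intro exI[of _ n]) (simp add: Times_Int_Times)
qed

lemma weakly_mixing_run_away:
  assumes wm: "weakly_mixing X C"
  shows "run_away \<Omega> \<psi>"
  unfolding run_away_def
proof (intro allI impI)
  fix K assume K: "compact K \<and> K \<subseteq> \<Omega>"
  from ex_ratio_sets[OF conjunct1[OF K] conjunct2[OF K]] obtain U V where
    UV: "openin X U" "openin X V" "U \<noteq> {}" "V \<noteq> {}"
      "\<forall>n. (C ^^ n) ` U \<inter> U \<noteq> {} \<and> (C ^^ n) ` U \<inter> V \<noteq> {} \<longrightarrow> (\<psi> ^^ n) ` K \<inter> K = {}"
    by (elim exE conjE)
  from weakly_mixing_pair[OF wm UV(1,1,1,2) UV(3,3,3,4)] obtain n where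
    "(C ^^ n) ` U \<inter> U \<noteq> {} \<and> (C ^^ n) ` U \<inter> V \<noteq> {}" by (elim exE)
  then have n: "(\<psi> ^^ n) ` K \<inter> K = {}" using UV(5) by simp
  show "\<exists>n\<ge>1. (\<psi> ^^ n) ` K \<inter> K = {}"
  proof (cases "n = 0")
    case True
    then have "K = {}" using n by simp
    then show ?thesis by auto
  next
    case False
    then show ?thesis using n by (intro exI[of _ n]) auto
  qed
qed

lemma mixing_strongly_run_away:
  assumes "mixing X C"
  shows "strongly_run_away \<Omega> \<psi>"
  unfolding strongly_run_away_def
proof (intro allI impI)
  fix K assume K: "compact K \<and> K \<subseteq> \<Omega>"
  from ex_ratio_sets[OF conjunct1[OF K] conjunct2[OF K]] obtain U V where
    UV: "openin X U" "openin X V" "U \<noteq> {}" "V \<noteq> {}"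
      "\<forall>n. (C ^^ n) ` U \<inter> U \<noteq> {} \<and> (C ^^ n) ` U \<inter> V \<noteq> {} \<longrightarrow> (\<psi> ^^ n) ` K \<inter> K = {}"
    by (elim exE conjE)
  from assms[unfolded mixing_def, rule_format, of U U] UV(1,3)
  obtain N1 where N1: "\<forall>n\<ge>N1. (C ^^ n) ` U \<inter> U \<noteq> {}" by auto
  from assms[unfolded mixing_def, rule_format, of U V] UV(1-4)
  obtain N2 where N2: "\<forall>n\<ge>N2. (C ^^ n) ` U \<inter> V \<noteq> {}" by auto
  show "\<exists>N. \<forall>n\<ge>N. (\<psi> ^^ n) ` K \<inter> K = {}"
    using N1 N2 UV(5) by (intro exI[of _ "max N1 N2"]) simp
qed

lemma weakly_mixing_imp_transitive:
  assumes "weakly_mixing X C"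
  shows "transitive X C"
  unfolding transitive_def
proof (intro allI impI)
  fix U V assume UV: "openin X U \<and> openin X V \<and> U \<noteq> {} \<and> V \<noteq> {}"
  then have "\<exists>n. (C ^^ n) ` U \<inter> V \<noteq> {} \<and> (C ^^ n) ` U \<inter> V \<noteq> {}"
    by (intro weakly_mixing_pair[OF assms]) simp_all
  then show "\<exists>n. (C ^^ n) ` U \<inter> V \<noteq> {}" by simp
qed

lemma mixing_imp_transitive:
  assumes "mixing X C"
  shows "transitive X C"
  unfolding transitive_def
proof (intro allI impI)
  fix U V assume "openin X U \<and> openin X V \<and> U \<noteq> {} \<and> V \<noteq> {}"
  from assms[unfolded mixing_def, rule_format, OF this]
  obtain N where "\<forall>n\<ge>N. (C ^^ n) ` U \<inter> V \<noteq> {}" by (elim exE)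
  then show "\<exists>n. (C ^^ n) ` U \<inter> V \<noteq> {}" by (intro exI[of _ N]) simp
qed

lemma weakly_mixing_iff: "weakly_mixing X C \<longleftrightarrow> nondegenerate \<and> run_away \<Omega> \<psi>"
  by (intro iffI conjI weakly_mixing_run_away transitive_imp_nondegenerate weakly_mixing_imp_transitive)
    (auto intro: weakly_mixingI)

lemma mixing_iff: "mixing X C \<longleftrightarrow> nondegenerate \<and> strongly_run_away \<Omega> \<psi>"
  by (intro iffI conjI mixing_strongly_run_away transitive_imp_nondegenerate mixing_imp_transitive)
    (auto intro: mixingI)

lemma supercyclic_along_iff:
  "supercyclic_along S \<longleftrightarrow> nondegenerate \<and> (\<forall>K. compact K \<and> K \<subseteq> \<Omega> \<longrightarrow> (\<exists>n\<in>S. (\<psi> ^^ n) ` K \<inter> K = {}))"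
proof
  assume "supercyclic_along S"
  then show "nondegenerate \<and> (\<forall>K. compact K \<and> K \<subseteq> \<Omega> \<longrightarrow> (\<exists>n\<in>S. (\<psi> ^^ n) ` K \<inter> K = {}))"
    using supercyclic_along_run_away by (simp add: supercyclic_along_imp_nondegenerate)
next
  assume "nondegenerate \<and> (\<forall>K. compact K \<and> K \<subseteq> \<Omega> \<longrightarrow> (\<exists>n\<in>S. (\<psi> ^^ n) ` K \<inter> K = {}))"
  then show "supercyclic_along S" by (intro supercyclic_alongI) auto
qed

lemma supercyclic_iff: "supercyclic X (fun_scale \<Omega>) C \<longleftrightarrow> nondegenerate \<and> run_away \<Omega> \<psi>"
proof -
  have "(\<exists>n. (\<psi> ^^ n) ` K \<inter> K = {}) \<longleftrightarrow> (\<exists>n\<ge>1. (\<psi> ^^ n) ` K \<inter> K = {})" for K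
  proof
    assume "\<exists>n. (\<psi> ^^ n) ` K \<inter> K = {}"
    then obtain n where n: "(\<psi> ^^ n) ` K \<inter> K = {}" ..
    show "\<exists>n\<ge>1. (\<psi> ^^ n) ` K \<inter> K = {}"
    proof (cases "n = 0")
      case True
      then show ?thesis using n by auto
    next
      case False
      then show ?thesis using n by (intro exI[of _ n]) auto
    qed
  qed auto
  moreover have "supercyclic X (fun_scale \<Omega>) C \<longleftrightarrow> supercyclic_along UNIV"
    by (simp add: supercyclic_def supercyclic_along_def)
  ultimately show ?thesis by (simp add: supercyclic_along_iff run_away_def)
qed

lemma strongly_supercyclic_iff_along:
  "strongly_supercyclic X (fun_scale \<Omega>) C \<longleftrightarrow>
     (\<forall>m :: nat \<Rightarrow> nat. strict_mono m \<and> (\<forall>k. 0 < m k) \<longrightarrow> supercyclic_along (insert 0 (range m)))"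
proof -
  have "{fun_scale \<Omega> c h | c h. h \<in> insert g (range (\<lambda>k. (C ^^ m k) g))} =
      {fun_scale \<Omega> c ((C ^^ n) g) | c n. n \<in> insert 0 (range m)}" for g :: "real^'d \<Rightarrow> 'k" and m :: "nat \<Rightarrow> nat"
  proof -
    have 1: "insert g (range (\<lambda>k. (C ^^ m k) g)) = (\<lambda>n. (C ^^ n) g) ` insert 0 (range m)"
      by (simp add: image_image)
    have 2: "{F c h | c h. h \<in> k ` A} = {F c (k n) | c n. n \<in> A}"
      for F :: "'k \<Rightarrow> (real^'d \<Rightarrow> 'k) \<Rightarrow> real^'d \<Rightarrow> 'k" and k and A :: "nat set" by blast
    show ?thesis unfolding 1 2 ..
  qed
  then show ?thesis by (simp add: strongly_supercyclic_def supercyclic_along_def)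
qed

lemma strongly_supercyclic_iff:
  "strongly_supercyclic X (fun_scale \<Omega>) C \<longleftrightarrow> nondegenerate \<and> strongly_run_away \<Omega> \<psi>"
proof
  assume "strongly_supercyclic X (fun_scale \<Omega>) C"
  then have sc: "supercyclic_along (insert 0 (range m))" if "strict_mono m" "\<forall>k. 0 < m k" for m :: "nat \<Rightarrow> nat"
    using iffD1[OF strongly_supercyclic_iff_along, rule_format, OF _ conjI] that by simp
  have "nondegenerate"
    using sc[of Suc] supercyclic_along_imp_nondegenerate by (simp add: strict_mono_Suc_iff)
  moreover have "strongly_run_away \<Omega> \<psi>"
  proof (rule ccontr)
    assume "\<not> strongly_run_away \<Omega> \<psi>"
    then obtain K where K: "compact K" "K \<subseteq> \<Omega>" "\<forall>N. \<exists>n\<ge>N. (\<psi> ^^ n) ` K \<inter> K \<noteq> {}"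
      unfolding strongly_run_away_def by meson
    define B where "B = {n. 0 < n \<and> (\<psi> ^^ n) ` K \<inter> K \<noteq> {}}"
    have "infinite B"
      unfolding infinite_nat_iff_unbounded_le
    proof
      fix N
      obtain n where "n \<ge> Suc N" "(\<psi> ^^ n) ` K \<inter> K \<noteq> {}" using K(3) by blast
      then show "\<exists>n\<ge>N. n \<in> B" by (intro exI[of _ n]) (auto simp: B_def)
    qed
    have "\<forall>k. 0 < enumerate B k"
      using enumerate_in_set[OF \<open>infinite B\<close>] by (auto simp: B_def)
    then have "supercyclic_along (insert 0 (range (enumerate B)))"
      using sc strict_mono_enumerate[OF \<open>infinite B\<close>] by blast
    then obtain n where n: "n \<in> insert 0 B" "(\<psi> ^^ n) ` K \<inter> K = {}"
      using supercyclic_along_run_away[OF _ K(1,2)] range_enumerate[OF \<open>infinite B\<close>] by metis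
    have "K \<noteq> {}" using K(3) by auto
    then show False using n by (auto simp: B_def)
  qed
  ultimately show "nondegenerate \<and> strongly_run_away \<Omega> \<psi>" ..
next
  assume *: "nondegenerate \<and> strongly_run_away \<Omega> \<psi>"
  have "\<exists>n\<in>insert 0 (range m). (\<psi> ^^ n) ` K \<inter> K = {}"
    if m: "strict_mono m" and K: "compact K" "K \<subseteq> \<Omega>" for m :: "nat \<Rightarrow> nat" and K
  proof -
    obtain N where "\<forall>n\<ge>N. (\<psi> ^^ n) ` K \<inter> K = {}"
      using * K unfolding strongly_run_away_def by blast
    then have "(\<psi> ^^ m N) ` K \<inter> K = {}"
      using strict_mono_imp_increasing[OF m, of N] by blast
    then show ?thesis by (intro bexI[of _ "m N"]) auto
  qed
  then show "strongly_supercyclic X (fun_scale \<Omega>) C"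
    using * by (simp add: strongly_supercyclic_iff_along supercyclic_along_iff)
qed

end

theorem theorem2p1:
  fixes \<Omega> :: "(real^'d::finite) set"
    and p :: enat
    and \<psi> :: "real^'d \<Rightarrow> real^'d"
    and \<omega> :: "real^'d \<Rightarrow> 'k::{real_normed_field,euclidean_space}"
  defines "X \<equiv> (Cp_topology p \<Omega> :: (real^'d \<Rightarrow> 'k) topology)"
    and "C \<equiv> weighted_comp \<Omega> \<omega> \<psi>"
  assumes "open \<Omega>" and "1 \<le> p" and "Cp_self_map p \<Omega> \<psi>" and "Cp_on p \<Omega> \<omega>"
  shows
    "(supercyclic X (fun_scale \<Omega>) C \<longleftrightarrow> weakly_mixing X C) \<and>
     (weakly_mixing X C \<longleftrightarrow>
        (\<forall>x\<in>\<Omega>. \<omega> x \<noteq> 0) \<and> inj_on \<psi> \<Omega> \<and> (\<forall>x\<in>\<Omega>. det (jacobian \<psi> (at x)) \<noteq> 0) \<and>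
        run_away \<Omega> \<psi>) \<and>
     (strongly_supercyclic X (fun_scale \<Omega>) C \<longleftrightarrow> mixing X C) \<and>
     (mixing X C \<longleftrightarrow>
        strongly_run_away \<Omega> \<psi> \<and>
        (\<forall>x\<in>\<Omega>. \<omega> x \<noteq> 0) \<and> inj_on \<psi> \<Omega> \<and> (\<forall>x\<in>\<Omega>. det (jacobian \<psi> (at x)) \<noteq> 0))"
proof -
  interpret weighted_composition \<Omega> p \<psi> \<omega>
    using assms(3-6) by unfold_locales
  show ?thesis
    unfolding X_def C_def supercyclic_iff weakly_mixing_iff strongly_supercyclic_iff mixing_iff nondegenerate_def
    by blast
qed

end
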